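(* Let $\dot x = f(x) + g_1(x)u^1 + g_2(x)u^2$ be a smooth two-input control-affine system on an $n$-dimensional manifold, let $y=(\varphi^1(x),\varphi^2(x))$ be an $x$-flat output of it, and let $d = \#R - n$ be its differential difference. Then there is an integer $\nu$ with $0\le\nu\le d$ such that the system obtained by $\nu$-fold prolonging each input is static feedback equivalent to the general triangular form (GTF) in such a way that the components of $y$ appear as $(z^1, z^{k_1+1})$ in the GTF.
   Context: All objects are smooth, distributions/codistributions are assumed of locally constant rank, and statements are local, at generic points. For a system $\dot x = f(x,u)$ with $m$ inputs, a flat output is an $m$-tuple of smooth functions $\varphi^j(x,u,\dots,u_{[\nu]})$ (where $u_{[\alpha]}$ denotes the $\alpha$-th time derivative) such that locally $x^i = F_x^i(\varphi_{[0,R-1]})$ and $u^j = F_u^j(\varphi_{[0,R]})$ for smooth $F_x,F_u$ and a multi-index $R=(r_1,\dots,r_m)$; here $\varphi_{[0,R]}$ means $\varphi^j$ and its time derivatives up to order $r_j$ for each $j$. The multi-index $R$ is locally unique for a given flat output, $\#R=r_1+\dots+r_m$, and $d=\#R-n$ is called the differential difference. The system is $x$-flat if it has a flat output depending on $x$ only. The $\nu$-fold prolongation of each input of $\dot x = f(x)+g_1(x)u^1+g_2(x)u^2$ is the system with state $(x,u,u_{[1]},\dots,u_{[\nu-1]})$, input $u_{[\nu]}$ and dynamics $\dot x = f+g_1u^1+g_2u^2$, $\frac{d}{dt}u_{[\alpha]} = u_{[\alpha+1]}$ for $\alpha=0,\dots,\nu-1$ (for $\nu=0$ it is the original system). A system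 $\dot x = f(x,u)$ is static feedback equivalent to $\dot z = g(z,v)$ if there exist a (local) invertible state transformation $z=\Phi_x(x)$ and input transformation $v=\Phi_u(x,u)$, jointly invertible, transforming the first system into the second. The general triangular form (GTF) with integers $k_1,k_2\ge 1$, $k_1+k_2\le N$ ($N$ the state dimension), states $z^1,\dots,z^N$ and inputs $v^1,v^2$ is: $\dot z^i = z^{i+1}$ for $i=1,\dots,k_1-1$; $\dot z^{k_1} = v^1$; $\dot z^i = z^{i+1}$ for $i=k_1+1,\dots,k_1+k_2-1$; $\dot z^l = a^l(z^1,\dots,z^{l+1}) + b^l(z^1,\dots,z^{l+1})\,v^1$ for $l=k_1+k_2,\dots,N-1$; $\dot z^N = v^2$; where $b^{k_1+k_2}\neq 0$ and, for each $l=k_1+k_2,\dots,N-1$, $\partial_{z^{l+1}}a^l\neq 0$ or $\partial_{z^{l+1}}b^l\neq 0$. Its $x$-flat output is $(z^1,z^{k_1+1})$. *)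

theory Defs
  imports "HOL-Analysis.Analysis"
begin

text \<open>Coordinates. Points of R^m are modelled as functions nat => real vanishing
  at indices >= m. Points of the (infinite) jet space of the system are arbitrary
  functions nat => real, with the encoding: x^i is coordinate i (i < n), and the
  alpha-th time derivative of input u^(j+1) (j = 0,1) is coordinate n + 2*alpha + j.
  With this encoding the state of the nu-fold prolonged system is given by the
  coordinates < n + 2 nu and its input by the coordinates n + 2 nu, n + 2 nu + 1.\<close>

definition Rsp :: "nat \<Rightarrow> (nat \<Rightarrow> real) set" where
  "Rsp m = {p. \<forall>i\<ge>m. p i = 0}"

definition tr :: "nat \<Rightarrow> (nat \<Rightarrow> real) \<Rightarrow> nat \<Rightarrow> real" where
  "tr m p = (\<lambda>i. if i < m then p i else 0)"

definition ropen :: "nat \<Rightarrow> (nat \<Rightarrow> real) set \<Rightarrow> bool" where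
  "ropen m U \<longleftrightarrow> U \<subseteq> Rsp m \<and> openin (top_of_set (Rsp m)) U"

definition pd :: "nat \<Rightarrow> ((nat \<Rightarrow> real) \<Rightarrow> real) \<Rightarrow> (nat \<Rightarrow> real) \<Rightarrow> real" where
  "pd i h p = deriv (\<lambda>t. h (p(i := t))) (p i)"

fun ipd :: "nat list \<Rightarrow> ((nat \<Rightarrow> real) \<Rightarrow> real) \<Rightarrow> (nat \<Rightarrow> real) \<Rightarrow> real" where
  "ipd [] h = h"
| "ipd (i # is) h = pd i (ipd is h)"

definition smooth_fun :: "nat \<Rightarrow> (nat \<Rightarrow> real) set \<Rightarrow> ((nat \<Rightarrow> real) \<Rightarrow> real) \<Rightarrow> bool" where
  "smooth_fun m U h \<longleftrightarrow> ropen m U \<and>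
     (\<forall>is. set is \<subseteq> {..<m} \<longrightarrow>
        (\<forall>p\<in>U. \<forall>i<m. (\<lambda>t. ipd is h (p(i := t))) differentiable (at (p i))) \<and>
        continuous_on U (ipd is h))"

definition diffeo :: "nat \<Rightarrow> (nat \<Rightarrow> real) set \<Rightarrow> (nat \<Rightarrow> real) set
                       \<Rightarrow> ((nat \<Rightarrow> real) \<Rightarrow> nat \<Rightarrow> real) \<Rightarrow> bool" where
  "diffeo m U V \<Theta> \<longleftrightarrow> ropen m U \<and> ropen m V \<and> bij_betw \<Theta> U V \<and>
     (\<forall>i<m. smooth_fun m U (\<lambda>p. \<Theta> p i)) \<and>
     (\<forall>i<m. smooth_fun m V (\<lambda>w. the_inv_into U \<Theta> w i))"

text \<open>Smooth two-input control-affine system xdot = f(x) + g1(x) u^1 + g2(x) u^2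
  on the open set X of R^n (a chart of the state manifold).\<close>
definition affine2_system :: "nat \<Rightarrow> (nat \<Rightarrow> real) set
    \<Rightarrow> (nat \<Rightarrow> (nat \<Rightarrow> real) \<Rightarrow> real) \<Rightarrow> (nat \<Rightarrow> (nat \<Rightarrow> real) \<Rightarrow> real)
    \<Rightarrow> (nat \<Rightarrow> (nat \<Rightarrow> real) \<Rightarrow> real) \<Rightarrow> bool" where
  "affine2_system n X f g1 g2 \<longleftrightarrow> ropen n X \<and>
     (\<forall>i<n. smooth_fun n X (f i) \<and> smooth_fun n X (g1 i) \<and> smooth_fun n X (g2 i))"

text \<open>Total time derivative along the system (and its prolongations) of a function h
  of the jet coordinates < m (m >= n).\<close>
definition tder :: "nat \<Rightarrow> (nat \<Rightarrow> (nat \<Rightarrow> real) \<Rightarrow> real) \<Rightarrow> (nat \<Rightarrow> (nat \<Rightarrow> real) \<Rightarrow> real)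
    \<Rightarrow> (nat \<Rightarrow> (nat \<Rightarrow> real) \<Rightarrow> real) \<Rightarrow> nat \<Rightarrow> ((nat \<Rightarrow> real) \<Rightarrow> real) \<Rightarrow> (nat \<Rightarrow> real) \<Rightarrow> real" where
  "tder n f g1 g2 m h p =
     (\<Sum>i<n. (f i (tr n p) + g1 i (tr n p) * p n + g2 i (tr n p) * p (Suc n)) * pd i h (tr m p))
   + (\<Sum>c\<in>{n..<m}. p (c + 2) * pd c h (tr m p))"

fun jder :: "nat \<Rightarrow> (nat \<Rightarrow> (nat \<Rightarrow> real) \<Rightarrow> real) \<Rightarrow> (nat \<Rightarrow> (nat \<Rightarrow> real) \<Rightarrow> real)
    \<Rightarrow> (nat \<Rightarrow> (nat \<Rightarrow> real) \<Rightarrow> real) \<Rightarrow> nat \<Rightarrow> ((nat \<Rightarrow> real) \<Rightarrow> real) \<Rightarrow> (nat \<Rightarrow> real) \<Rightarrow> real" where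
  "jder n f g1 g2 0 h = (\<lambda>p. h (tr n p))"
| "jder n f g1 g2 (Suc k) h = tder n f g1 g2 (n + 2 * k) (jder n f g1 g2 k h)"

text \<open>(phi1, phi2), functions of x, is an x-flat output with multi-index R = (r1, r2)
  on the nonempty open set Om of jet space: x = F_x(phi_[0,R-1]), u = F_u(phi_[0,R])
  on Om, with F_x, F_u smooth.  The arguments phi_[0,R-1] are arranged as a point of
  R^(r1+r2) (phi1_[0..r1-1], then phi2_[0..r2-1]) and phi_[0,R] as a point of
  R^(r1+r2+2).\<close>
definition x_flat_output :: "nat \<Rightarrow> (nat \<Rightarrow> (nat \<Rightarrow> real) \<Rightarrow> real) \<Rightarrow> (nat \<Rightarrow> (nat \<Rightarrow> real) \<Rightarrow> real)
    \<Rightarrow> (nat \<Rightarrow> (nat \<Rightarrow> real) \<Rightarrow> real) \<Rightarrow> (nat \<Rightarrow> real) set \<Rightarrow> (nat \<Rightarrow> real) set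
    \<Rightarrow> ((nat \<Rightarrow> real) \<Rightarrow> real) \<Rightarrow> ((nat \<Rightarrow> real) \<Rightarrow> real) \<Rightarrow> nat \<Rightarrow> nat \<Rightarrow> bool" where
  "x_flat_output n f g1 g2 X Om \<phi>1 \<phi>2 r1 r2 \<longleftrightarrow>
     smooth_fun n X \<phi>1 \<and> smooth_fun n X \<phi>2 \<and> open Om \<and> Om \<noteq> {} \<and> (\<forall>p\<in>Om. tr n p \<in> X) \<and>
     (let Yx = (\<lambda>p k. if k < r1 then jder n f g1 g2 k \<phi>1 p
                      else if k < r1 + r2 then jder n f g1 g2 (k - r1) \<phi>2 p else 0);
          Yu = (\<lambda>p k. if k < r1 + 1 then jder n f g1 g2 k \<phi>1 p
                      else if k < r1 + r2 + 2 then jder n f g1 g2 (k - (r1 + 1)) \<phi>2 p else 0)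
      in \<exists>Fx Fu V1 V2. ropen (r1 + r2) V1 \<and> ropen (r1 + r2 + 2) V2 \<and>
          (\<forall>i<n. smooth_fun (r1 + r2) V1 (Fx i)) \<and>
          (\<forall>j<2. smooth_fun (r1 + r2 + 2) V2 (Fu j)) \<and>
          (\<forall>p\<in>Om. Yx p \<in> V1 \<and> Yu p \<in> V2 \<and>
             (\<forall>i<n. p i = Fx i (Yx p)) \<and> (\<forall>j<2. p (n + j) = Fu j (Yu p))))"

text \<open>Right-hand side of the GTF, with 0-based state indices (paper's z^i is z (i-1)).\<close>
definition gtf_rhs :: "nat \<Rightarrow> nat \<Rightarrow> nat \<Rightarrow> (nat \<Rightarrow> (nat \<Rightarrow> real) \<Rightarrow> real)
    \<Rightarrow> (nat \<Rightarrow> (nat \<Rightarrow> real) \<Rightarrow> real) \<Rightarrow> (nat \<Rightarrow> real) \<Rightarrow> real \<Rightarrow> real \<Rightarrow> nat \<Rightarrow> real" where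
  "gtf_rhs k1 k2 N a b z v1 v2 i =
     (if i < k1 - 1 then z (i + 1)
      else if i = k1 - 1 then v1
      else if i < k1 + k2 - 1 then z (i + 1)
      else if i < N - 1 then a i z + b i z * v1
      else v2)"

text \<open>On the open set U of R^(N+2), N = n + 2 nu (coordinates: state of the nu-fold
  prolonged system followed by its input u_[nu]), the prolonged system is static
  feedback equivalent to a GTF, via z = Phi(xbar), v = Psi(xbar, u_[nu]), with
  (phi1, phi2) appearing as (z^1, z^(k1+1)) (in some order).\<close>
definition GTF_equiv :: "nat \<Rightarrow> (nat \<Rightarrow> (nat \<Rightarrow> real) \<Rightarrow> real) \<Rightarrow> (nat \<Rightarrow> (nat \<Rightarrow> real) \<Rightarrow> real)
    \<Rightarrow> (nat \<Rightarrow> (nat \<Rightarrow> real) \<Rightarrow> real) \<Rightarrow> ((nat \<Rightarrow> real) \<Rightarrow> real) \<Rightarrow> ((nat \<Rightarrow> real) \<Rightarrow> real)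
    \<Rightarrow> nat \<Rightarrow> (nat \<Rightarrow> real) set \<Rightarrow> bool" where
  "GTF_equiv n f g1 g2 \<phi>1 \<phi>2 \<nu> U \<longleftrightarrow>
     (let N = n + 2 * \<nu> in
      \<exists>k1 k2 a b \<Phi> \<Psi> Vx V.
        1 \<le> k1 \<and> 1 \<le> k2 \<and> k1 + k2 \<le> N \<and>
        diffeo N (tr N ` U) Vx \<Phi> \<and>
        diffeo (N + 2) U V
          (\<lambda>q i. if i < N then \<Phi> (tr N q) i else if i < N + 2 then \<Psi> q (i - N) else 0) \<and>
        (\<forall>l. k1 + k2 - 1 \<le> l \<and> l \<le> N - 2 \<longrightarrow>
           smooth_fun N Vx (a l) \<and> smooth_fun N Vx (b l) \<and>
           (\<forall>z z'. (\<forall>i<l + 2. z i = z' i) \<longrightarrow> a l z = a l z' \<and> b l z = b l z') \<and>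
           (\<forall>z\<in>Vx. pd (l + 1) (a l) z \<noteq> 0 \<or> pd (l + 1) (b l) z \<noteq> 0)) \<and>
        (k1 + k2 < N \<longrightarrow> (\<forall>z\<in>Vx. b (k1 + k2 - 1) z \<noteq> 0)) \<and>
        (\<forall>q\<in>U. \<forall>i<N.
           tder n f g1 g2 N (\<lambda>p. \<Phi> p i) q
             = gtf_rhs k1 k2 N a b (\<Phi> (tr N q)) (\<Psi> q 0) (\<Psi> q 1) i) \<and>
        ((\<forall>q\<in>U. \<Phi> (tr N q) 0 = \<phi>1 (tr n q) \<and> \<Phi> (tr N q) k1 = \<phi>2 (tr n q)) \<or>
         (\<forall>q\<in>U. \<Phi> (tr N q) 0 = \<phi>2 (tr n q) \<and> \<Phi> (tr N q) k1 = \<phi>1 (tr n q))))"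

end

(* A flat output is studied through the differentials of its derivatives psi_k, zeta_k along the
   total derivative D.  Let psi be a component whose derivatives eventually involve the input, say
   first psi_kappa, and use v1 = psi_kappa as one input, u2 being the other one.  Let zeta_K be the
   first derivative of the second component that involves u2 once the state and all derivatives of
   v1 are known, and zeta_kappa2 the first one that involves any input.  At generic points the
   differentials of psi_0, psi_1, ... and zeta_0, ..., zeta_(K-1) are independent, for otherwise a
   dependency would be propagated by D and zeta_K could not involve u2; and by flatness they exhaust
   the state, so that n = kappa + K.  Put nu = K - kappa2.  The functions psi_j (j < kappa + nu),
   zeta_j (j < K) and u2, D u2, ..., D^(nu-1) u2 are coordinates of the nu-fold prolonged system, and
   zeta_K = a + b psi_(kappa+nu), where b depends on x only and a on x, v1, ..., D^(nu-1) v1, u2: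
   this is the general triangular form.  Flatness also forces r1 >= kappa + nu and r2 >= K, whence
   nu <= r1 + r2 - n. *)

theory Submission
  imports Defs "HOL-Library.Function_Algebras"
begin

section \<open>Smooth functions on jet space\<close>

text \<open>Jet space is a product of countably many lines, so calculus is done one coordinate at a
  time: all functions involved depend on finitely many coordinates, and the chain rule, the symmetry
  of second derivatives and the inverse function theorem are derived from the mean value theorem in
  single coordinates. The obstacle is that ranks of codistributions may jump. A dependency at one
  point cannot be differentiated; a relation with smooth coefficients on an open set can, since dh =
  sum a_i dg_i implies d(D h) = sum (D a_i) dg_i + a_i d(D g_i). Hence there are two spans, a smooth
  one (\<open>form_span\<close>) and a pointwise one (\<open>fv.span\<close>), linked by a dichotomy
  that holds after shrinking: a form is a smooth combination of given ones, or lies outside their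
  span at every point. The first alternative is refuted by propagation along D; the second leaves
  linear algebra at a point. There everything rests on a staircase: each application of D moves the
  input coefficients two coordinates up, unchanged. That b depends on x only comes from the affine
  inputs, b being a quotient of two input coefficients.\<close>

definition box_nbhd :: "(nat \<Rightarrow> real) \<Rightarrow> nat \<Rightarrow> real \<Rightarrow> (nat \<Rightarrow> real) set" where
  "box_nbhd p M \<delta> = {q. \<forall>i<M. \<bar>q i - p i\<bar> < \<delta>}"

lemma open_box_nbhd: "open (box_nbhd p M \<delta>)"
proof -
  have "open {f::nat \<Rightarrow> real. \<forall>i\<in>{..<M}. f i \<in> {y. \<bar>y - p i\<bar> < \<delta>}}"
  proof (rule product_topology_basis'[where x = "\<lambda>i. i"])
    show "open {y. \<bar>y - p i\<bar> < \<delta>}" if "i \<in> {..<M}" for i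
      by (rule open_Collect_less) (auto intro!: continuous_intros)
  qed simp
  thus ?thesis by (simp add: box_nbhd_def Ball_def)
qed

lemma center_in_box_nbhd: "\<delta> > 0 \<Longrightarrow> p \<in> box_nbhd p M \<delta>"
  by (simp add: box_nbhd_def)

lemma open_contains_box_nbhd:
  assumes "open U" "p \<in> U"
  obtains M \<delta> where "\<delta> > 0" "box_nbhd p M \<delta> \<subseteq> U"
proof -
  from assms obtain X where X: "p \<in> Pi\<^sub>E UNIV X" "\<And>i. open (X i)" "finite {i. X i \<noteq> UNIV}"
      "Pi\<^sub>E UNIV X \<subseteq> U"
    using product_topology_open_contains_basis[of "\<lambda>_. euclidean" UNIV U p]
    by (auto simp: open_fun_def)
  have "\<exists>d>0. \<forall>y. \<bar>y - p i\<bar> < d \<longrightarrow> y \<in> X i" for i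
  proof -
    have "p i \<in> X i" using X(1) by auto
    with X(2)[of i] obtain d where "d > 0" "\<And>y. dist y (p i) < d \<Longrightarrow> y \<in> X i"
      unfolding open_dist by blast
    thus ?thesis by (auto simp: dist_real_def)
  qed
  then obtain d where d: "\<And>i. d i > 0" "\<And>i y. \<bar>y - p i\<bar> < d i \<Longrightarrow> y \<in> X i" by metis
  define F where "F = {i. X i \<noteq> UNIV}"
  define \<delta> where "\<delta> = Min (insert 1 (d ` F))"
  define M where "M = Suc (Max (insert 0 F))"
  have depends_below: "finite F" using X(3) by (simp add: F_def)
  have "\<delta> > 0" using depends_below d(1) by (simp add: \<delta>_def)
  moreover have "box_nbhd p M \<delta> \<subseteq> U"
  proof
    fix q assume q: "q \<in> box_nbhd p M \<delta>"
    have "q i \<in> X i" for i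
    proof (cases "i \<in> F")
      case True
      have "i < M" unfolding M_def using depends_below True by (auto simp: less_Suc_eq_le)
      hence "\<bar>q i - p i\<bar> < \<delta>" using q by (simp add: box_nbhd_def)
      also have "\<delta> \<le> d i" unfolding \<delta>_def using depends_below True by auto
      finally show ?thesis using d(2) by blast
    qed (simp add: F_def)
    thus "q \<in> U" using X(4) by auto
  qed
  ultimately show ?thesis using that by blast
qed

lemma box_nbhd_mono: "M \<ge> M' \<Longrightarrow> \<delta> \<le> \<delta>' \<Longrightarrow> box_nbhd p M \<delta> \<subseteq> box_nbhd p M' \<delta>'"
  by (auto simp: box_nbhd_def intro: less_le_trans)

lemma open_contains_box_nbhd_ge:
  assumes "open U" "p \<in> U"
  obtains M \<delta> where "\<delta> > 0" "M \<ge> m" "box_nbhd p M \<delta> \<subseteq> U"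
proof -
  obtain M \<delta> where "\<delta> > 0" "box_nbhd p M \<delta> \<subseteq> U" using open_contains_box_nbhd assms .
  thus ?thesis using that[of \<delta> "max m M"] box_nbhd_mono[of M "max m M" \<delta> \<delta> p] by auto
qed

lemma tendsto_pointwiseI:
  fixes f :: "'a \<Rightarrow> nat \<Rightarrow> real"
  assumes "\<And>i. ((\<lambda>t. f t i) \<longlongrightarrow> l i) F"
  shows "(f \<longlongrightarrow> l) F"
proof (rule topological_tendstoI)
  fix S :: "(nat \<Rightarrow> real) set" assume "open S" "l \<in> S"
  then obtain M \<delta> where M: "\<delta> > 0" "box_nbhd l M \<delta> \<subseteq> S" using open_contains_box_nbhd by blast
  have "\<forall>\<^sub>F t in F. \<forall>i\<in>{..<M}. \<bar>f t i - l i\<bar> < \<delta>"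
    using assms M(1) by (subst eventually_ball_finite_distrib) (auto simp: tendsto_iff dist_real_def)
  thus "\<forall>\<^sub>F t in F. f t \<in> S"
    by eventually_elim (use M in \<open>auto simp: box_nbhd_def\<close>)
qed

lemma continuous_on_fun_upd: "continuous_on S (\<lambda>t. (p::nat \<Rightarrow> real)(i := t))"
proof (rule continuous_on_coordinatewise_then_product)
  fix j
  show "continuous_on S (\<lambda>t. (p(i := t)) j)" by (cases "j = i") auto
qed

lemma open_upd_vimage: "open U \<Longrightarrow> open {t. (p::nat \<Rightarrow> real)(i := t) \<in> U}"
  using continuous_on_fun_upd[of UNIV p i]
  by (metis UNIV_I continuous_on_open_vimage open_UNIV Int_UNIV_right vimage_def)

lemma eventually_upd:
  assumes "open U" "p \<in> U"
  shows "\<forall>\<^sub>F t in nhds (p i). (p::nat \<Rightarrow> real)(i := t) \<in> U"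
proof -
  have "p(i := p i) \<in> U" using assms by simp
  thus ?thesis using open_upd_vimage[OF assms(1), of p i] by (force simp: eventually_nhds)
qed

section \<open>Partial derivatives and smoothness in infinitely many coordinates\<close>

lemma pd_cong:
  assumes "open U" "p \<in> U" "\<And>q. q \<in> U \<Longrightarrow> h q = h' q"
  shows "pd i h p = pd i h' p"
  unfolding pd_def
proof (rule deriv_cong_ev)
  show "\<forall>\<^sub>F t in nhds (p i). h (p(i := t)) = h' (p(i := t))"
    using eventually_upd[OF assms(1,2)] by eventually_elim (use assms(3) in blast)
qed simp

text \<open>The counterpart of \<open>smooth_fun\<close> on open sets of jet space, with no bound on
  the directions. As \<open>deriv\<close> is total, an iterated derivative exists everywhere as a
  value but carries information only on \<open>U\<close>, so differentiability has to be demanded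
  explicitly.\<close>

definition csmooth :: "(nat \<Rightarrow> real) set \<Rightarrow> ((nat \<Rightarrow> real) \<Rightarrow> real) \<Rightarrow> bool" where
  "csmooth U h \<longleftrightarrow> (\<forall>is. (\<forall>p\<in>U. \<forall>i. (\<lambda>t. ipd is h (p(i := t))) differentiable (at (p i)))
                   \<and> continuous_on U (ipd is h))"

lemma ipd_append: "ipd (is @ js) h = ipd is (ipd js h)"
  by (induction "is") auto

lemma csmooth_subset: "csmooth U h \<Longrightarrow> U' \<subseteq> U \<Longrightarrow> csmooth U' h"
  unfolding csmooth_def by (meson continuous_on_subset subsetD)

lemma csmooth_continuous: "csmooth U h \<Longrightarrow> continuous_on U h"
  unfolding csmooth_def by (metis ipd.simps(1))

lemma csmooth_DERIV:
  assumes "csmooth U h" "p \<in> U"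
  shows "((\<lambda>t. h (p(i := t))) has_real_derivative pd i h p) (at (p i))"
proof -
  have "(\<lambda>t. h (p(i := t))) differentiable (at (p i))"
    using assms unfolding csmooth_def by (metis ipd.simps(1))
  thus ?thesis unfolding pd_def by (simp add: DERIV_deriv_iff_real_differentiable)
qed

lemma csmooth_DERIV_upd:
  assumes "csmooth U h" "p(i := s) \<in> U"
  shows "((\<lambda>t. h (p(i := t))) has_real_derivative pd i h (p(i := s))) (at s)"
  using csmooth_DERIV[OF assms, of i] by simp

lemma csmooth_pd: "csmooth U h \<Longrightarrow> csmooth U (pd i h)"
  unfolding csmooth_def
proof
  fix "is" assume "\<forall>is. (\<forall>p\<in>U. \<forall>i. (\<lambda>t. ipd is h (p(i := t))) differentiable (at (p i)))
                   \<and> continuous_on U (ipd is h)"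
  from this[rule_format, of "is @ [i]"]
  show "(\<forall>p\<in>U. \<forall>j. (\<lambda>t. ipd is (pd i h) (p(j := t))) differentiable (at (p j)))
                   \<and> continuous_on U (ipd is (pd i h))"
    by (simp add: ipd_append)
qed

text \<open>Induction on the list of directions: every iterated derivative of \<open>h\<close>
  agrees on \<open>U\<close> with some member of \<open>C\<close>. Agreement on an open set is
  preserved by \<open>pd\<close>, and \<open>step\<close> makes each member continuous and
  differentiable.\<close>

lemma csmooth_coinduct:
  assumes "open U" and "C h"
    and step: "\<And>h. C h \<Longrightarrow> continuous_on U h \<and>
        (\<forall>i. \<exists>h'. C h' \<and> (\<forall>p\<in>U. ((\<lambda>t. h (p(i := t))) has_real_derivative h' p) (at (p i))))"
  shows "csmooth U h"
proof -
  have ex: "\<exists>h'. C h' \<and> (\<forall>p\<in>U. ipd is h p = h' p)" for "is"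
  proof (induction "is")
    case Nil
    show ?case using assms(2) by auto
  next
    case (Cons i "is")
    then obtain h' where h': "C h'" "\<forall>p\<in>U. ipd is h p = h' p" by blast
    from step[OF h'(1)] obtain h'' where h'': "C h''"
      "\<forall>p\<in>U. ((\<lambda>t. h' (p(i := t))) has_real_derivative h'' p) (at (p i))" by blast
    have "ipd (i # is) h p = h'' p" if "p \<in> U" for p
    proof -
      have "pd i (ipd is h) p = pd i h' p"
        by (rule pd_cong[OF assms(1) that]) (use h'(2) in auto)
      also have "\<dots> = h'' p" unfolding pd_def
        by (rule DERIV_imp_deriv) (use h''(2) that in blast)
      finally show ?thesis by simp
    qed
    thus ?case using h''(1) by blast
  qed
  show ?thesis unfolding csmooth_def
  proof (intro allI conjI ballI)
    fix "is"
    obtain h' where h': "C h'" "\<forall>p\<in>U. ipd is h p = h' p" using ex by blast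
    have st: "continuous_on U h'" using step[OF h'(1)] by blast
    thus "continuous_on U (ipd is h)"
      using h'(2) by (metis (no_types, lifting) continuous_on_cong)
    fix p i assume p: "p \<in> U"
    from step[OF h'(1)] obtain g where
      "((\<lambda>t. h' (p(i := t))) has_real_derivative g p) (at (p i))" using p by blast
    hence "((\<lambda>t. ipd is h (p(i := t))) has_real_derivative g p) (at (p i))"
    proof (rule has_field_derivative_transform_within_open)
      show "open {t. p(i := t) \<in> U}" using open_upd_vimage[OF assms(1)] .
    qed (use p h'(2) in auto)
    thus "(\<lambda>t. ipd is h (p(i := t))) differentiable (at (p i))"
      using real_differentiable_def by blast
  qed
qed

text \<open>Stated with \<open>closed_segment\<close> so as to cover both orders of the end points
  and the degenerate case, since the sign of the increment is unknown in the later uses.\<close>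

lemma pd_MVT:
  assumes "csmooth U h" "\<And>t. t \<in> closed_segment (q c) y \<Longrightarrow> q(c := t) \<in> U"
  obtains \<xi> where "\<xi> \<in> closed_segment (q c) y" "h (q(c := y)) - h q = pd c h (q(c := \<xi>)) * (y - q c)"
proof -
  have der: "((\<lambda>t. h (q(c := t))) has_real_derivative pd c h (q(c := s))) (at s)"
    if "s \<in> closed_segment (q c) y" for s
    using csmooth_DERIV_upd assms that by blast
  have aux: "\<exists>\<xi>. \<xi> \<in> closed_segment a b \<and> h (q(c := b)) - h (q(c := a)) = pd c h (q(c := \<xi>)) * (b - a)"
    if "a < b" "closed_segment a b = closed_segment (q c) y" for a b
  proof -
    have "\<exists>z::real. z > a \<and> z < b \<and> h (q(c := b)) - h (q(c := a)) = (b - a) * pd c h (q(c := z))"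
    proof (rule MVT2[OF that(1)])
      fix s assume "a \<le> s" "s \<le> b"
      hence "s \<in> closed_segment a b" by (simp add: closed_segment_eq_real_ivl)
      thus "((\<lambda>t. h (q(c := t))) has_real_derivative pd c h (q(c := s))) (at s)"
        using der that(2) by blast
    qed
    then obtain z where "a < z" "z < b" "h (q(c := b)) - h (q(c := a)) = (b - a) * pd c h (q(c := z))"
      by blast
    thus ?thesis using that(1)
      by (intro exI[of _ z]) (simp add: closed_segment_eq_real_ivl mult.commute)
  qed
  consider "q c = y" | "q c < y" | "y < q c" by linarith
  then show ?thesis
  proof cases
    case 1
    show ?thesis by (rule that[of y]) (use 1 in \<open>auto simp flip: 1\<close>)
  next
    case 2
    from aux[OF 2] show ?thesis using that by auto
  next
    case 3
    from aux[OF 3] obtain \<xi> where "\<xi> \<in> closed_segment (q c) y"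
      "h (q(c := q c)) - h (q(c := y)) = pd c h (q(c := \<xi>)) * (q c - y)"
      by (auto simp: closed_segment_commute)
    thus ?thesis using that[of \<xi>] by (simp add: algebra_simps)
  qed
qed

text \<open>The dependence is global, not restricted to a domain of smoothness: partial derivatives
  in the other directions then vanish identically, and those coordinates may be altered without
  regard to a domain.\<close>

definition depends_below :: "nat \<Rightarrow> ((nat \<Rightarrow> real) \<Rightarrow> real) \<Rightarrow> bool" where
  "depends_below m h \<longleftrightarrow> (\<forall>p. h (tr m p) = h p)"

lemma depends_below_eq: "depends_below m h \<Longrightarrow> (\<And>i. i < m \<Longrightarrow> p i = q i) \<Longrightarrow> h p = h q"
proof -
  assume f: "depends_below m h" and e: "\<And>i. i < m \<Longrightarrow> p i = q i"
  have "tr m p = tr m q" using e by (auto simp: tr_def)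
  hence "h (tr m p) = h (tr m q)" by simp
  thus "h p = h q" using f by (simp add: depends_below_def)
qed

lemma depends_belowI: "(\<And>p q. (\<And>i. i < m \<Longrightarrow> p i = q i) \<Longrightarrow> h p = h q) \<Longrightarrow> depends_below m h"
  unfolding depends_below_def
proof
  fix p assume "\<And>p q. (\<And>i. i < m \<Longrightarrow> p i = q i) \<Longrightarrow> h p = h q"
  from this[of "tr m p" p] show "h (tr m p) = h p" by (simp add: tr_def)
qed

lemma depends_below_mono: "depends_below m h \<Longrightarrow> m \<le> m' \<Longrightarrow> depends_below m' h"
proof (rule depends_belowI)
  fix p q :: "nat \<Rightarrow> real"
  assume "depends_below m h" "m \<le> m'" "\<And>i. i < m' \<Longrightarrow> p i = q i"
  thus "h p = h q" using depends_below_eq[of m h p q] by simp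
qed

lemma depends_below_pd_zero: "depends_below m h \<Longrightarrow> m \<le> c \<Longrightarrow> pd c h p = 0"
proof -
  assume *: "depends_below m h" "m \<le> c"
  have "(\<lambda>t. h (p(c := t))) = (\<lambda>t. h p)"
    by (intro ext depends_below_eq[OF *(1)]) (use *(2) in auto)
  thus ?thesis unfolding pd_def by simp
qed

lemma depends_below_pd: assumes "depends_below m h" shows "depends_below m (pd c h)"
proof (cases "c < m")
  case True
  show ?thesis
  proof (rule depends_belowI)
    fix p q :: "nat \<Rightarrow> real" assume e: "\<And>i. i < m \<Longrightarrow> p i = q i"
    have "(\<lambda>t. h (p(c := t))) = (\<lambda>t. h (q(c := t)))"
      by (intro ext depends_below_eq[OF assms]) (use e in auto)
    thus "pd c h p = pd c h q" unfolding pd_def using e True by simp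
  qed
next
  case False
  thus ?thesis using depends_below_pd_zero[OF assms] by (intro depends_belowI) simp
qed

text \<open>The coordinates of the curve are moved one after the other; each increment of
  \<open>H\<close> is one partial derivative at an intermediate point times the increment of one
  coordinate. The curve need only be differentiable at \<open>t0\<close>, as continuity of the
  partial derivatives supplies the limit.\<close>

lemma chain_rule:
  assumes "open V" "csmooth V H" "depends_below M H" "\<gamma> t0 \<in> V"
    and g: "\<And>j. j < M \<Longrightarrow> ((\<lambda>t. \<gamma> t j) has_real_derivative g j) (at t0)"
  shows "((\<lambda>t. H (\<gamma> t)) has_real_derivative (\<Sum>j<M. pd j H (\<gamma> t0) * g j)) (at t0)"
proof -
  define \<mu> where "\<mu> = (\<lambda>k t j. if j < k then \<gamma> t j else \<gamma> t0 j)"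
  obtain B \<delta> where B: "\<delta> > 0" "box_nbhd (\<gamma> t0) B \<delta> \<subseteq> V"
    using open_contains_box_nbhd assms(1,4) by blast
  have \<mu>0: "\<mu> k t0 = \<gamma> t0" for k by (auto simp: \<mu>_def)
  have "((\<lambda>t. H (\<mu> k t)) has_real_derivative (\<Sum>j<k. pd j H (\<gamma> t0) * g j)) (at t0)" if "k \<le> M" for k
    using that
  proof (induction k)
    case 0
    have "\<mu> 0 = (\<lambda>t. \<gamma> t0)" by (auto simp: \<mu>_def)
    thus ?case by simp
  next
    case (Suc k)
    define \<phi> where "\<phi> = (\<lambda>t. H (\<mu> (Suc k) t) - H (\<mu> k t))"
    have cont: "((\<lambda>t. \<gamma> t j) \<longlongrightarrow> \<gamma> t0 j) (at t0)" if "j \<le> k" for j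
      using DERIV_isCont[OF g[of j]] that Suc.prems by (auto simp: isCont_def)
    have covec: "\<forall>\<^sub>F t in at t0. \<forall>j\<in>{..k}. \<bar>\<gamma> t j - \<gamma> t0 j\<bar> < \<delta>"
      using cont B(1) by (subst eventually_ball_finite_distrib) (auto simp: tendsto_iff dist_real_def)
    define good where "good = (\<lambda>t \<xi>. \<bar>\<xi> - \<gamma> t0 k\<bar> \<le> \<bar>\<gamma> t k - \<gamma> t0 k\<bar> \<and>
          \<phi> t = pd k H ((\<mu> k t)(k := \<xi>)) * (\<gamma> t k - \<gamma> t0 k))"
    have ex: "\<exists>\<xi>. good t \<xi>" if t: "\<forall>j\<in>{..k}. \<bar>\<gamma> t j - \<gamma> t0 j\<bar> < \<delta>" for t
    proof -
      have seg: "\<bar>s - \<gamma> t0 k\<bar> \<le> \<bar>\<gamma> t k - \<gamma> t0 k\<bar>" if "s \<in> closed_segment (\<mu> k t k) (\<gamma> t k)" for s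
        using that by (auto simp: \<mu>_def closed_segment_eq_real_ivl split: if_splits)
      have "(\<mu> k t)(k := s) \<in> V" if "s \<in> closed_segment (\<mu> k t k) (\<gamma> t k)" for s
      proof -
        have "\<bar>s - \<gamma> t0 k\<bar> < \<delta>" using seg[OF that] t[rule_format, of k] by simp
        hence "(\<mu> k t)(k := s) \<in> box_nbhd (\<gamma> t0) B \<delta>"
          using t B(1) by (auto simp: box_nbhd_def \<mu>_def)
        thus ?thesis using B by blast
      qed
      from pd_MVT[OF assms(2) this] obtain \<xi> where \<xi>: "\<xi> \<in> closed_segment (\<mu> k t k) (\<gamma> t k)"
        "H ((\<mu> k t)(k := \<gamma> t k)) - H (\<mu> k t) = pd k H ((\<mu> k t)(k := \<xi>)) * (\<gamma> t k - \<mu> k t k)" by blast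
      moreover have "(\<mu> k t)(k := \<gamma> t k) = \<mu> (Suc k) t" by (auto simp: \<mu>_def)
      moreover have "\<mu> k t k = \<gamma> t0 k" by (simp add: \<mu>_def)
      ultimately show ?thesis using seg unfolding good_def \<phi>_def by metis
    qed
    \<comment> \<open>Away from \<open>t0\<close> no intermediate value need exist; the default
      \<open>\<gamma> t0 k\<close> keeps the bound \<open>\<xi>le\<close> valid for all
      \<open>t\<close>.\<close>
    define \<xi> where "\<xi> = (\<lambda>t. if \<exists>s. good t s then SOME s. good t s else \<gamma> t0 k)"
    have \<xi>: "good t (\<xi> t)" if "\<forall>j\<in>{..k}. \<bar>\<gamma> t j - \<gamma> t0 j\<bar> < \<delta>" for t
      using someI_ex[OF ex[OF that]] ex[OF that] by (auto simp: \<xi>_def)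
    have \<xi>le: "\<bar>\<xi> t - \<gamma> t0 k\<bar> \<le> \<bar>\<gamma> t k - \<gamma> t0 k\<bar>" for t
      using someI_ex[of "good t"] by (auto simp: \<xi>_def good_def)
    have \<xi>lim: "(\<xi> \<longlongrightarrow> \<gamma> t0 k) (at t0)"
    proof -
      have "((\<lambda>t. \<gamma> t k - \<gamma> t0 k) \<longlongrightarrow> 0) (at t0)" using cont[of k] by (simp add: LIM_zero)
      hence "((\<lambda>t. \<bar>\<gamma> t k - \<gamma> t0 k\<bar>) \<longlongrightarrow> 0) (at t0)" by (rule tendsto_rabs_zero)
      hence "((\<lambda>t. \<xi> t - \<gamma> t0 k) \<longlongrightarrow> 0) (at t0)"
        by (rule Lim_null_comparison[rotated]) (use \<xi>le in auto)
      thus ?thesis by (rule LIM_zero_cancel)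
    qed
    have "((\<lambda>t. (\<mu> k t)(k := \<xi> t)) \<longlongrightarrow> \<gamma> t0) (at t0)"
    proof (rule tendsto_pointwiseI)
      fix i
      show "((\<lambda>t. ((\<mu> k t)(k := \<xi> t)) i) \<longlongrightarrow> \<gamma> t0 i) (at t0)"
        using \<xi>lim cont[of i] by (cases "i = k"; cases "i < k") (auto simp: \<mu>_def)
    qed
    moreover have "isCont (pd k H) (\<gamma> t0)"
      using csmooth_continuous[OF csmooth_pd[OF assms(2)]] assms(1,4) continuous_on_eq_continuous_at by blast
    ultimately have l1: "((\<lambda>t. pd k H ((\<mu> k t)(k := \<xi> t))) \<longlongrightarrow> pd k H (\<gamma> t0)) (at t0)"
      by (rule isCont_tendsto_compose[rotated])
    have l2: "((\<lambda>t. (\<gamma> t k - \<gamma> t0 k) / (t - t0)) \<longlongrightarrow> g k) (at t0)"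
      using g[of k] Suc.prems by (simp add: has_field_derivative_iff)
    have "((\<lambda>t. pd k H ((\<mu> k t)(k := \<xi> t)) * ((\<gamma> t k - \<gamma> t0 k) / (t - t0))) \<longlongrightarrow> pd k H (\<gamma> t0) * g k) (at t0)"
      by (intro tendsto_mult l1 l2)
    moreover have "\<forall>\<^sub>F t in at t0. pd k H ((\<mu> k t)(k := \<xi> t)) * ((\<gamma> t k - \<gamma> t0 k) / (t - t0)) = (\<phi> t - \<phi> t0) / (t - t0)"
      using covec by eventually_elim (use \<xi> in \<open>auto simp: good_def \<phi>_def \<mu>0\<close>)
    ultimately have "((\<lambda>t. (\<phi> t - \<phi> t0) / (t - t0)) \<longlongrightarrow> pd k H (\<gamma> t0) * g k) (at t0)"
      by (rule Lim_transform_eventually)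
    hence "(\<phi> has_real_derivative pd k H (\<gamma> t0) * g k) (at t0)"
      by (simp add: has_field_derivative_iff)
    from DERIV_add[OF Suc.IH this] Suc.prems show ?case by (simp add: \<phi>_def)
  qed
  from this[of M] show ?thesis
  proof -
    assume *: "M \<le> M \<Longrightarrow> ((\<lambda>t. H (\<mu> M t)) has_real_derivative (\<Sum>j<M. pd j H (\<gamma> t0) * g j)) (at t0)"
    have "(\<lambda>t. H (\<mu> M t)) = (\<lambda>t. H (\<gamma> t))" by (intro ext depends_below_eq[OF assms(3)]) (simp add: \<mu>_def)
    thus ?thesis using * by simp
  qed
qed

text \<open>Every member of this class has its partial derivatives in the class again, so that
  coinduction shows at once that all of them are smooth.\<close>

inductive smooth_closure :: "(nat \<Rightarrow> real) set \<Rightarrow> ((nat \<Rightarrow> real) \<Rightarrow> real) \<Rightarrow> bool" for U where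
  smooth_closure_csmooth: "csmooth U h \<Longrightarrow> smooth_closure U h"
| smooth_closure_add: "smooth_closure U g \<Longrightarrow> smooth_closure U h \<Longrightarrow> smooth_closure U (\<lambda>p. g p + h p)"
| smooth_closure_mult: "smooth_closure U g \<Longrightarrow> smooth_closure U h \<Longrightarrow> smooth_closure U (\<lambda>p. g p * h p)"
| smooth_closure_inverse: "smooth_closure U h \<Longrightarrow> (\<And>p. p \<in> U \<Longrightarrow> h p \<noteq> 0) \<Longrightarrow> smooth_closure U (\<lambda>p. inverse (h p))"
| smooth_closure_comp: "open V \<Longrightarrow> csmooth V H \<Longrightarrow> depends_below M H \<Longrightarrow> (\<And>j. smooth_closure U (\<lambda>p. T p j)) \<Longrightarrow> (\<And>p. p \<in> U \<Longrightarrow> T p \<in> V)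
     \<Longrightarrow> smooth_closure U (\<lambda>p. H (T p))"

lemma pd_const: "pd i (\<lambda>p. c) p = 0" by (simp add: pd_def)

lemma pd_coord: "pd i (\<lambda>p. p c) p = (if i = c then 1 else 0)"
  by (simp add: pd_def)

lemma csmooth_const: "csmooth U (\<lambda>p. c)"
proof -
  have *: "\<exists>d. ipd is (\<lambda>p. c) = (\<lambda>p. d)" for "is"
  proof (induction "is")
    case (Cons i "is")
    then obtain d where "ipd is (\<lambda>p. c) = (\<lambda>p. d)" by blast
    hence "ipd (i # is) (\<lambda>p. c) = pd i (\<lambda>p. d)" by simp
    also have "\<dots> = (\<lambda>p. 0)" by (auto simp: pd_const)
    finally have "ipd (i # is) (\<lambda>p. c) = (\<lambda>p. 0)" .
    thus ?case by blast
  qed auto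
  show ?thesis unfolding csmooth_def
  proof
    fix "is"
    obtain d where "ipd is (\<lambda>p. c) = (\<lambda>p. d)" using * by blast
    thus "(\<forall>p\<in>U. \<forall>i. (\<lambda>t. ipd is (\<lambda>p. c) (p(i := t))) differentiable (at (p i)))
            \<and> continuous_on U (ipd is (\<lambda>p. c))" by simp
  qed
qed

lemma continuous_on_coord: "continuous_on U (\<lambda>p. (p::nat \<Rightarrow> real) c)"
  by (rule continuous_on_subset[OF continuous_on_product_coordinates]) simp

lemma csmooth_coord: "csmooth U (\<lambda>p. p c)"
proof -
  have *: "(\<exists>d. ipd is (\<lambda>p. p c) = (\<lambda>p. d)) \<or> ipd is (\<lambda>p. p c) = (\<lambda>p. p c)" for "is"
  proof (induction "is")
    case (Cons i "is")
    then show ?case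
    proof (elim disjE exE)
      fix d assume "ipd is (\<lambda>p. p c) = (\<lambda>p. d)"
      hence "ipd (i # is) (\<lambda>p. p c) = pd i (\<lambda>p. d)" by simp
      also have "\<dots> = (\<lambda>p. 0)" by (auto simp: pd_const)
      finally have "ipd (i # is) (\<lambda>p. p c) = (\<lambda>p. 0)" .
      thus ?thesis by blast
    next
      assume "ipd is (\<lambda>p. p c) = (\<lambda>p. p c)"
      hence "ipd (i # is) (\<lambda>p. p c) = pd i (\<lambda>p. p c)" by simp
      also have "\<dots> = (\<lambda>p. if i = c then 1 else 0)" by (auto simp: pd_coord)
      finally have "ipd (i # is) (\<lambda>p. p c) = (\<lambda>p. if i = c then 1 else 0)" .
      thus ?thesis by blast
    qed
  qed auto
  have d: "(\<lambda>t. (p(i := t)) c) differentiable (at x)" for p :: "nat \<Rightarrow> real" and i x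
    by (cases "i = c") auto
  show ?thesis unfolding csmooth_def
  proof
    fix "is"
    show "(\<forall>p\<in>U. \<forall>i. (\<lambda>t. ipd is (\<lambda>p. p c) (p(i := t))) differentiable (at (p i)))
            \<and> continuous_on U (ipd is (\<lambda>p. p c))"
      using *[of "is"]
    proof (elim disjE exE)
      fix e assume "ipd is (\<lambda>p. p c) = (\<lambda>p. e)"
      thus ?thesis by simp
    next
      assume e: "ipd is (\<lambda>p. p c) = (\<lambda>p. p c)"
      show ?thesis unfolding e by (intro conjI ballI allI d continuous_on_coord)
    qed
  qed
qed

lemma smooth_closure_sum:
  assumes "finite I" "\<And>i. i \<in> I \<Longrightarrow> smooth_closure U (h i)"
  shows "smooth_closure U (\<lambda>p. \<Sum>i\<in>I. h i p)"
  using assms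
proof (induction I rule: finite_induct)
  case empty
  have "smooth_closure U (\<lambda>p. 0)" by (rule smooth_closure_csmooth[OF csmooth_const])
  thus ?case by (simp only: sum.empty)
next
  case (insert i I)
  have 1: "smooth_closure U (h i)" using insert.prems by blast
  have 2: "smooth_closure U (\<lambda>p. \<Sum>i\<in>I. h i p)" using insert.prems by (intro insert.IH) blast
  have "smooth_closure U (\<lambda>p. h i p + (\<Sum>i\<in>I. h i p))" by (rule smooth_closure_add[OF 1 2])
  thus ?case by (simp only: sum.insert[OF insert.hyps])
qed

lemma smooth_closure_imp_csmooth:
  assumes "open U" "smooth_closure U h"
  shows "csmooth U h"
proof (rule csmooth_coinduct[where C = "smooth_closure U", OF assms])
  fix h assume "smooth_closure U h"
  thus "continuous_on U h \<and>
        (\<forall>i. \<exists>h'. smooth_closure U h' \<and> (\<forall>p\<in>U. ((\<lambda>t. h (p(i := t))) has_real_derivative h' p) (at (p i))))"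
  proof induction
    case (smooth_closure_csmooth h)
    thus ?case using csmooth_continuous csmooth_DERIV csmooth_pd smooth_closure.smooth_closure_csmooth by meson
  next
    case (smooth_closure_add g h)
    have "\<exists>h'. smooth_closure U h' \<and> (\<forall>p\<in>U. ((\<lambda>t. g (p(i := t)) + h (p(i := t))) has_real_derivative h' p) (at (p i)))" (is "?P i") for i
    proof -
      obtain g' h' where *: "smooth_closure U g'" "\<forall>p\<in>U. ((\<lambda>t. g (p(i := t))) has_real_derivative g' p) (at (p i))"
        "smooth_closure U h'" "\<forall>p\<in>U. ((\<lambda>t. h (p(i := t))) has_real_derivative h' p) (at (p i))" using smooth_closure_add.IH by blast
      show ?thesis by (rule exI[of _ "\<lambda>p. g' p + h' p"]) (use * in \<open>auto intro!: smooth_closure.smooth_closure_add DERIV_add\<close>)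
    qed
    hence "\<forall>i. ?P i" ..
    moreover have "continuous_on U (\<lambda>p. g p + h p)" using smooth_closure_add.IH by (intro continuous_on_add) auto
    ultimately show ?case by (rule conjI[rotated])
  next
    case (smooth_closure_mult g h)
    have "\<exists>h'. smooth_closure U h' \<and> (\<forall>p\<in>U. ((\<lambda>t. g (p(i := t)) * h (p(i := t))) has_real_derivative h' p) (at (p i)))" (is "?P i") for i
    proof -
      obtain g' h' where *: "smooth_closure U g'" "\<forall>p\<in>U. ((\<lambda>t. g (p(i := t))) has_real_derivative g' p) (at (p i))"
        "smooth_closure U h'" "\<forall>p\<in>U. ((\<lambda>t. h (p(i := t))) has_real_derivative h' p) (at (p i))" using smooth_closure_mult.IH by blast
      have "((\<lambda>t. g (p(i := t)) * h (p(i := t))) has_real_derivative g' p * h p + h' p * g p) (at (p i))"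
        if "p \<in> U" for p
        using DERIV_mult[OF bspec[OF *(2) that] bspec[OF *(4) that]] by simp
      thus ?thesis using * smooth_closure_mult.hyps
        by (intro exI[of _ "\<lambda>p. g' p * h p + h' p * g p"]) (auto intro!: smooth_closure.smooth_closure_add smooth_closure.smooth_closure_mult)
    qed
    hence "\<forall>i. ?P i" ..
    moreover have "continuous_on U (\<lambda>p. g p * h p)" using smooth_closure_mult.IH by (intro continuous_on_mult) auto
    ultimately show ?case by (rule conjI[rotated])
  next
    case (smooth_closure_inverse h)
    have "\<exists>h'. smooth_closure U h' \<and> (\<forall>p\<in>U. ((\<lambda>t. inverse (h (p(i := t)))) has_real_derivative h' p) (at (p i)))" (is "?P i") for i
    proof -
      obtain h' where *: "smooth_closure U h'" "\<forall>p\<in>U. ((\<lambda>t. h (p(i := t))) has_real_derivative h' p) (at (p i))"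
        using smooth_closure_inverse.IH by blast
      have "((\<lambda>t. inverse (h (p(i := t)))) has_real_derivative (-1) * (inverse (h p) * h' p * inverse (h p))) (at (p i))"
        if "p \<in> U" for p
        using DERIV_inverse'[OF bspec[OF *(2) that]] smooth_closure_inverse.hyps(2)[OF that] by simp
      moreover have "smooth_closure U (\<lambda>p. (-1) * (inverse (h p) * h' p * inverse (h p)))"
        by (intro smooth_closure.smooth_closure_mult smooth_closure.smooth_closure_inverse[OF smooth_closure_inverse.hyps] * smooth_closure.smooth_closure_csmooth[OF csmooth_const])
      ultimately show ?thesis by blast
    qed
    hence "\<forall>i. ?P i" ..
    moreover have "continuous_on U (\<lambda>p. inverse (h p))" using smooth_closure_inverse by (intro continuous_on_inverse) auto
    ultimately show ?case by (rule conjI[rotated])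
  next
    case (smooth_closure_comp V H M T)
    have "\<exists>h'. smooth_closure U h' \<and> (\<forall>p\<in>U. ((\<lambda>t. H (T (p(i := t)))) has_real_derivative h' p) (at (p i)))" (is "?P i") for i
    proof -
      have "\<forall>j. \<exists>g. smooth_closure U g \<and> (\<forall>p\<in>U. ((\<lambda>t. T (p(i := t)) j) has_real_derivative g p) (at (p i)))"
        using smooth_closure_comp.IH by blast
      then obtain g where g: "\<And>j. smooth_closure U (g j)"
        "\<And>j p. p \<in> U \<Longrightarrow> ((\<lambda>t. T (p(i := t)) j) has_real_derivative g j p) (at (p i))" by metis
      have "((\<lambda>t. H (T (p(i := t)))) has_real_derivative (\<Sum>j<M. pd j H (T p) * g j p)) (at (p i))"
        if p: "p \<in> U" for p
        using chain_rule[OF smooth_closure_comp.hyps(1-3), of "\<lambda>t. T (p(i := t))" "p i" "\<lambda>j. g j p"]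
          smooth_closure_comp.hyps(5)[OF p] g(2)[OF p] by simp
      moreover have "smooth_closure U (\<lambda>p. \<Sum>j<M. pd j H (T p) * g j p)"
        by (intro smooth_closure_sum smooth_closure.smooth_closure_mult g smooth_closure.smooth_closure_comp[OF smooth_closure_comp.hyps(1) csmooth_pd depends_below_pd])
           (use smooth_closure_comp.hyps in auto)
      ultimately show ?thesis by blast
    qed
    hence "\<forall>i. ?P i" ..
    moreover have "continuous_on U (\<lambda>p. H (T p))"
      by (rule continuous_on_compose2[OF csmooth_continuous[OF smooth_closure_comp.hyps(2)]
            continuous_on_coordinatewise_then_product[of U T]])
         (use smooth_closure_comp in auto)
    ultimately show ?case by (rule conjI[rotated])
  qed
qed

lemma csmooth_add: "open U \<Longrightarrow> csmooth U g \<Longrightarrow> csmooth U h \<Longrightarrow> csmooth U (\<lambda>p. g p + h p)"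
  by (rule smooth_closure_imp_csmooth[OF _ smooth_closure_add[OF smooth_closure_csmooth smooth_closure_csmooth]])
lemma csmooth_mult: "open U \<Longrightarrow> csmooth U g \<Longrightarrow> csmooth U h \<Longrightarrow> csmooth U (\<lambda>p. g p * h p)"
  by (rule smooth_closure_imp_csmooth[OF _ smooth_closure_mult[OF smooth_closure_csmooth smooth_closure_csmooth]])
lemma csmooth_uminus: "open U \<Longrightarrow> csmooth U h \<Longrightarrow> csmooth U (\<lambda>p. - h p)"
  using csmooth_mult[OF _ csmooth_const[of U "-1"], of h] by simp
lemma csmooth_diff: "open U \<Longrightarrow> csmooth U g \<Longrightarrow> csmooth U h \<Longrightarrow> csmooth U (\<lambda>p. g p - h p)"
  using csmooth_add[of U g "\<lambda>p. - h p"] csmooth_uminus[of U h] by simp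
lemma csmooth_inverse: "open U \<Longrightarrow> csmooth U h \<Longrightarrow> (\<And>p. p \<in> U \<Longrightarrow> h p \<noteq> 0) \<Longrightarrow> csmooth U (\<lambda>p. inverse (h p))"
  by (rule smooth_closure_imp_csmooth[OF _ smooth_closure_inverse[OF smooth_closure_csmooth]])
lemma csmooth_divide: "open U \<Longrightarrow> csmooth U g \<Longrightarrow> csmooth U h \<Longrightarrow> (\<And>p. p \<in> U \<Longrightarrow> h p \<noteq> 0) \<Longrightarrow> csmooth U (\<lambda>p. g p / h p)"
  using csmooth_mult[of U g "\<lambda>p. inverse (h p)"] csmooth_inverse[of U h] by (simp add: divide_inverse)
lemma csmooth_sum: "open U \<Longrightarrow> finite I \<Longrightarrow> (\<And>i. i \<in> I \<Longrightarrow> csmooth U (h i)) \<Longrightarrow> csmooth U (\<lambda>p. \<Sum>i\<in>I. h i p)"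
  by (rule smooth_closure_imp_csmooth[OF _ smooth_closure_sum]) (auto intro: smooth_closure_csmooth)
lemma csmooth_comp:
  assumes "open U" "open V" "csmooth V H" "depends_below M H" "\<And>j. csmooth U (\<lambda>p. T p j)" "\<And>p. p \<in> U \<Longrightarrow> T p \<in> V"
  shows "csmooth U (\<lambda>p. H (T p))"
  by (rule smooth_closure_imp_csmooth[OF assms(1)], rule smooth_closure.smooth_closure_comp[OF assms(2-4)]) (use assms smooth_closure.smooth_closure_csmooth in auto)

section \<open>Rules for partial derivatives\<close>

lemma pd_comp:
  assumes "open U" "open V" "csmooth V H" "depends_below M H" "\<And>j. j < M \<Longrightarrow> csmooth U (\<lambda>p. T p j)" "p \<in> U" "T p \<in> V"
  shows "pd i (\<lambda>p. H (T p)) p = (\<Sum>j<M. pd j H (T p) * pd i (\<lambda>p. T p j) p)"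
proof -
  have "((\<lambda>t. H (T (p(i := t)))) has_real_derivative (\<Sum>j<M. pd j H (T (p(i := p i))) * pd i (\<lambda>p. T p j) p)) (at (p i))"
    by (rule chain_rule[OF assms(2-4)]) (use assms(7) csmooth_DERIV[OF assms(5,6)] in simp_all)
  thus ?thesis unfolding pd_def[of i "\<lambda>p. H (T p)"] by (simp add: DERIV_imp_deriv)
qed

lemma pd_diff: "csmooth U g \<Longrightarrow> csmooth U h \<Longrightarrow> p \<in> U \<Longrightarrow> pd i (\<lambda>p. g p - h p) p = pd i g p - pd i h p"
  unfolding pd_def[of i "\<lambda>p. g p - h p"]
  by (rule DERIV_imp_deriv) (intro DERIV_diff csmooth_DERIV)
lemma pd_mult: "csmooth U g \<Longrightarrow> csmooth U h \<Longrightarrow> p \<in> U \<Longrightarrow> pd i (\<lambda>p. g p * h p) p = pd i g p * h p + g p * pd i h p"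
proof -
  assume "csmooth U g" "csmooth U h" "p \<in> U"
  from DERIV_mult[OF csmooth_DERIV[OF this(1,3)] csmooth_DERIV[OF this(2,3)], of i] show ?thesis
    unfolding pd_def[of i "\<lambda>p. g p * h p"] by (subst DERIV_imp_deriv) (auto simp: mult.commute)
qed
lemma pd_sum: "finite I \<Longrightarrow> (\<And>j. j \<in> I \<Longrightarrow> csmooth U (h j)) \<Longrightarrow> p \<in> U
    \<Longrightarrow> pd i (\<lambda>p. \<Sum>j\<in>I. h j p) p = (\<Sum>j\<in>I. pd i (h j) p)"
  unfolding pd_def[of i "\<lambda>p. \<Sum>j\<in>I. h j p"]
  by (rule DERIV_imp_deriv) (intro DERIV_sum csmooth_DERIV)
lemma pd_divide:
  assumes "open U" "csmooth U g" "csmooth U h" "p \<in> U" "\<And>p. p \<in> U \<Longrightarrow> h p \<noteq> 0"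
  shows "pd i (\<lambda>p. g p / h p) p = (pd i g p * h p - g p * pd i h p) / (h p)\<^sup>2"
proof -
  have "((\<lambda>t. g (p(i := t)) / h (p(i := t))) has_real_derivative
     (pd i g p * h (p(i := p i)) - g (p(i := p i)) * pd i h p) / (h (p(i := p i)) * h (p(i := p i)))) (at (p i))"
    by (rule DERIV_divide) (use assms csmooth_DERIV in auto)
  thus ?thesis unfolding pd_def[of i "\<lambda>p. g p / h p"]
    by (simp add: DERIV_imp_deriv power2_eq_square)
qed

text \<open>Two applications of the mean value theorem: in direction \<open>i\<close> to the
  difference taken in direction \<open>j\<close>, then in direction \<open>j\<close> to the
  derivative so obtained.\<close>

lemma second_difference:
  assumes "open U" "csmooth U h" "i \<noteq> j" "s > 0"
    and box: "\<And>x y. \<bar>x - p i\<bar> \<le> s \<Longrightarrow> \<bar>y - p j\<bar> \<le> s \<Longrightarrow> p(i := x, j := y) \<in> U"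
  shows "\<exists>x y. \<bar>x - p i\<bar> \<le> s \<and> \<bar>y - p j\<bar> \<le> s \<and>
     h (p(i := p i + s, j := p j + s)) - h (p(i := p i + s)) - h (p(j := p j + s)) + h p
       = s * s * pd j (pd i h) (p(i := x, j := y))"
proof -
  define g where "g = (\<lambda>x. h (p(i := x, j := p j + s)) - h (p(i := x, j := p j)))"
  have d: "((\<lambda>x. h (p(i := x, j := y))) has_real_derivative pd i h (p(i := x, j := y))) (at x)"
    if "\<bar>x - p i\<bar> \<le> s" "\<bar>y - p j\<bar> \<le> s" for x y
    using csmooth_DERIV_upd[OF assms(2), of "p(j := y)" i x] box[OF that] assms(3)
    by (simp add: fun_upd_twist)
  have "\<exists>z>p i. z < p i + s \<and> g (p i + s) - g (p i) =
      (p i + s - p i) * (pd i h (p(i := z, j := p j + s)) - pd i h (p(i := z, j := p j)))"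
    unfolding g_def by (rule MVT2) (use assms(4) in \<open>auto simp del: fun_upd_apply intro!: DERIV_diff d\<close>)
  then obtain x where x: "p i < x" "x < p i + s"
    "g (p i + s) - g (p i) = s * (pd i h (p(i := x, j := p j + s)) - pd i h (p(i := x, j := p j)))" by auto
  have "\<exists>z>p j. z < p j + s \<and> pd i h (p(i := x, j := p j + s)) - pd i h (p(i := x, j := p j)) =
      (p j + s - p j) * pd j (pd i h) (p(i := x, j := z))"
    by (rule MVT2) (use assms(4) x box csmooth_DERIV_upd[OF csmooth_pd[OF assms(2)], of "p(i := x)" j] in \<open>auto simp del: fun_upd_apply\<close>)
  then obtain y where y: "p j < y" "y < p j + s"
    "pd i h (p(i := x, j := p j + s)) - pd i h (p(i := x, j := p j)) = s * pd j (pd i h) (p(i := x, j := y))"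
    by auto
  have "(p(i := p i + s))(j := p j) = p(i := p i + s)" "p(i := p i, j := p j) = p"
    "p(i := p i, j := p j + s) = p(j := p j + s)"
    using assms(3) by auto
  hence "h (p(i := p i + s, j := p j + s)) - h (p(i := p i + s)) - h (p(j := p j + s)) + h p = g (p i + s) - g (p i)"
    by (simp add: g_def)
  thus ?thesis using x y by (intro exI[of _ x] exI[of _ y]) auto
qed

text \<open>The second difference is symmetric in the two directions, so each mixed derivative, at a
  suitable point of a small rectangle, equals the same quotient. Continuity gives equality at
  \<open>p\<close> as the rectangles shrink.\<close>

lemma pd_commute:
  assumes "open U" "csmooth U h" "p \<in> U"
  shows "pd i (pd j h) p = pd j (pd i h) p"
proof (cases "i = j")
  case False
  obtain M \<delta> where B: "\<delta> > 0" "box_nbhd p M \<delta> \<subseteq> U" using open_contains_box_nbhd assms(1,3) by blast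
  \<comment> \<open>The shift by 2 makes every step strictly smaller than \<open>\<delta>\<close>,
    so the closed squares stay in the box.\<close>
  define s where "s = (\<lambda>n. \<delta> / real (n + 2))"
  have s: "s n > 0" "s n < \<delta>" for n
  proof -
    have "\<delta> * 1 < \<delta> * real (n + 2)" using B(1) by (intro mult_strict_left_mono) auto
    thus "s n > 0" "s n < \<delta>" using B(1) by (auto simp: s_def divide_less_eq)
  qed
  have s0: "s \<longlonglongrightarrow> 0" unfolding s_def
    using LIMSEQ_ignore_initial_segment[OF lim_const_over_n[of \<delta>], of 2] by simp
  have in_box: "p(i := x, j := y) \<in> U" if "\<bar>x - p i\<bar> \<le> s n" "\<bar>y - p j\<bar> \<le> s n" for x y n
    using that s[of n] B by (auto simp: box_nbhd_def)
  have "\<exists>x y x' y'. \<bar>x - p i\<bar> \<le> s n \<and> \<bar>y - p j\<bar> \<le> s n \<and> \<bar>x' - p i\<bar> \<le> s n \<and> \<bar>y' - p j\<bar> \<le> s n \<and>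
      pd j (pd i h) (p(i := x, j := y)) = pd i (pd j h) (p(i := x', j := y'))" for n
  proof -
    obtain x y where xy: "\<bar>x - p i\<bar> \<le> s n \<and> \<bar>y - p j\<bar> \<le> s n \<and>
     h (p(i := p i + s n, j := p j + s n)) - h (p(i := p i + s n)) - h (p(j := p j + s n)) + h p
       = s n * s n * pd j (pd i h) (p(i := x, j := y))"
      using second_difference[OF assms(1,2) False s(1)[of n], of p, OF in_box[of _ n]] by blast
    have in_box': "p(j := y, i := x) \<in> U" if "\<bar>y - p j\<bar> \<le> s n" "\<bar>x - p i\<bar> \<le> s n" for x y
      using in_box[OF that(2,1)] False by (simp add: fun_upd_twist)
    obtain y' x' where xy': "\<bar>y' - p j\<bar> \<le> s n \<and> \<bar>x' - p i\<bar> \<le> s n \<and>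
     h (p(j := p j + s n, i := p i + s n)) - h (p(j := p j + s n)) - h (p(i := p i + s n)) + h p
       = s n * s n * pd i (pd j h) (p(j := y', i := x'))"
      using second_difference[OF assms(1,2) False[symmetric] s(1)[of n], of p, OF in_box'] by blast
    have e: "p(j := a, i := b) = p(i := b, j := a)" for a b
      using False by (rule fun_upd_twist[symmetric])
    have "s n * s n * pd j (pd i h) (p(i := x, j := y)) = s n * s n * pd i (pd j h) (p(i := x', j := y'))"
      using xy xy' unfolding e by linarith
    hence "pd j (pd i h) (p(i := x, j := y)) = pd i (pd j h) (p(i := x', j := y'))"
      using s(1)[of n] by simp
    thus ?thesis using xy xy' by blast
  qed
  then obtain x y x' y' where *: "\<And>n. \<bar>x n - p i\<bar> \<le> s n" "\<And>n. \<bar>y n - p j\<bar> \<le> s n"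
    "\<And>n. \<bar>x' n - p i\<bar> \<le> s n" "\<And>n. \<bar>y' n - p j\<bar> \<le> s n"
    "\<And>n. pd j (pd i h) (p(i := x n, j := y n)) = pd i (pd j h) (p(i := x' n, j := y' n))" by metis
  have lim: "(\<lambda>n. F (p(i := a n, j := b n))) \<longlonglongrightarrow> F p"
    if F: "csmooth U F" and ab: "\<And>n. \<bar>a n - p i\<bar> \<le> s n" "\<And>n. \<bar>b n - p j\<bar> \<le> s n" for F a b
  proof -
    have l: "c \<longlonglongrightarrow> l" if "\<And>n. \<bar>c n - l\<bar> \<le> s n" for c l
      by (rule LIM_zero_cancel, rule Lim_null_comparison[OF _ s0]) (use that in auto)
    have "(\<lambda>n. p(i := a n, j := b n)) \<longlonglongrightarrow> p"
    proof (rule tendsto_pointwiseI)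
      fix k
      show "(\<lambda>n. (p(i := a n, j := b n)) k) \<longlonglongrightarrow> p k"
        using l[of a, OF ab(1)] l[of b, OF ab(2)] by (cases "k = i"; cases "k = j") auto
    qed
    moreover have "isCont F p"
      using csmooth_continuous[OF F] assms(1,3) continuous_on_eq_continuous_at by blast
    ultimately show ?thesis using isCont_tendsto_compose by blast
  qed
  have "(\<lambda>n. pd j (pd i h) (p(i := x n, j := y n))) \<longlonglongrightarrow> pd j (pd i h) p"
    by (rule lim) (use * csmooth_pd assms in auto)
  moreover have "(\<lambda>n. pd j (pd i h) (p(i := x n, j := y n))) \<longlonglongrightarrow> pd i (pd j h) p"
    unfolding *(5) by (rule lim) (use * csmooth_pd assms in auto)
  ultimately show ?thesis by (rule LIMSEQ_unique[symmetric])
qed simp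

section \<open>Smooth codistributions and their ranks at generic points\<close>

text \<open>Smooth functions of finite but unspecified order. Finite order turns total derivatives
  into finite sums.\<close>

definition fsmooth :: "(nat \<Rightarrow> real) set \<Rightarrow> ((nat \<Rightarrow> real) \<Rightarrow> real) \<Rightarrow> bool" where
  "fsmooth U h \<longleftrightarrow> csmooth U h \<and> (\<exists>m. depends_below m h)"

lemma fsmooth_csmooth: "fsmooth U h \<Longrightarrow> csmooth U h" by (simp add: fsmooth_def)

lemma depends_below_op:
  assumes "depends_below m g" "depends_below m' h"
  shows "depends_below (max m m') (\<lambda>p. F (g p) (h p))"
  using depends_below_mono[OF assms(1), of "max m m'"] depends_below_mono[OF assms(2), of "max m m'"]
  by (simp add: depends_below_def)

lemma depends_below_const: "depends_below m (\<lambda>p. c)" by (simp add: depends_below_def)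

lemma depends_below_coord: "c < m \<Longrightarrow> depends_below m (\<lambda>p. p c)" by (simp add: depends_below_def tr_def)

lemma fsmooth_subset: "fsmooth U h \<Longrightarrow> U' \<subseteq> U \<Longrightarrow> fsmooth U' h"
  using csmooth_subset by (auto simp: fsmooth_def)
lemma fsmooth_const: "fsmooth U (\<lambda>p. c)" using csmooth_const depends_below_const by (auto simp: fsmooth_def)
lemma fsmooth_coord: "fsmooth U (\<lambda>p. p c)" using csmooth_coord depends_below_coord[of c "Suc c"] by (auto simp: fsmooth_def)
lemma fsmooth_add: "open U \<Longrightarrow> fsmooth U g \<Longrightarrow> fsmooth U h \<Longrightarrow> fsmooth U (\<lambda>p. g p + h p)"
  unfolding fsmooth_def using csmooth_add depends_below_op[of _ g _ h "(+)"] by blast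
lemma fsmooth_diff: "open U \<Longrightarrow> fsmooth U g \<Longrightarrow> fsmooth U h \<Longrightarrow> fsmooth U (\<lambda>p. g p - h p)"
  unfolding fsmooth_def using csmooth_diff depends_below_op[of _ g _ h "(-)"] by blast
lemma fsmooth_mult: "open U \<Longrightarrow> fsmooth U g \<Longrightarrow> fsmooth U h \<Longrightarrow> fsmooth U (\<lambda>p. g p * h p)"
  unfolding fsmooth_def using csmooth_mult depends_below_op[of _ g _ h "(*)"] by blast
lemma fsmooth_divide: "open U \<Longrightarrow> fsmooth U g \<Longrightarrow> fsmooth U h \<Longrightarrow> (\<And>p. p \<in> U \<Longrightarrow> h p \<noteq> 0) \<Longrightarrow> fsmooth U (\<lambda>p. g p / h p)"
  unfolding fsmooth_def using csmooth_divide[of U g h] depends_below_op[of _ g _ h "(/)"] by blast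
lemma fsmooth_pd: "fsmooth U h \<Longrightarrow> fsmooth U (pd c h)"
  unfolding fsmooth_def using csmooth_pd depends_below_pd by blast
lemma fsmooth_sum:
  assumes "open U" "finite I" "\<And>i. i \<in> I \<Longrightarrow> fsmooth U (h i)"
  shows "fsmooth U (\<lambda>p. \<Sum>i\<in>I. h i p)"
  using assms(2,3)
proof (induction I rule: finite_induct)
  case empty
  show ?case using fsmooth_const[of U 0] by (simp only: sum.empty)
next
  case (insert i I)
  have "fsmooth U (\<lambda>p. h i p + (\<Sum>i\<in>I. h i p))"
    by (rule fsmooth_add[OF assms(1)]) (use insert.prems insert.IH in blast)+
  thus ?case by (simp only: sum.insert[OF insert.hyps])
qed

lemma open_nonzero:
  assumes "open U" "csmooth U h"
  shows "open {p \<in> U. h p \<noteq> 0}"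
proof -
  have "open (U \<inter> h -` (- {0}))"
    by (rule continuous_open_preimage[OF csmooth_continuous[OF assms(2)] assms(1)]) auto
  also have "U \<inter> h -` (- {0}) = {p \<in> U. h p \<noteq> 0}" by auto
  finally show ?thesis .
qed

text \<open>The cotangent space of jet space at a point; a covector is the family of its
  components.\<close>

interpretation fv: vector_space "\<lambda>(r::real) (v::nat \<Rightarrow> real) i. r * v i"
  by standard (auto simp: fun_eq_iff algebra_simps)

text \<open>Independence of a family, not of a set: two differentials may coincide at a point, which
  the set of values would hide.\<close>

definition indep :: "('i \<Rightarrow> nat \<Rightarrow> real) \<Rightarrow> 'i set \<Rightarrow> bool" where
  "indep v I \<longleftrightarrow> inj_on v I \<and> fv.independent (v ` I)"

lemma indep_empty: "indep v {}"
  by (simp add: indep_def fv.independent_empty)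

lemma indep_insert: "indep v I \<Longrightarrow> v i \<notin> fv.span (v ` I) \<Longrightarrow> indep v (insert i I)"
  unfolding indep_def using fv.span_base[of "v i" "v ` I"]
  by (auto simp: fv.independent_insert inj_on_insert)

lemma indep_notin: assumes "indep v I" "i \<in> I" shows "v i \<notin> fv.span (v ` (I - {i}))"
proof -
  have "v ` (I - {i}) = v ` I - {v i}"
    using assms by (auto simp: indep_def inj_on_def)
  thus ?thesis using assms unfolding indep_def fv.dependent_def by (metis imageI)
qed

lemma indep_subset: "indep v I \<Longrightarrow> J \<subseteq> I \<Longrightarrow> indep v J"
  unfolding indep_def using fv.independent_mono inj_on_subset by (metis image_mono)

lemma indep_notin': "indep v I \<Longrightarrow> i \<in> I \<Longrightarrow> J \<subseteq> I \<Longrightarrow> i \<notin> J \<Longrightarrow> v i \<notin> fv.span (v ` J)"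
  using indep_notin[of v I i] fv.span_mono[of "v ` J" "v ` (I - {i})"] by blast

lemma indep_card_le:
  assumes "indep v I" "v ` I \<subseteq> fv.span T" "finite T"
  shows "card I \<le> card T"
  using fv.independent_span_bound[OF assms(3) _ assms(2)] assms(1)
  by (auto simp: indep_def card_image)

section \<open>One-forms, coded by their coefficient functions, and spans with smooth
  coefficients\<close>

definition covec_at :: "(nat \<Rightarrow> real) \<Rightarrow> (nat \<Rightarrow> (nat \<Rightarrow> real) \<Rightarrow> real) \<Rightarrow> nat \<Rightarrow> real" where
  "covec_at p \<theta> = (\<lambda>c. \<theta> c p)"

definition exact_form :: "((nat \<Rightarrow> real) \<Rightarrow> real) \<Rightarrow> nat \<Rightarrow> (nat \<Rightarrow> real) \<Rightarrow> real" where
  "exact_form h = (\<lambda>c p. pd c h p)"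

definition diff_at :: "(nat \<Rightarrow> real) \<Rightarrow> ((nat \<Rightarrow> real) \<Rightarrow> real) \<Rightarrow> nat \<Rightarrow> real" where
  "diff_at p h = (\<lambda>c. pd c h p)"

lemma covec_at_exact_form: "covec_at p (exact_form h) = diff_at p h"
  by (simp add: covec_at_def exact_form_def diff_at_def)

text \<open>Linear combinations with smooth coefficients on \<open>U\<close>; the pointwise counterpart is
  \<open>fv.span\<close> of the values at a point.\<close>

inductive form_span :: "(nat \<Rightarrow> real) set \<Rightarrow> (nat \<Rightarrow> (nat \<Rightarrow> real) \<Rightarrow> real) set \<Rightarrow> (nat \<Rightarrow> (nat \<Rightarrow> real) \<Rightarrow> real) \<Rightarrow> bool"
  for U S where
  form_span_zero: "(\<And>p c. p \<in> U \<Longrightarrow> \<theta> c p = 0) \<Longrightarrow> form_span U S \<theta>"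
| form_span_step: "form_span U S \<theta>' \<Longrightarrow> \<omega> \<in> S \<Longrightarrow> fsmooth U a \<Longrightarrow> (\<And>p c. p \<in> U \<Longrightarrow> \<theta> c p = \<theta>' c p + a p * \<omega> c p)
     \<Longrightarrow> form_span U S \<theta>"

lemma form_span_cong: "form_span U S \<theta> \<Longrightarrow> (\<And>p c. p \<in> U \<Longrightarrow> \<theta> c p = \<theta>' c p) \<Longrightarrow> form_span U S \<theta>'"
proof (induction rule: form_span.induct)
  case (form_span_zero \<theta>)
  thus ?case by (intro form_span.form_span_zero) simp
next
  case (form_span_step \<theta>1 \<omega> a \<theta>)
  show ?case by (rule form_span.form_span_step[OF form_span_step.hyps(1-3)]) (use form_span_step in simp)
qed

lemma form_span_base: "\<omega> \<in> S \<Longrightarrow> form_span U S \<omega>"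
  by (rule form_span_step[of U S "\<lambda>c p. 0" \<omega> "\<lambda>p. 1"]) (auto intro: form_span_zero fsmooth_const)

lemma form_span_mono: "form_span U S \<theta> \<Longrightarrow> S \<subseteq> S' \<Longrightarrow> form_span U S' \<theta>"
proof (induction rule: form_span.induct)
  case (form_span_zero \<theta>)
  show ?case by (rule form_span.form_span_zero) (use form_span_zero in auto)
next
  case (form_span_step \<theta>1 \<omega> a \<theta>)
  show ?case by (rule form_span.form_span_step[of _ _ \<theta>1 \<omega> a]) (use form_span_step in auto)
qed

lemma form_span_subset: "form_span U S \<theta> \<Longrightarrow> U' \<subseteq> U \<Longrightarrow> form_span U' S \<theta>"
proof (induction rule: form_span.induct)
  case (form_span_zero \<theta>)
  show ?case by (rule form_span.form_span_zero) (use form_span_zero in auto)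
next
  case (form_span_step \<theta>1 \<omega> a \<theta>)
  show ?case by (rule form_span.form_span_step[of _ _ \<theta>1 \<omega> a]) (use form_span_step fsmooth_subset in auto)
qed

lemma form_span_add: "form_span U S \<theta> \<Longrightarrow> form_span U S \<theta>' \<Longrightarrow> form_span U S (\<lambda>c p. \<theta>' c p + \<theta> c p)"
proof (induction rule: form_span.induct)
  case (form_span_zero \<theta>)
  show ?case by (rule form_span_cong[OF form_span_zero(2)]) (use form_span_zero in simp)
next
  case (form_span_step \<theta>1 \<omega> a \<theta>)
  show ?case by (rule form_span.form_span_step[OF form_span_step.IH[OF form_span_step.prems] form_span_step.hyps(2,3)]) (use form_span_step.hyps in simp)
qed

lemma form_span_scale: "open U \<Longrightarrow> fsmooth U b \<Longrightarrow> form_span U S \<theta> \<Longrightarrow> form_span U S (\<lambda>c p. b p * \<theta> c p)"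
proof -
  assume U: "open U" "fsmooth U b"
  show "form_span U S \<theta> \<Longrightarrow> form_span U S (\<lambda>c p. b p * \<theta> c p)"
  proof (induction rule: form_span.induct)
    case (form_span_zero \<theta>)
    show ?case by (rule form_span.form_span_zero) (use form_span_zero in simp)
  next
    case (form_span_step \<theta>1 \<omega> a \<theta>)
    show ?case
      by (rule form_span.form_span_step[OF form_span_step.IH form_span_step.hyps(2) fsmooth_mult[OF U form_span_step.hyps(3)]])
         (use form_span_step.hyps in \<open>simp add: algebra_simps\<close>)
  qed
qed

lemma form_span_diff: "open U \<Longrightarrow> form_span U S \<theta> \<Longrightarrow> form_span U S \<theta>' \<Longrightarrow> form_span U S (\<lambda>c p. \<theta> c p - \<theta>' c p)"
  using form_span_add[OF form_span_scale[OF _ fsmooth_const[of U "-1"]], of S \<theta>' \<theta>] by simp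

lemma form_span_trans:
  assumes "open U" "form_span U S \<theta>" "\<And>\<omega>. \<omega> \<in> S \<Longrightarrow> form_span U S' \<omega>"
  shows "form_span U S' \<theta>"
  using assms(2)
proof (induction rule: form_span.induct)
  case (form_span_zero \<theta>)
  thus ?case by (rule form_span.form_span_zero)
next
  case (form_span_step \<theta>1 \<omega> a \<theta>)
  show ?case
    by (rule form_span_cong[OF form_span_add[OF form_span_scale[OF assms(1) form_span_step.hyps(3) assms(3)[OF form_span_step.hyps(2)]] form_span_step.IH]])
       (use form_span_step.hyps in simp)
qed

text \<open>It isolates the coefficient of one distinguished form, so that one can later divide by
  it on the open set where it does not vanish.\<close>

lemma form_span_insertE:
  assumes "open U" "form_span U (insert \<omega> S) \<theta>"
  obtains a where "fsmooth U a" "form_span U S (\<lambda>c p. \<theta> c p - a p * \<omega> c p)"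
proof -
  from assms(2) have "\<exists>a. fsmooth U a \<and> form_span U S (\<lambda>c p. \<theta> c p - a p * \<omega> c p)"
  proof (induction rule: form_span.induct)
    case (form_span_zero \<theta>)
    show ?case by (rule exI[of _ "\<lambda>p. 0"]) (use form_span_zero in \<open>auto intro!: form_span.form_span_zero fsmooth_const\<close>)
  next
    case (form_span_step \<theta>1 \<eta> b \<theta>)
    from form_span_step.IH obtain a where a: "fsmooth U a" "form_span U S (\<lambda>c p. \<theta>1 c p - a p * \<omega> c p)" by blast
    show ?case
    proof (cases "\<eta> = \<omega>")
      case True
      have "form_span U S (\<lambda>c p. \<theta> c p - (a p + b p) * \<omega> c p)"
        by (rule form_span_cong[OF a(2)]) (use True form_span_step.hyps in \<open>simp add: algebra_simps\<close>)
      thus ?thesis using fsmooth_add[OF assms(1) a(1) form_span_step.hyps(3)] by blast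
    next
      case False
      hence "\<eta> \<in> S" using form_span_step.hyps by blast
      hence "form_span U S (\<lambda>c p. \<theta> c p - a p * \<omega> c p)"
        by (rule form_span.form_span_step[OF a(2) _ form_span_step.hyps(3)]) (use form_span_step.hyps in simp)
      thus ?thesis using a(1) by blast
    qed
  qed
  thus ?thesis using that by blast
qed

lemma form_span_span: "form_span U S \<theta> \<Longrightarrow> p \<in> U \<Longrightarrow> covec_at p \<theta> \<in> fv.span (covec_at p ` S)"
proof (induction rule: form_span.induct)
  case (form_span_zero \<theta>)
  hence "covec_at p \<theta> = 0" by (auto simp: covec_at_def fun_eq_iff)
  thus ?case by (simp only: fv.span_zero)
next
  case (form_span_step \<theta>1 \<omega> a \<theta>)
  have "covec_at p \<theta> = covec_at p \<theta>1 + (\<lambda>i. a p * covec_at p \<omega> i)"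
    using form_span_step by (auto simp: covec_at_def fun_eq_iff)
  also have "\<dots> \<in> fv.span (covec_at p ` S)"
    using form_span_step fv.span_base[of "covec_at p \<omega>" "covec_at p ` S"] by (intro fv.span_add fv.span_scale) auto
  finally show ?case .
qed

lemma form_span_diff_at_span:
  assumes "form_span U (exact_form ` S) (exact_form h)" "p \<in> U"
  shows "diff_at p h \<in> fv.span (diff_at p ` S)"
  using form_span_span[OF assms] by (simp add: covec_at_exact_form image_image)

text \<open>An explicit finite sum is what can be differentiated term by term; the generators
  \<open>g i\<close> may repeat.\<close>

lemma form_span_coeffs:
  assumes "form_span U (exact_form ` S) \<theta>"
  obtains N a g where "\<And>i. i < N \<Longrightarrow> fsmooth U (a i)" "\<And>i. i < N \<Longrightarrow> g i \<in> S"
     "\<And>p c. p \<in> U \<Longrightarrow> \<theta> c p = (\<Sum>i<(N::nat). a i p * pd c (g i) p)"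
proof -
  from assms have "\<exists>N a g. (\<forall>i<(N::nat). fsmooth U (a i) \<and> g i \<in> S) \<and>
     (\<forall>p\<in>U. \<forall>c. \<theta> c p = (\<Sum>i<N. a i p * pd c (g i) p))"
  proof (induction rule: form_span.induct)
    case (form_span_zero \<theta>)
    show ?case by (rule exI[of _ 0]) (use form_span_zero in auto)
  next
    case (form_span_step \<theta>1 \<omega> b \<theta>)
    from form_span_step.IH obtain N :: nat and a g where *: "\<forall>i<N. fsmooth U (a i) \<and> g i \<in> S"
      "\<forall>p\<in>U. \<forall>c. \<theta>1 c p = (\<Sum>i<N. a i p * pd c (g i) p)" by blast
    obtain h where h: "h \<in> S" "\<omega> = exact_form h" using form_span_step.hyps by blast
    have "\<forall>i<Suc N. fsmooth U ((a(N := b)) i) \<and> (g(N := h)) i \<in> S"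
      using * h form_span_step.hyps(3) by auto
    moreover have "\<forall>p\<in>U. \<forall>c. \<theta> c p = (\<Sum>i<Suc N. (a(N := b)) i p * pd c ((g(N := h)) i) p)"
      using * h form_span_step.hyps(4) by (auto simp: exact_form_def)
    ultimately show ?case by blast
  qed
  thus ?thesis using that by blast
qed

lemma form_span_sum:
  assumes "open U" "\<And>i. i < (N::nat) \<Longrightarrow> form_span U S (\<theta> i)"
  shows "form_span U S (\<lambda>c p. \<Sum>i<N. \<theta> i c p)"
  using assms(2)
proof (induction N)
  case 0
  show ?case by (rule form_span_zero) simp
next
  case (Suc N)
  have "form_span U S (\<lambda>c p. (\<Sum>i<N. \<theta> i c p) + \<theta> N c p)"
    by (rule form_span_add) (use Suc in auto)
  thus ?case by simp
qed

definition smooth_form :: "(nat \<Rightarrow> real) set \<Rightarrow> (nat \<Rightarrow> (nat \<Rightarrow> real) \<Rightarrow> real) \<Rightarrow> bool" where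
  "smooth_form U \<theta> \<longleftrightarrow> (\<forall>c. fsmooth U (\<theta> c))"

lemma smooth_form_subset: "smooth_form U \<theta> \<Longrightarrow> U' \<subseteq> U \<Longrightarrow> smooth_form U' \<theta>"
  unfolding smooth_form_def using fsmooth_subset by blast

lemma smooth_form_exact_form: "fsmooth U h \<Longrightarrow> smooth_form U (exact_form h)"
  using fsmooth_pd by (auto simp: smooth_form_def exact_form_def)

text \<open>A reduction removes from a form its component along \<open>S\<close>, smoothly and pointwise linearly.
  It exists after shrinking \<open>U\<close>: forms are added to \<open>S\<close> one by one, each either already
  reduces to zero or provides a component that can be divided by near some point.\<close>

definition reduction where
  "reduction U S \<rho> \<longleftrightarrow>
     (\<forall>V \<theta>. open V \<longrightarrow> V \<subseteq> U \<longrightarrow> smooth_form V \<theta> \<longrightarrow> smooth_form V (\<rho> \<theta>) \<and> form_span V S (\<lambda>c p. \<theta> c p - \<rho> \<theta> c p)) \<and>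
     (\<forall>p\<in>U. \<forall>\<theta>. covec_at p \<theta> \<in> fv.span (covec_at p ` S) \<longrightarrow> (\<forall>c. \<rho> \<theta> c p = 0)) \<and>
     (\<forall>p\<in>U. \<forall>\<theta> \<theta>' \<omega> k. (\<forall>c. \<theta> c p = \<theta>' c p + k * \<omega> c p) \<longrightarrow>
        (\<forall>c. \<rho> \<theta> c p = \<rho> \<theta>' c p + k * \<rho> \<omega> c p))"

lemma reductionD:
  assumes "reduction U S \<rho>"
  shows "\<And>V \<theta>. open V \<Longrightarrow> V \<subseteq> U \<Longrightarrow> smooth_form V \<theta> \<Longrightarrow> smooth_form V (\<rho> \<theta>)"
    and "\<And>V \<theta>. open V \<Longrightarrow> V \<subseteq> U \<Longrightarrow> smooth_form V \<theta> \<Longrightarrow> form_span V S (\<lambda>c p. \<theta> c p - \<rho> \<theta> c p)"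
    and "\<And>p \<theta> c. p \<in> U \<Longrightarrow> covec_at p \<theta> \<in> fv.span (covec_at p ` S) \<Longrightarrow> \<rho> \<theta> c p = 0"
    and "\<And>p \<theta> \<theta>' \<omega> k c. p \<in> U \<Longrightarrow> (\<And>c. \<theta> c p = \<theta>' c p + k * \<omega> c p)
           \<Longrightarrow> \<rho> \<theta> c p = \<rho> \<theta>' c p + k * \<rho> \<omega> c p"
proof -
  note * = assms[unfolded reduction_def]
  note 1 = *[THEN conjunct1, rule_format] and 2 = *[THEN conjunct2, THEN conjunct1, rule_format]
    and 3 = *[THEN conjunct2, THEN conjunct2, rule_format]
  show "smooth_form V (\<rho> \<theta>)" if "open V" "V \<subseteq> U" "smooth_form V \<theta>" for V \<theta>
    by (rule 1[OF that, THEN conjunct1])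
  show "form_span V S (\<lambda>c p. \<theta> c p - \<rho> \<theta> c p)" if "open V" "V \<subseteq> U" "smooth_form V \<theta>" for V \<theta>
    by (rule 1[OF that, THEN conjunct2])
  show "\<rho> \<theta> c p = 0" if "p \<in> U" "covec_at p \<theta> \<in> fv.span (covec_at p ` S)" for p \<theta> c
    by (rule 2[OF that])
  show "\<rho> \<theta> c p = \<rho> \<theta>' c p + k * \<rho> \<omega> c p"
    if "p \<in> U" "\<And>c. \<theta> c p = \<theta>' c p + k * \<omega> c p" for p \<theta> \<theta>' \<omega> k c
    by (rule 3) (fact that)+
qed

lemma reductionI:
  assumes "\<And>V \<theta>. open V \<Longrightarrow> V \<subseteq> U \<Longrightarrow> smooth_form V \<theta> \<Longrightarrow> smooth_form V (\<rho> \<theta>) \<and> form_span V S (\<lambda>c p. \<theta> c p - \<rho> \<theta> c p)"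
    and "\<And>p \<theta> c. p \<in> U \<Longrightarrow> covec_at p \<theta> \<in> fv.span (covec_at p ` S) \<Longrightarrow> \<rho> \<theta> c p = 0"
    and "\<And>p \<theta> \<theta>' \<omega> k c. p \<in> U \<Longrightarrow> \<forall>c. \<theta> c p = \<theta>' c p + k * \<omega> c p
           \<Longrightarrow> \<rho> \<theta> c p = \<rho> \<theta>' c p + k * \<rho> \<omega> c p"
  shows "reduction U S \<rho>"
  unfolding reduction_def
proof (intro conjI[of "All _"] conjI[of "Ball _ _"] allI ballI impI)
  show "smooth_form V (\<rho> \<theta>) \<and> form_span V S (\<lambda>c p. \<theta> c p - \<rho> \<theta> c p)" if "open V" "V \<subseteq> U" "smooth_form V \<theta>" for V \<theta>
    by (rule assms(1)[OF that])
  show "\<rho> \<theta> c p = 0" if "p \<in> U" "covec_at p \<theta> \<in> fv.span (covec_at p ` S)" for p \<theta> c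
    by (rule assms(2)[OF that])
  show "\<rho> \<theta> c p = \<rho> \<theta>' c p + k * \<rho> \<omega> c p"
    if "p \<in> U" "\<forall>c. \<theta> c p = \<theta>' c p + k * \<omega> c p" for p \<theta> \<theta>' \<omega> k c
    by (rule assms(3)) (fact that)+
qed

lemma reduction_exists:
  assumes "finite S" "\<forall>\<omega>\<in>S. smooth_form U \<omega>" "open U" "U \<noteq> {}"
  shows "\<exists>U' \<rho>. open U' \<and> U' \<noteq> {} \<and> U' \<subseteq> U \<and> reduction U' S \<rho>"
  using assms(1,2)
proof (induction S rule: finite_induct)
  case empty
  have "reduction U {} (\<lambda>\<theta>. \<theta>)"
    by (rule reductionI) (auto intro!: form_span_zero simp: covec_at_def fun_eq_iff)
  thus ?case using assms(3,4) by blast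
next
  case (insert \<omega> S)
  then obtain U' \<rho> where U': "open U'" "U' \<noteq> {}" "U' \<subseteq> U" and \<rho>: "reduction U' S \<rho>" by auto
  note r1 = reductionD(1)[OF \<rho>] and r2 = reductionD(2)[OF \<rho>] and r3 = reductionD(3)[OF \<rho>]
    and r4 = reductionD(4)[OF \<rho>]
  have \<omega>: "smooth_form U' \<omega>" using insert.prems U'(3) smooth_form_subset by blast
  show ?case
  proof (cases "\<forall>p\<in>U'. \<forall>c. \<rho> \<omega> c p = 0")
    case True
    \<comment> \<open>\<open>\<omega>\<close> is itself a smooth combination of \<open>S\<close>, so
      the old reduction also serves the enlarged set.\<close>
    have "form_span U' S \<omega>" by (rule form_span_cong[OF r2[OF U'(1) subset_refl \<omega>]]) (use True in simp)
    hence in_span: "covec_at p \<omega> \<in> fv.span (covec_at p ` S)" if "p \<in> U'" for p using form_span_span that by blast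
    have "\<rho> \<theta> c p = 0" if "p \<in> U'" "covec_at p \<theta> \<in> fv.span (covec_at p ` insert \<omega> S)" for p \<theta> c
    proof -
      have "covec_at p \<theta> \<in> fv.span (covec_at p ` S)"
        using that(2) fv.span_redundant[OF in_span[OF that(1)]] by simp
      thus ?thesis using r3 that by blast
    qed
    moreover have "form_span V (insert \<omega> S) (\<lambda>c p. \<theta> c p - \<rho> \<theta> c p)" if "open V" "V \<subseteq> U'" "smooth_form V \<theta>" for V \<theta>
      using form_span_mono[OF r2[OF that]] by blast
    moreover note r1 r4
    ultimately have "reduction U' (insert \<omega> S) \<rho>"
      by (intro reductionI conjI) (assumption | simp)+
    thus ?thesis using U' by blast
  next
    case False
    then obtain p0 c0 where p0: "p0 \<in> U'" "\<rho> \<omega> c0 p0 \<noteq> 0" by blast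
    have \<rho>\<omega>: "smooth_form U' (\<rho> \<omega>)" by (rule r1[OF U'(1) subset_refl \<omega>])
    define U'' where "U'' = {p \<in> U'. \<rho> \<omega> c0 p \<noteq> 0}"
    have U'': "open U''" "U'' \<noteq> {}" "U'' \<subseteq> U'"
      using open_nonzero[OF U'(1)] \<rho>\<omega> p0 by (auto simp: U''_def smooth_form_def fsmooth_def)
    \<comment> \<open>Gaussian elimination with pivot \<open>c0\<close>: the reduced
      \<open>\<omega>\<close> is subtracted with the factor that cancels component
      \<open>c0\<close>.\<close>
    define \<rho>' where "\<rho>' = (\<lambda>\<theta> c p. \<rho> \<theta> c p - (\<rho> \<theta> c0 p / \<rho> \<omega> c0 p) * \<rho> \<omega> c p)"
    have nz: "\<rho> \<omega> c0 p \<noteq> 0" if "p \<in> U''" for p using that by (simp add: U''_def)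
    have 1: "smooth_form V (\<rho>' \<theta>) \<and> form_span V (insert \<omega> S) (\<lambda>c p. \<theta> c p - \<rho>' \<theta> c p)"
      if V: "open V" "V \<subseteq> U''" "smooth_form V \<theta>" for V \<theta>
    proof -
      have \<theta>: "smooth_form V (\<rho> \<theta>)" "form_span V S (\<lambda>c p. \<theta> c p - \<rho> \<theta> c p)"
        using r1 r2 V U'' by blast+
      have \<omega>V: "smooth_form V \<omega>" "smooth_form V (\<rho> \<omega>)" using \<omega> \<rho>\<omega> smooth_form_subset V U'' by blast+
      define k where "k = (\<lambda>p. \<rho> \<theta> c0 p / \<rho> \<omega> c0 p)"
      have k: "fsmooth V k" unfolding k_def
        by (rule fsmooth_divide[OF V(1)]) (use \<theta> \<omega>V nz V in \<open>auto simp: smooth_form_def\<close>)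
      have "fsmooth V (\<lambda>p. \<rho> \<theta> c p - k p * \<rho> \<omega> c p)" for c
        by (rule fsmooth_diff[OF V(1) _ fsmooth_mult[OF V(1) k]]) (use \<theta>(1) \<omega>V(2) in \<open>simp_all add: smooth_form_def\<close>)
      hence "smooth_form V (\<rho>' \<theta>)" by (simp add: smooth_form_def \<rho>'_def k_def)
      moreover have "form_span V S (\<lambda>c p. \<omega> c p - \<rho> \<omega> c p)" by (rule r2[OF V(1) _ \<omega>V(1)]) (use V U'' in blast)
      hence "form_span V (insert \<omega> S) (\<lambda>c p. \<omega> c p - \<rho> \<omega> c p)" by (rule form_span_mono) blast
      hence "form_span V (insert \<omega> S) (\<lambda>c p. \<omega> c p - (\<omega> c p - \<rho> \<omega> c p))"
        by (rule form_span_diff[OF V(1) form_span_base[OF insertI1]])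
      hence "form_span V (insert \<omega> S) (\<lambda>c p. k p * (\<omega> c p - (\<omega> c p - \<rho> \<omega> c p)))"
        by (rule form_span_scale[OF V(1) k])
      from form_span_add[OF this form_span_mono[OF \<theta>(2), of "insert \<omega> S"]]
      have "form_span V (insert \<omega> S) (\<lambda>c p. \<theta> c p - \<rho> \<theta> c p + k p * (\<omega> c p - (\<omega> c p - \<rho> \<omega> c p)))" by blast
      hence "form_span V (insert \<omega> S) (\<lambda>c p. \<theta> c p - \<rho>' \<theta> c p)"
        by (rule form_span_cong) (simp add: \<rho>'_def k_def)
      ultimately show ?thesis by blast
    qed
    have 2: "\<rho>' \<theta> c p = 0" if p: "p \<in> U''" and "covec_at p \<theta> \<in> fv.span (covec_at p ` insert \<omega> S)" for p \<theta> c
    proof -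
      from fv.span_breakdown[of "covec_at p \<omega>" "covec_at p ` insert \<omega> S" "covec_at p \<theta>", OF _ that(2)]
      obtain k where k: "covec_at p \<theta> - (\<lambda>i. k * covec_at p \<omega> i) \<in> fv.span (covec_at p ` insert \<omega> S - {covec_at p \<omega>})" by blast
      define \<theta>' where "\<theta>' = (\<lambda>c q. \<theta> c q - k * \<omega> c q)"
      have "covec_at p \<theta>' = covec_at p \<theta> - (\<lambda>i. k * covec_at p \<omega> i)" by (simp add: \<theta>'_def covec_at_def fun_eq_iff)
      hence "covec_at p \<theta>' \<in> fv.span (covec_at p ` S)"
        using k fv.span_mono[of "covec_at p ` insert \<omega> S - {covec_at p \<omega>}" "covec_at p ` S"] by auto
      hence z: "\<rho> \<theta>' c p = 0" for c using r3 p U'' by blast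
      have "\<rho> \<theta> c p = \<rho> \<theta>' c p + k * \<rho> \<omega> c p" for c
        by (rule r4) (use p U'' in \<open>auto simp: \<theta>'_def\<close>)
      thus ?thesis using z nz[OF p] by (simp add: \<rho>'_def)
    qed
    have 3: "\<rho>' \<theta> c p = \<rho>' \<theta>' c p + k * \<rho>' \<eta> c p"
      if p: "p \<in> U''" and "\<forall>c. \<theta> c p = \<theta>' c p + k * \<eta> c p" for p \<theta> \<theta>' \<eta> k c
    proof -
      have "\<rho> \<theta> c p = \<rho> \<theta>' c p + k * \<rho> \<eta> c p" for c
        by (rule r4) (use p U'' that in auto)
      thus ?thesis using nz[OF p] by (simp add: \<rho>'_def field_simps)
    qed
    have "reduction U'' (insert \<omega> S) \<rho>'" by (rule reductionI) (fact 1 2 3)+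
    thus ?thesis using U' U'' by blast
  qed
qed

text \<open>If the reduction of \<open>\<theta>\<close> vanishes identically,
  \<open>\<theta>\<close> is a smooth combination of \<open>S\<close>. If not, some component is
  nonzero on an open set, and there \<open>\<theta>\<close> is outside the pointwise span, because
  the reduction annihilates that span.\<close>

lemma generic_dichotomy:
  assumes "finite S" "\<forall>\<omega>\<in>S. smooth_form U \<omega>" "smooth_form U \<theta>" "open U" "U \<noteq> {}"
  obtains U' where "open U'" "U' \<noteq> {}" "U' \<subseteq> U" "form_span U' S \<theta>"
    | U' where "open U'" "U' \<noteq> {}" "U' \<subseteq> U" "\<And>p. p \<in> U' \<Longrightarrow> covec_at p \<theta> \<notin> fv.span (covec_at p ` S)"
proof -
  obtain U' \<rho> where U': "open U'" "U' \<noteq> {}" "U' \<subseteq> U" and \<rho>: "reduction U' S \<rho>"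
    using reduction_exists[OF assms(1,2,4,5)] by blast
  note r1 = reductionD(1)[OF \<rho>] and r2 = reductionD(2)[OF \<rho>] and r3 = reductionD(3)[OF \<rho>]
  have \<theta>: "smooth_form U' \<theta>" using assms(3) U'(3) smooth_form_subset by blast
  show ?thesis
  proof (cases "\<forall>p\<in>U'. \<forall>c. \<rho> \<theta> c p = 0")
    case True
    have "form_span U' S \<theta>" by (rule form_span_cong[OF r2[OF U'(1) subset_refl \<theta>]]) (use True in simp)
    thus ?thesis using that(1) U' by blast
  next
    case False
    then obtain p0 c0 where p0: "p0 \<in> U'" "\<rho> \<theta> c0 p0 \<noteq> 0" by blast
    have \<rho>\<theta>: "smooth_form U' (\<rho> \<theta>)" by (rule r1[OF U'(1) subset_refl \<theta>])
    define U'' where "U'' = {p \<in> U'. \<rho> \<theta> c0 p \<noteq> 0}"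
    have "open U''" "U'' \<noteq> {}" "U'' \<subseteq> U"
      using open_nonzero[OF U'(1)] \<rho>\<theta> p0 U'(3) by (auto simp: U''_def smooth_form_def fsmooth_def)
    moreover have "covec_at p \<theta> \<notin> fv.span (covec_at p ` S)" if "p \<in> U''" for p
      using r3 that by (auto simp: U''_def)
    ultimately show ?thesis using that(2) by blast
  qed
qed

text \<open>The derivative along the vector field with components \<open>W c\<close>. Summing over
  the support of the differential avoids carrying an order along; for functions of finite order the
  support is finite.\<close>

definition total_deriv :: "(nat \<Rightarrow> (nat \<Rightarrow> real) \<Rightarrow> real) \<Rightarrow> ((nat \<Rightarrow> real) \<Rightarrow> real) \<Rightarrow> (nat \<Rightarrow> real) \<Rightarrow> real" where
  "total_deriv W h p = (\<Sum>c | pd c h p \<noteq> 0. W c p * pd c h p)"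

lemma total_deriv_eq: "depends_below m h \<Longrightarrow> total_deriv W h p = (\<Sum>c<m. W c p * pd c h p)"
  unfolding total_deriv_def
  by (rule sum.mono_neutral_left) (use depends_below_pd_zero[of m h] in \<open>auto simp: not_less[symmetric]\<close>)

lemma fsmooth_total_deriv:
  assumes "open U" "\<And>c. fsmooth U (W c)" "fsmooth U h"
  shows "fsmooth U (total_deriv W h)"
proof -
  obtain m where m: "depends_below m h" using assms(3) by (auto simp: fsmooth_def)
  have "total_deriv W h = (\<lambda>p. \<Sum>c<m. W c p * pd c h p)" using total_deriv_eq[OF m] by auto
  thus ?thesis using assms fsmooth_pd by (auto intro!: fsmooth_sum fsmooth_mult)
qed

lemma pd_total_deriv:
  assumes "open U" "\<And>c. fsmooth U (W c)" "fsmooth U h" "depends_below m h" "p \<in> U"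
  shows "pd j (total_deriv W h) p = (\<Sum>c<m. pd j (W c) p * pd c h p + W c p * pd c (pd j h) p)"
proof -
  have e: "total_deriv W h = (\<lambda>p. \<Sum>c<m. W c p * pd c h p)" using total_deriv_eq[OF assms(4)] by auto
  have "pd j (\<lambda>p. \<Sum>c<m. W c p * pd c h p) p = (\<Sum>c<m. pd j (\<lambda>p. W c p * pd c h p) p)"
    by (rule pd_sum[of _ U]) (use assms in \<open>auto intro!: fsmooth_csmooth fsmooth_mult fsmooth_pd\<close>)
  also have "\<dots> = (\<Sum>c<m. pd j (W c) p * pd c h p + W c p * pd c (pd j h) p)"
  proof (rule sum.cong)
    fix c
    show "pd j (\<lambda>p. W c p * pd c h p) p = pd j (W c) p * pd c h p + W c p * pd c (pd j h) p"
      using pd_mult[OF fsmooth_csmooth[OF assms(2)] csmooth_pd[OF fsmooth_csmooth[OF assms(3)]] assms(5), of j]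
        pd_commute[OF assms(1) fsmooth_csmooth[OF assms(3)] assms(5), of j c] by simp
  qed simp
  finally show ?thesis unfolding e .
qed

text \<open>The Leibniz rule for the Lie derivative along \<open>W\<close>, which commutes with d.
  In coordinates this commutation is the symmetry of second derivatives.\<close>

lemma pd_total_deriv_expansion:
  assumes "open U" "\<And>c. fsmooth U (W c)" "fsmooth U h"
    and a: "\<And>i. i < N \<Longrightarrow> fsmooth U (a i)" and g: "\<And>i. i < N \<Longrightarrow> fsmooth U (g i)"
    and e: "\<And>p c. p \<in> U \<Longrightarrow> pd c h p = (\<Sum>i<(N::nat). a i p * pd c (g i) p)"
    and "p \<in> U"
  shows "pd j (total_deriv W h) p = (\<Sum>i<N. total_deriv W (a i) p * pd j (g i) p + a i p * pd j (total_deriv W (g i)) p)"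
proof -
  obtain m0 where m0: "depends_below m0 h" using assms(3) by (auto simp: fsmooth_def)
  have "\<forall>i. \<exists>m. i < N \<longrightarrow> depends_below m (a i) \<and> depends_below m (g i)"
  proof
    fix i
    show "\<exists>m. i < N \<longrightarrow> depends_below m (a i) \<and> depends_below m (g i)"
    proof (cases "i < N")
      case True
      then obtain m1 m2 where "depends_below m1 (a i)" "depends_below m2 (g i)" using a[of i] g[of i] by (auto simp: fsmooth_def)
      thus ?thesis using depends_below_mono[of m1 _ "max m1 m2"] depends_below_mono[of m2 _ "max m1 m2"] by (metis max.cobounded1 max.cobounded2)
    qed simp
  qed
  then obtain M where M: "\<And>i. i < N \<Longrightarrow> depends_below (M i) (a i) \<and> depends_below (M i) (g i)" by metis
  \<comment> \<open>One order bounding all functions involved, so that every total derivative is a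
    sum over the same range and the sums can be interchanged.\<close>
  define m where "m = Max (insert m0 (M ` {..<N}))"
  have mle: "m0 \<le> m" "\<And>i. i < N \<Longrightarrow> M i \<le> m" unfolding m_def by auto
  have mh: "depends_below m h" and ma: "\<And>i. i < N \<Longrightarrow> depends_below m (a i)" and mg: "\<And>i. i < N \<Longrightarrow> depends_below m (g i)"
    using depends_below_mono m0 M mle by blast+
  have p2: "pd c (pd j h) p = (\<Sum>i<N. pd c (a i) p * pd j (g i) p + a i p * pd c (pd j (g i)) p)" for c
  proof -
    have "pd c (pd j h) p = pd c (\<lambda>p. \<Sum>i<N. a i p * pd j (g i) p) p"
      by (rule pd_cong[OF assms(1,7)]) (rule e)
    also have "\<dots> = (\<Sum>i<N. pd c (\<lambda>p. a i p * pd j (g i) p) p)"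
      by (rule pd_sum[of _ U]) (use assms in \<open>auto intro!: fsmooth_csmooth fsmooth_mult fsmooth_pd\<close>)
    also have "\<dots> = (\<Sum>i<N. pd c (a i) p * pd j (g i) p + a i p * pd c (pd j (g i)) p)"
      by (intro sum.cong refl pd_mult[of U]) (use assms in \<open>auto intro!: fsmooth_csmooth fsmooth_pd\<close>)
    finally show ?thesis .
  qed
  have "pd j (total_deriv W h) p = (\<Sum>c<m. pd j (W c) p * pd c h p + W c p * pd c (pd j h) p)"
    by (rule pd_total_deriv[OF assms(1-3) mh assms(7)])
  also have "\<dots> = (\<Sum>c<m. \<Sum>i<N. pd j (W c) p * (a i p * pd c (g i) p) +
       W c p * (pd c (a i) p * pd j (g i) p + a i p * pd c (pd j (g i)) p))"
    by (simp only: p2 e[OF assms(7)] sum_distrib_left sum.distrib[symmetric])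
  also have "\<dots> = (\<Sum>i<N. \<Sum>c<m. pd j (W c) p * (a i p * pd c (g i) p) +
       W c p * (pd c (a i) p * pd j (g i) p + a i p * pd c (pd j (g i)) p))"
    by (rule sum.swap)
  also have "\<dots> = (\<Sum>i<N. total_deriv W (a i) p * pd j (g i) p + a i p * pd j (total_deriv W (g i)) p)"
  proof (rule sum.cong)
    fix i assume "i \<in> {..<N}"
    hence i: "i < N" by simp
    show "(\<Sum>c<m. pd j (W c) p * (a i p * pd c (g i) p) +
       W c p * (pd c (a i) p * pd j (g i) p + a i p * pd c (pd j (g i)) p)) =
       total_deriv W (a i) p * pd j (g i) p + a i p * pd j (total_deriv W (g i)) p"
      unfolding pd_total_deriv[OF assms(1,2) g[OF i] mg[OF i] assms(7)] total_deriv_eq[OF ma[OF i]]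
        sum_distrib_left sum_distrib_right sum.distrib[symmetric]
      by (intro sum.cong refl) (simp add: algebra_simps)
  qed simp
  finally show ?thesis .
qed

text \<open>The coefficients get differentiated as well, which is why smooth coefficients on an open
  set are essential. By iteration a single dependency spreads to all later derivatives.\<close>

lemma form_span_total_deriv:
  assumes "open U" "\<And>c. fsmooth U (W c)" "fsmooth U h" "\<And>g. g \<in> S \<Longrightarrow> fsmooth U g"
    and "form_span U (exact_form ` S) (exact_form h)"
  shows "form_span U (exact_form ` (S \<union> total_deriv W ` S)) (exact_form (total_deriv W h))"
proof -
  obtain N :: nat and a g where *: "\<And>i. i < N \<Longrightarrow> fsmooth U (a i)" "\<And>i. i < N \<Longrightarrow> g i \<in> S"
     "\<And>p c. p \<in> U \<Longrightarrow> exact_form h c p = (\<Sum>i<N. a i p * pd c (g i) p)"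
    using form_span_coeffs[OF assms(5)] by metis
  have "form_span U (exact_form ` (S \<union> total_deriv W ` S))
      (\<lambda>c p. \<Sum>i<N. total_deriv W (a i) p * exact_form (g i) c p + a i p * exact_form (total_deriv W (g i)) c p)"
    by (intro form_span_sum form_span_add form_span_scale form_span_base assms(1) fsmooth_total_deriv assms(2)) (use * in auto)
  thus ?thesis
    by (rule form_span_cong)
       (use pd_total_deriv_expansion[OF assms(1-3) *(1) assms(4)[OF *(2)], of N] *(3) in \<open>auto simp: exact_form_def\<close>)
qed

section \<open>Linear algebra of a flat output at a point\<close>

definition covec :: "nat \<Rightarrow> nat \<Rightarrow> real" where
  "covec c = (\<lambda>i. if i = c then 1 else 0)"

lemma diff_at_coord: "diff_at p (\<lambda>q. q c) = covec c"
  by (auto simp: diff_at_def covec_def pd_coord)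

text \<open>A component is a linear functional. This is the standard test below for a covector lying
  outside a span.\<close>

lemma span_component_zero:
  assumes "x \<in> fv.span S" "\<And>y. y \<in> S \<Longrightarrow> y c = 0"
  shows "x c = 0"
  using assms(1)
proof (induction rule: fv.span_induct_alt)
  case base
  show ?case by simp
next
  case (step k y z)
  thus ?case using assms(2) by simp
qed

lemma span_insertE:
  assumes "x \<in> fv.span (insert a S)"
  obtains k where "(\<lambda>c. x c - k * a c) \<in> fv.span S"
proof -
  from assms obtain k where "x - (\<lambda>i. k * a i) \<in> fv.span S"
    by (auto simp: fv.span_insert)
  moreover have "x - (\<lambda>i. k * a i) = (\<lambda>c. x c - k * a c)" by (simp add: fun_eq_iff)
  ultimately show ?thesis using that by simp
qed

lemma span_lincomb:
  assumes "x \<in> fv.span S" "y \<in> fv.span S"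
  shows "(\<lambda>c. x c - k * y c) \<in> fv.span S"
proof -
  have "x - (\<lambda>i. k * y i) \<in> fv.span S" by (intro fv.span_diff fv.span_scale assms)
  moreover have "x - (\<lambda>i. k * y i) = (\<lambda>c. x c - k * y c)" by (simp add: fun_eq_iff)
  ultimately show ?thesis by simp
qed

lemma span_lincombD:
  assumes "(\<lambda>c. x c - k * y c) \<in> fv.span S" "y \<in> fv.span S"
  shows "x \<in> fv.span S"
  using span_lincomb[OF assms, of "-k"] by simp

lemma span_lincombD2:
  assumes "(\<lambda>c. x c - k * y c) \<in> fv.span S" "x \<in> fv.span S" "k \<noteq> 0"
  shows "y \<in> fv.span S"
proof -
  have "(\<lambda>i. (1 / k) * (x i - 1 * (x i - k * y i))) \<in> fv.span S"
    by (rule fv.span_scale[OF span_lincomb[OF assms(2,1)]])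
  moreover have "(\<lambda>i. (1 / k) * (x i - 1 * (x i - k * y i))) = y" using assms(3) by auto
  ultimately show ?thesis by simp
qed

lemma supported_span: "(\<And>c. c \<ge> n \<Longrightarrow> x c = 0) \<Longrightarrow> x \<in> fv.span (covec ` {..<n})"
proof (induction n arbitrary: x)
  case 0
  hence "x = 0" by auto
  thus ?case by (simp only: fv.span_zero)
next
  case (Suc n)
  have "(\<lambda>c. x c - x n * covec n c) \<in> fv.span (covec ` {..<n})"
  proof (rule Suc.IH)
    fix c assume "n \<le> c"
    thus "x c - x n * covec n c = 0" using Suc.prems[of c] by (cases "c = n") (auto simp: covec_def)
  qed
  hence "(\<lambda>c. x c - x n * covec n c) \<in> fv.span (covec ` {..<Suc n})"
    by (rule subsetD[OF fv.span_mono, rotated]) auto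
  thus ?case by (rule span_lincombD) (auto intro: fv.span_base)
qed

lemma indep_comp: "indep F (\<iota> ` I) \<Longrightarrow> inj_on \<iota> I \<Longrightarrow> indep (F \<circ> \<iota>) I"
  unfolding indep_def by (simp add: comp_inj_on image_comp)

text \<open>A dimension count: one more independent vector in the span of \<open>T\<close> would
  exceed the cardinality of \<open>T\<close>.\<close>

lemma indep_spanning:
  assumes "indep F I" "finite I" "F ` I \<subseteq> fv.span T" "finite T" "card T \<le> card I" "t \<in> fv.span T"
  shows "t \<in> fv.span (F ` I)"
proof (rule ccontr)
  assume *: "t \<notin> fv.span (F ` I)"
  \<comment> \<open>\<open>None\<close> serves as a fresh index for the additional vector.\<close>
  define G where "G = (\<lambda>x. case x of None \<Rightarrow> t | Some i \<Rightarrow> F i)"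
  have e: "G ` Some ` I = F ` I" by (auto simp: G_def image_image)
  have "indep G (Some ` I)" using assms(1) unfolding indep_def e by (auto simp: inj_on_def G_def)
  hence "indep G (insert None (Some ` I))" by (rule indep_insert) (use * e in \<open>simp add: G_def image_image\<close>)
  from indep_card_le[OF this _ assms(4)] have "card (insert None (Some ` I)) \<le> card T"
    using assms(3,6) e by (auto simp: G_def)
  thus False using assms(2,5) by (simp add: card_image)
qed

text \<open>The linear algebra of a flat output at one point of jet space: \<open>v k\<close> and \<open>w k\<close> stand for
  the differentials of the \<open>k\<close>-th derivatives of the two components, \<open>covec c\<close> for the
  differential of the \<open>c\<close>-th jet coordinate.\<close>

locale triangular =
  fixes n \<kappa> c0 c1 :: nat and v :: "nat \<Rightarrow> nat \<Rightarrow> real"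
  assumes c01: "{c0, c1} = {n, n + 1}"
    and v_low: "\<And>k c. k < \<kappa> \<Longrightarrow> c \<ge> n \<Longrightarrow> v k c = 0"
    and v_supp: "\<And>j c. c \<ge> n + 2 + 2 * j \<Longrightarrow> v (\<kappa> + j) c = 0"
    and v_shift: "\<And>j c. c \<ge> n \<Longrightarrow> v (\<kappa> + j) (c + 2 * j) = v \<kappa> c"
    and v_pivot: "v \<kappa> c0 \<noteq> 0"
begin

text \<open>\<open>Q I\<close> holds the differentials of those derivatives of the second input
  whose orders are in \<open>I\<close>. \<open>G\<close> holds the differentials of the state and of
  all derivatives of the first component; since \<psi>_\<kappa> replaces the first input, it is all
  that is known without the second input.\<close>

definition Q :: "nat set \<Rightarrow> (nat \<Rightarrow> real) set" where "Q I = (\<lambda>i. covec (c1 + 2 * i)) ` I"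
definition G :: "(nat \<Rightarrow> real) set" where "G = covec ` {..<n} \<union> range v"

lemma v_in_G: "v k \<in> fv.span G" and covec_in_G: "i < n \<Longrightarrow> covec i \<in> fv.span G"
  by (auto simp: G_def intro: fv.span_base)

lemma Q_mono: "I \<subseteq> J \<Longrightarrow> Q I \<subseteq> Q J" by (auto simp: Q_def)

lemma c_cases: "c0 = n \<and> c1 = n + 1 \<or> c0 = n + 1 \<and> c1 = n"
  using c01 by (auto simp: doubleton_eq_iff)

lemma c0_ge: "c0 \<ge> n" and c1_ge: "c1 \<ge> n" and c0_lt: "c0 < n + 2" and c1_lt: "c1 < n + 2"
  using c_cases by auto

lemma c0_c1: "c0 + 2 * i \<noteq> c1 + 2 * j" using c_cases by (elim disjE conjE) presburger+

lemma c_top: "c \<ge> n + 2 * j \<Longrightarrow> c < n + 2 + 2 * j \<Longrightarrow> c = c0 + 2 * j \<or> c = c1 + 2 * j"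
  using c_cases by auto

lemma v_pivot': "v (\<kappa> + j) (c0 + 2 * j) \<noteq> 0"
  using v_pivot v_shift[OF c0_ge] by simp

text \<open>The staircase: component \<open>c0 + 2 * j\<close> occurs in
  \<open>v (\<kappa> + j)\<close> for the first time and is therefore a pivot.\<close>

lemma v_below: "i < \<kappa> + j \<Longrightarrow> v i (c0 + 2 * j) = 0"
proof (cases "i < \<kappa>")
  case True
  thus ?thesis using v_low[of i] c0_ge by simp
next
  case False
  assume "i < \<kappa> + j"
  with False obtain i' where "i = \<kappa> + i'" "i' < j" by (metis add_less_cancel_left le_Suc_ex not_less)
  thus ?thesis using v_supp[of i' "c0 + 2 * j"] c0_ge by simp
qed

text \<open>Elimination from the top of the staircase: in a relation with finitely many
  \<open>v\<close>, the highest one has coefficient zero, because its pivot component occurs nowhere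
  else in the relation. When only the \<open>v\<close> below \<kappa> are left, component
  \<open>c1 + 2 * j\<close> vanishes on all generators.\<close>

lemma Q_notin: "covec (c1 + 2 * j) \<notin> fv.span (G \<union> Q (- {j}))"
proof
  assume *: "covec (c1 + 2 * j) \<in> fv.span (G \<union> Q (- {j}))"
  have no: "covec (c1 + 2 * j) \<notin> fv.span (covec ` {..<n} \<union> v ` {..<\<kappa> + J} \<union> Q (- {j}))" for J
  proof (induction J)
    case 0
    show ?case
    proof
      assume "covec (c1 + 2 * j) \<in> fv.span (covec ` {..<n} \<union> v ` {..<\<kappa> + 0} \<union> Q (- {j}))"
      hence "covec (c1 + 2 * j) (c1 + 2 * j) = 0"
        by (rule span_component_zero) (use c1_ge v_low in \<open>auto simp: covec_def Q_def split: if_splits\<close>)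
      thus False by (simp add: covec_def)
    qed
  next
    case (Suc J)
    show ?case
    proof
      let ?S = "covec ` {..<n} \<union> v ` {..<\<kappa> + J} \<union> Q (- {j})"
      assume "covec (c1 + 2 * j) \<in> fv.span (covec ` {..<n} \<union> v ` {..<\<kappa> + Suc J} \<union> Q (- {j}))"
      moreover have "covec ` {..<n} \<union> v ` {..<\<kappa> + Suc J} \<union> Q (- {j}) = insert (v (\<kappa> + J)) ?S"
        by (auto simp: lessThan_Suc)
      ultimately have "covec (c1 + 2 * j) \<in> fv.span (insert (v (\<kappa> + J)) ?S)" by simp
      then obtain k where k: "(\<lambda>c. covec (c1 + 2 * j) c - k * v (\<kappa> + J) c) \<in> fv.span ?S"
        by (rule span_insertE)
      hence "covec (c1 + 2 * j) (c0 + 2 * J) - k * v (\<kappa> + J) (c0 + 2 * J) = 0"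
        by (rule span_component_zero[where c = "c0 + 2 * J"])
           (use c0_ge v_below c0_c1 in \<open>auto simp: covec_def Q_def split: if_splits\<close>)
      hence "k = 0" using v_pivot' c0_c1 by (simp add: covec_def)
      thus False using k Suc.IH by simp
    qed
  qed
  \<comment> \<open>A member of the span uses finitely many generators, hence only \<open>v\<close>
    below some bound.\<close>
  obtain T r where T: "finite T" "T \<subseteq> G \<union> Q (- {j})" "covec (c1 + 2 * j) = (\<Sum>a\<in>T. (\<lambda>i. r a * a i))"
    using * unfolding fv.span_explicit by blast
  have T': "covec (c1 + 2 * j) \<in> fv.span T"
    unfolding T(3) by (intro fv.span_sum fv.span_scale fv.span_base)
  have "\<exists>J. T \<subseteq> covec ` {..<n} \<union> v ` {..<\<kappa> + J} \<union> Q (- {j})" using T(1,2)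
  proof (induction T rule: finite_induct)
    case (insert x T)
    then obtain J where J: "T \<subseteq> covec ` {..<n} \<union> v ` {..<\<kappa> + J} \<union> Q (- {j})" by blast
    show ?case
    proof (cases "x \<in> range v")
      case True
      then obtain k where "x = v k" by blast
      hence "insert x T \<subseteq> covec ` {..<n} \<union> v ` {..<\<kappa> + max J (Suc k)} \<union> Q (- {j})"
        using J by fastforce
      thus ?thesis by blast
    next
      case False
      thus ?thesis using J insert.prems by (intro exI[of _ J]) (auto simp: G_def)
    qed
  qed simp
  thus False using no T' fv.span_mono by blast
qed

lemma Q_notin': "j \<notin> I \<Longrightarrow> S \<subseteq> fv.span (G \<union> Q I) \<Longrightarrow> covec (c1 + 2 * j) \<notin> fv.span S"
proof
  assume *: "j \<notin> I" "S \<subseteq> fv.span (G \<union> Q I)" "covec (c1 + 2 * j) \<in> fv.span S"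
  have "fv.span S \<subseteq> fv.span (G \<union> Q I)" using *(2) fv.span_minimal fv.subspace_span by blast
  also have "\<dots> \<subseteq> fv.span (G \<union> Q (- {j}))" by (rule fv.span_mono) (use *(1) in \<open>auto simp: Q_def\<close>)
  finally show False using *(3) Q_notin by blast
qed

text \<open>The two highest coordinates are cleared in turn: \<open>c0 + 2 * j\<close> by
  \<open>v (\<kappa> + j)\<close> through its pivot, then \<open>c1 + 2 * j\<close> by its own
  covector.\<close>

lemma supported_decomp:
  "(\<And>c. c \<ge> n + 2 * j \<Longrightarrow> x c = 0) \<Longrightarrow> x \<in> fv.span (covec ` {..<n} \<union> v ` {\<kappa>..<\<kappa> + j} \<union> Q {..<j})"
proof (induction j arbitrary: x)
  case 0
  thus ?case using supported_span[of n x] by (simp add: Q_def)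
next
  case (Suc j)
  let ?S = "\<lambda>j. covec ` {..<n} \<union> v ` {\<kappa>..<\<kappa> + j} \<union> Q {..<j}"
  define a where "a = x (c0 + 2 * j) / v (\<kappa> + j) (c0 + 2 * j)"
  define y where "y = (\<lambda>c. x c - a * v (\<kappa> + j) c)"
  define z where "z = (\<lambda>c. y c - y (c1 + 2 * j) * covec (c1 + 2 * j) c)"
  have "z \<in> fv.span (?S j)"
  proof (rule Suc.IH)
    fix c assume c: "n + 2 * j \<le> c"
    show "z c = 0"
    proof (cases "c < n + 2 + 2 * j")
      case False
      hence "x c = 0" "v (\<kappa> + j) c = 0" using Suc.prems[of c] v_supp[of j c] by auto
      moreover have "c \<noteq> c1 + 2 * j" using c1_lt False by simp
      ultimately show ?thesis by (simp add: z_def y_def covec_def)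
    next
      case True
      have "y (c0 + 2 * j) = 0" using v_pivot'[of j] by (simp add: y_def a_def)
      thus ?thesis using c_top[OF c True] c0_c1[of j j] by (auto simp: z_def covec_def)
    qed
  qed
  hence z: "z \<in> fv.span (?S (Suc j))"
    by (rule subsetD[OF fv.span_mono, rotated]) (auto simp: Q_def)
  have "covec (c1 + 2 * j) \<in> ?S (Suc j)" "v (\<kappa> + j) \<in> ?S (Suc j)" by (auto simp: Q_def)
  hence 1: "covec (c1 + 2 * j) \<in> fv.span (?S (Suc j))" "v (\<kappa> + j) \<in> fv.span (?S (Suc j))"
    by (blast intro: fv.span_base)+
  have "y \<in> fv.span (?S (Suc j))" by (rule span_lincombD[OF z[unfolded z_def] 1(1)])
  thus ?case unfolding y_def by (rule span_lincombD[OF _ 1(2)])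
qed

text \<open>If the highest \<open>Q\<close> term had a nonzero coefficient, it could be solved for
  within \<open>G\<close> and the lower terms, against \<open>Q_notin'\<close>. Thus the surplus
  terms of a decomposition obtained from the support alone are removed once membership in a smaller
  span is known.\<close>

lemma drop_Q:
  assumes "x \<in> fv.span (S \<union> Q {a..<a + d})" "x \<in> fv.span (G \<union> Q {..<a})"
    "S \<subseteq> fv.span (G \<union> Q {..<a})"
  shows "x \<in> fv.span S"
  using assms(1)
proof (induction d)
  case (Suc d)
  have "S \<union> Q {a..<a + Suc d} = insert (covec (c1 + 2 * (a + d))) (S \<union> Q {a..<a + d})"
    by (auto simp: Q_def atLeastLessThanSuc)
  with Suc.prems have "x \<in> fv.span (insert (covec (c1 + 2 * (a + d))) (S \<union> Q {a..<a + d}))" by simp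
  then obtain k where k: "(\<lambda>c. x c - k * covec (c1 + 2 * (a + d)) c) \<in> fv.span (S \<union> Q {a..<a + d})"
    by (rule span_insertE)
  have sub: "S \<union> Q {a..<a + d} \<subseteq> fv.span (G \<union> Q {..<a + d})"
  proof -
    have "fv.span (G \<union> Q {..<a}) \<subseteq> fv.span (G \<union> Q {..<a + d})"
      by (rule fv.span_mono) (auto simp: Q_def)
    moreover have "Q {a..<a + d} \<subseteq> fv.span (G \<union> Q {..<a + d})"
      by (auto simp: Q_def intro!: fv.span_base)
    ultimately show ?thesis using assms(3) by blast
  qed
  have x: "x \<in> fv.span (G \<union> Q {..<a + d})"
    using assms(2) by (rule subsetD[OF fv.span_mono, rotated]) (auto simp: Q_def)
  have "k = 0"
  proof (rule ccontr)
    assume "k \<noteq> 0"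
    have "(\<lambda>c. x c - k * covec (c1 + 2 * (a + d)) c) \<in> fv.span (G \<union> Q {..<a + d})"
      using k fv.span_minimal[OF sub fv.subspace_span] by blast
    from span_lincombD2[OF this x \<open>k \<noteq> 0\<close>]
    show False using Q_notin'[of "a + d" "{..<a + d}" "G \<union> Q {..<a + d}"] fv.span_superset by auto
  qed
  thus ?case using k Suc.IH by simp
qed (simp add: Q_def)

end


section \<open>Dimension counts at a flat point\<close>

lemma span_subset_span: "S \<subseteq> fv.span T \<Longrightarrow> x \<in> fv.span S \<Longrightarrow> x \<in> fv.span T"
  using fv.span_minimal[OF _ fv.subspace_span, of S T] by blast

lemma span_monoD: "x \<in> fv.span S \<Longrightarrow> S \<subseteq> T \<Longrightarrow> x \<in> fv.span T"
  using fv.span_mono by blast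

text \<open>The properties that generic points will be shown to have. \<open>K\<close> is the first
  order at which \<open>w\<close> meets the second input modulo \<open>G\<close>; by
  \<open>w_new\<close> and \<open>w_Q\<close> each further derivative brings in one more derivative
  of it. \<open>\<kappa>2\<close> is the first order at which any input occurs; if it equals
  \<open>K\<close>, there is no prolongation and \<open>w_pivot\<close> is void. The range
  \<open>\<kappa> + K + 1\<close> in \<open>w_ind\<close> reaches beyond order \<kappa> + s, the
  highest one in the chart.\<close>

locale flat_point = triangular +
  fixes w :: "nat \<Rightarrow> nat \<Rightarrow> real" and K \<kappa>2 r1 r2 :: nat
  assumes \<kappa>_pos: "\<kappa> \<ge> 1" and K_pos: "K \<ge> 1" and \<kappa>2_le: "\<kappa>2 \<le> K" and K_le: "K \<le> r2"
    and v_ind: "\<And>k. k < \<kappa> \<Longrightarrow> v k \<notin> fv.span (v ` {..<k})"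
    and w_ind: "\<And>k. k < K \<Longrightarrow> w k \<notin> fv.span (v ` {..<\<kappa> + K + 1} \<union> w ` {..<k})"
    and w_G: "\<And>k. k < K \<Longrightarrow> w k \<in> fv.span G"
    and w_new: "\<And>j. w (K + j) \<notin> fv.span (G \<union> Q {..<j})"
    and w_Q: "\<And>j. w (K + j) \<in> fv.span (G \<union> Q {..<Suc j})"
    and w_low: "\<And>k c. k < \<kappa>2 \<Longrightarrow> c \<ge> n \<Longrightarrow> w k c = 0"
    and w_supp: "\<And>j c. c \<ge> n + 2 + 2 * j \<Longrightarrow> w (\<kappa>2 + j) c = 0"
    and w_shift: "\<And>j c. c \<ge> n \<Longrightarrow> w (\<kappa>2 + j) (c + 2 * j) = w \<kappa>2 c"
    and w_pivot: "\<kappa>2 < K \<Longrightarrow> w \<kappa>2 c0 \<noteq> 0"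
    and flat: "\<And>i. i < n \<Longrightarrow> covec i \<in> fv.span (v ` {..<r1} \<union> w ` {..<r2})"
begin

text \<open>\<open>s\<close> is the number of prolongations. \<open>b\<close> is the ratio of the
  coefficients of the first input, the factor with which \<open>v (\<kappa> + j)\<close> enters
  \<open>w (\<kappa>2 + j)\<close>.\<close>

definition s :: nat where "s = K - \<kappa>2"
definition b :: real where "b = w \<kappa>2 c0 / v \<kappa> c0"

text \<open>One index type for three kinds of covectors, so that \<open>indep\<close> applies to
  mixed families.\<close>

definition F :: "nat + nat + nat \<Rightarrow> nat \<Rightarrow> real" where
  "F x = (case x of Inl k \<Rightarrow> v k | Inr (Inl k) \<Rightarrow> w k | Inr (Inr j) \<Rightarrow> covec (c1 + 2 * j))"

lemma F_simps [simp]: "F (Inl k) = v k" "F (Inr (Inl k)) = w k" "F (Inr (Inr j)) = covec (c1 + 2 * j)"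
  by (auto simp: F_def)

text \<open>Below \<kappa> this is genericity; from \<kappa> on the pivot component decides.\<close>

lemma v_notin: "v m \<notin> fv.span (v ` {..<m})"
proof (cases "m < \<kappa>")
  case False
  then obtain j where m: "m = \<kappa> + j" by (metis le_Suc_ex not_less)
  show ?thesis
  proof
    assume "v m \<in> fv.span (v ` {..<m})"
    hence "v m (c0 + 2 * j) = 0"
      by (rule span_component_zero) (use v_below m in auto)
    thus False using v_pivot' m by simp
  qed
qed (rule v_ind)

lemma indep_v: "indep F (Inl ` {..<m})"
proof (induction m)
  case (Suc m)
  have "indep F (insert (Inl m) (Inl ` {..<m}))"
    by (rule indep_insert[OF Suc]) (use v_notin[of m] in \<open>simp add: image_image\<close>)
  thus ?case by (simp add: lessThan_Suc)
qed (simp add: indep_empty)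

lemma indep_vw: "k \<le> K \<Longrightarrow> indep F (Inl ` {..<\<kappa> + K + 1} \<union> (Inr \<circ> Inl) ` {..<k})"
proof (induction k)
  case 0
  show ?case using indep_v by simp
next
  case (Suc k)
  have "indep F (insert (Inr (Inl k)) (Inl ` {..<\<kappa> + K + 1} \<union> (Inr \<circ> Inl) ` {..<k}))"
    by (rule indep_insert) (use Suc w_ind[of k] in \<open>simp_all add: image_Un image_image\<close>)
  thus ?case by (simp add: lessThan_Suc)
qed

lemma indep_vwQ: "indep F (Inl ` {..<\<kappa> + K + 1} \<union> (Inr \<circ> Inl) ` {..<K} \<union> (Inr \<circ> Inr) ` {..<m})"
proof (induction m)
  case 0
  show ?case using indep_vw[of K] by simp
next
  case (Suc m)
  let ?I = "Inl ` {..<\<kappa> + K + 1} \<union> (Inr \<circ> Inl) ` {..<K} \<union> (Inr \<circ> Inr) ` {..<m}"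
  have "F ` ?I \<subseteq> fv.span (G \<union> Q {..<m})"
  proof -
    have "v k \<in> fv.span (G \<union> Q {..<m})" for k by (rule fv.span_base) (auto simp: G_def)
    moreover have "w k \<in> fv.span (G \<union> Q {..<m})" if "k < K" for k
      by (rule span_monoD[OF w_G[OF that]]) auto
    moreover have "covec (c1 + 2 * k) \<in> fv.span (G \<union> Q {..<m})" if "k < m" for k
      by (rule fv.span_base) (use that in \<open>auto simp: Q_def\<close>)
    ultimately show ?thesis by auto
  qed
  hence "covec (c1 + 2 * m) \<notin> fv.span (F ` ?I)" by (intro Q_notin'[of m "{..<m}"]) auto
  hence "indep F (insert (Inr (Inr m)) ?I)" by (intro indep_insert[OF Suc]) simp
  thus ?case by (simp add: lessThan_Suc)
qed

text \<open>For the case without prolongation, where \<open>w K\<close> is the second input of the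
  chart.\<close>

lemma indep_vwK: "indep F (Inl ` {..<\<kappa> + K + 1} \<union> (Inr \<circ> Inl) ` {..<Suc K})"
proof -
  let ?I = "Inl ` {..<\<kappa> + K + 1} \<union> (Inr \<circ> Inl) ` {..<K}"
  have "F ` ?I \<subseteq> fv.span G"
    using w_G v_in_G by auto
  hence "w K \<notin> fv.span (F ` ?I)" using w_new[of 0] span_subset_span[of "F ` ?I" G "w K"]
    by (auto simp: Q_def)
  hence "indep F (insert (Inr (Inl K)) ?I)" by (intro indep_insert[OF indep_vw]) auto
  thus ?thesis by (simp add: lessThan_Suc)
qed

text \<open>The state together with the first \<open>s\<close> derivatives of \<psi> that contain
  inputs: the space which \<open>v\<close> and \<open>w\<close> will fill, and against which
  dimensions are counted.\<close>

definition P0 :: "(nat \<Rightarrow> real) set" where "P0 = covec ` {..<n} \<union> v ` {\<kappa>..<\<kappa> + s}"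

lemma P0_G: "P0 \<subseteq> fv.span G" by (auto simp: P0_def G_def intro!: fv.span_base)

lemma \<kappa>2_s: "\<kappa>2 + s = K" using \<kappa>2_le by (simp add: s_def)

lemma w_supp_K: "k < K \<Longrightarrow> c \<ge> n + 2 * s \<Longrightarrow> w k c = 0"
proof (cases "k < \<kappa>2")
  case False
  assume *: "k < K" "c \<ge> n + 2 * s"
  with False obtain j where "k = \<kappa>2 + j" "j < s"
    using \<kappa>2_s by (metis add_less_cancel_left le_Suc_ex not_less)
  thus ?thesis using w_supp[of j c] * by simp
qed (use w_low[of k c] in auto)

text \<open>The support allows \<open>P0\<close> and terms from \<open>Q\<close>; the latter drop
  out because \<open>w k\<close> lies in the span of \<open>G\<close>.\<close>

lemma w_P0: "k < K \<Longrightarrow> w k \<in> fv.span P0"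
proof -
  assume k: "k < K"
  have "w k \<in> fv.span (P0 \<union> Q {0..<0 + s})"
    using supported_decomp[of s "w k"] w_supp_K[OF k] by (simp add: P0_def atLeast0LessThan)
  thus ?thesis by (rule drop_Q) (use w_G[OF k] P0_G in \<open>auto simp: Q_def\<close>)
qed

lemma v_P0: "k < \<kappa> + s \<Longrightarrow> v k \<in> fv.span P0"
proof (cases "k < \<kappa>")
  case True
  hence "v k \<in> fv.span (covec ` {..<n})" using supported_span v_low by blast
  thus ?thesis by (rule span_monoD) (auto simp: P0_def)
next
  case False
  assume "k < \<kappa> + s"
  thus ?thesis using False by (intro fv.span_base) (auto simp: P0_def)
qed

lemma card_P0: "finite P0" "card P0 \<le> n + s"
proof -
  show "finite P0" by (simp add: P0_def)
  have "card P0 \<le> card (covec ` {..<n}) + card (v ` {\<kappa>..<\<kappa> + s})"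
    unfolding P0_def by (rule card_Un_le)
  also have "\<dots> \<le> n + s"
    using card_image_le[of "{..<n}" covec] card_image_le[of "{\<kappa>..<\<kappa> + s}" v] by simp
  finally show "card P0 \<le> n + s" .
qed

lemma s_le: "s \<le> K" by (simp add: s_def)

definition I0 :: "(nat + nat + nat) set" where
  "I0 = Inl ` {..<\<kappa> + s} \<union> (Inr \<circ> Inl) ` {..<K}"

lemma indep_I0: "indep F I0"
  by (rule indep_subset[OF indep_vw[of K]]) (use s_le in \<open>auto simp: I0_def\<close>)

lemma F_I0: "F ` I0 = v ` {..<\<kappa> + s} \<union> w ` {..<K}"
  by (simp add: I0_def image_Un image_image)

lemma card_I0: "finite I0" "card I0 = \<kappa> + s + K"
proof -
  show "finite I0" by (simp add: I0_def)
  have "card I0 = card (Inl ` {..<\<kappa> + s} :: (nat + nat + nat) set) + card ((Inr \<circ> Inl) ` {..<K} :: (nat + nat + nat) set)"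
    unfolding I0_def by (rule card_Un_disjoint) auto
  thus "card I0 = \<kappa> + s + K" by (simp add: card_image inj_on_def)
qed

lemma F_I0_P0: "F ` I0 \<subseteq> fv.span P0"
  using w_P0 v_P0 unfolding F_I0 by auto

text \<open>\<kappa> + s + K independent covectors lie in the span of \<open>P0\<close>, which has
  at most n + s generators.\<close>

lemma count_le: "\<kappa> + K \<le> n"
  using indep_card_le[OF indep_I0 F_I0_P0 card_P0(1)] card_P0(2) card_I0(2) by simp

text \<open>The terms \<open>w (K + j)\<close> of the flatness relation are discarded from the top:
  each would bring in the derivative of order \<open>j\<close> of the second input, which neither
  the state nor the remaining terms contain.\<close>

lemma eliminate: "i < n \<Longrightarrow> covec i \<in> fv.span (v ` {..<r1} \<union> w ` {..<K})"
proof -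
  assume i: "i < n"
  have evG: "covec i \<in> fv.span (G \<union> T)" for T
    by (rule fv.span_base) (use i in \<open>auto simp: G_def\<close>)
  have "covec i \<in> fv.span (v ` {..<r1} \<union> w ` {..<K + j}) \<Longrightarrow> ?thesis" for j
  proof (induction j)
    case (Suc j)
    let ?S = "v ` {..<r1} \<union> w ` {..<K + j}"
    have "v ` {..<r1} \<union> w ` {..<K + Suc j} = insert (w (K + j)) ?S" by (auto simp: lessThan_Suc)
    with Suc.prems have "covec i \<in> fv.span (insert (w (K + j)) ?S)" by simp
    then obtain k where k: "(\<lambda>c. covec i c - k * w (K + j) c) \<in> fv.span ?S" by (rule span_insertE)
    have "?S \<subseteq> fv.span (G \<union> Q {..<j})"
    proof -
      have "w k \<in> fv.span (G \<union> Q {..<j})" if "k < K + j" for k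
      proof (cases "k < K")
        case True
        show ?thesis by (rule span_monoD[OF w_G[OF True]]) auto
      next
        case False
        define l where "l = k - K"
        have l: "k = K + l" "l < j" using False that by (auto simp: l_def)
        have "w (K + l) \<in> fv.span (G \<union> Q {..<j})"
          by (rule span_monoD[OF w_Q]) (use Q_mono[of "{..<Suc l}" "{..<j}"] l in \<open>simp add: le_supI2\<close>)
        thus ?thesis using l by simp
      qed
      thus ?thesis using span_monoD[OF v_in_G, of "G \<union> Q {..<j}"] by auto
    qed
    hence k': "(\<lambda>c. covec i c - k * w (K + j) c) \<in> fv.span (G \<union> Q {..<j})"
      using k by (rule span_subset_span)
    have "k = 0"
    proof (rule ccontr)
      assume "k \<noteq> 0"
      from span_lincombD2[OF k' evG this] show False using w_new by blast
    qed
    thus ?case using k Suc.IH by simp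
  qed simp
  from this[of "r2 - K"] show ?thesis using flat[OF i] K_le by simp
qed

lemma indep_ev_v: "indep (\<lambda>x. case x of Inl i \<Rightarrow> covec i | Inr j \<Rightarrow> v (\<kappa> + j)) (Inl ` {..<m} \<union> Inr ` {..<l})"
  if "m \<le> n" for m l :: nat
proof -
  let ?F = "\<lambda>x. case x of Inl i \<Rightarrow> covec i | Inr j \<Rightarrow> v (\<kappa> + j)"
  have 1: "indep ?F (Inl ` {..<m} :: (nat + nat) set)"
  proof (induction m)
    case (Suc m)
    have "covec m \<notin> fv.span (covec ` {..<m})"
    proof
      assume "covec m \<in> fv.span (covec ` {..<m})"
      hence "covec m m = 0" by (rule span_component_zero) (auto simp: covec_def)
      thus False by (simp add: covec_def)
    qed
    hence "indep ?F (insert (Inl m) (Inl ` {..<m} :: (nat + nat) set))"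
      by (intro indep_insert[OF Suc]) (simp add: image_image)
    thus ?case by (simp add: lessThan_Suc)
  qed (simp add: indep_empty)
  show ?thesis
  proof (induction l)
    case 0
    thus ?case using 1 by simp
  next
    case (Suc l)
    let ?I = "Inl ` {..<m} \<union> Inr ` {..<l} :: (nat + nat) set"
    have "v (\<kappa> + l) \<notin> fv.span (?F ` ?I)"
    proof
      assume "v (\<kappa> + l) \<in> fv.span (?F ` ?I)"
      hence "v (\<kappa> + l) (c0 + 2 * l) = 0"
        by (rule span_component_zero) (use that c0_ge v_below in \<open>auto simp: covec_def\<close>)
      thus False using v_pivot' by simp
    qed
    hence "indep ?F (insert (Inr l) ?I)" by (intro indep_insert[OF Suc]) simp
    thus ?case by (simp add: lessThan_Suc)
  qed
qed

text \<open>The converse inequality: n + r1 independent covectors, those of the state and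
  \<open>v (\<kappa> + j)\<close> for j < r1, lie in the span of \<kappa> + r1 + K covectors by
  \<open>eliminate\<close>.\<close>

lemma count: "n = \<kappa> + K"
proof -
  let ?F = "\<lambda>x. case x of Inl i \<Rightarrow> covec i | Inr j \<Rightarrow> v (\<kappa> + j)"
  let ?I = "Inl ` {..<n} \<union> Inr ` {..<r1} :: (nat + nat) set"
  let ?T = "v ` {..<\<kappa> + r1} \<union> w ` {..<K}"
  have "covec i \<in> fv.span ?T" if "i < n" for i
    by (rule span_monoD[OF eliminate[OF that]]) auto
  moreover have "v (\<kappa> + j) \<in> fv.span ?T" if "j < r1" for j
    by (rule fv.span_base) (use that in auto)
  ultimately have sub: "?F ` ?I \<subseteq> fv.span ?T" by auto
  have "card ?I \<le> card ?T" by (rule indep_card_le[OF indep_ev_v sub]) auto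
  also have "card ?T \<le> card (v ` {..<\<kappa> + r1}) + card (w ` {..<K})" by (rule card_Un_le)
  also have "\<dots> \<le> \<kappa> + r1 + K"
    using card_image_le[of "{..<\<kappa> + r1}" v] card_image_le[of "{..<K}" w] by simp
  also have "card ?I = card (Inl ` {..<n} :: (nat + nat) set) + card (Inr ` {..<r1} :: (nat + nat) set)"
    by (rule card_Un_disjoint) auto
  hence "card ?I = n + r1" by (simp add: card_image)
  finally show ?thesis using count_le by simp
qed

text \<open>By the choice of \<open>b\<close>, the difference has at most component
  \<open>c1\<close> beyond the state. Were that nonzero, the second input could be solved for within
  \<open>G\<close>, because both covectors lie in the span of \<open>G\<close>.\<close>

lemma proportional:
  assumes "\<kappa>2 < K"
  shows "w \<kappa>2 c1 = b * v \<kappa> c1"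
proof (rule ccontr)
  assume ne: "w \<kappa>2 c1 \<noteq> b * v \<kappa> c1"
  define \<eta> where "\<eta> = (\<lambda>c. w \<kappa>2 c - b * v \<kappa> c)"
  define k where "k = \<eta> c1"
  have \<eta>: "\<eta> \<in> fv.span G" unfolding \<eta>_def
    by (rule span_lincomb[OF w_G[OF assms] v_in_G])
  have "(\<lambda>c. \<eta> c - k * covec c1 c) \<in> fv.span (covec ` {..<n})"
  proof (rule supported_span)
    fix c assume c: "n \<le> c"
    have "\<eta> c0 = 0" using v_pivot by (simp add: \<eta>_def b_def)
    moreover have "\<eta> c = 0" if "c \<ge> n + 2" using w_supp[of 0 c] v_supp[of 0 c] that by (simp add: \<eta>_def)
    ultimately show "\<eta> c - k * covec c1 c = 0"
      using c_top[of 0 c] c c0_c1[of 0 0] c1_lt by (cases "c < n + 2") (auto simp: covec_def k_def)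
  qed
  hence diff: "(\<lambda>c. \<eta> c - k * covec c1 c) \<in> fv.span G" by (rule span_monoD) (auto simp: G_def)
  have "k \<noteq> 0" using ne by (simp add: k_def \<eta>_def)
  from span_lincombD2[OF diff \<eta> this] have "covec c1 \<in> fv.span G" .
  thus False using Q_notin'[of 0 "{}" G] fv.span_superset by (auto simp: Q_def)
qed

text \<open>Further derivatives move the input coefficients of both covectors up by the same shift,
  so the cancellation at order \<kappa>2 recurs at the top of every later order.\<close>

lemma difference_supp:
  assumes "\<kappa>2 < K" "c \<ge> n + 2 * j"
  shows "w (\<kappa>2 + j) c - b * v (\<kappa> + j) c = 0"
proof (cases "c < n + 2 + 2 * j")
  case True
  have "w (\<kappa>2 + j) (c0 + 2 * j) - b * v (\<kappa> + j) (c0 + 2 * j) = 0"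
    using v_pivot by (simp add: w_shift v_shift c0_ge b_def)
  moreover have "w (\<kappa>2 + j) (c1 + 2 * j) - b * v (\<kappa> + j) (c1 + 2 * j) = 0"
    using proportional[OF assms(1)] by (simp add: w_shift v_shift c1_ge)
  ultimately show ?thesis using c_top[OF assms(2) True] by auto
qed (use w_supp[of j c] v_supp[of j c] in simp)

text \<open>Were r1 smaller, the state would be spanned by the \<open>w\<close> below
  \<open>K\<close> and the \<open>v\<close> below \<kappa> + s - 1. Then
  \<open>v (\<kappa> + s - 1)\<close> would be spanned too: for s = 0 it has state components only,
  otherwise it can be solved for from \<open>w (K - 1)\<close>, as \<open>b\<close> is nonzero. This
  contradicts independence.\<close>

lemma r1_ge: "\<kappa> + s \<le> r1"
proof (rule ccontr)
  assume "\<not> \<kappa> + s \<le> r1"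
  define j0 where "j0 = \<kappa> + s - 1"
  have j0: "r1 \<le> j0" "j0 < \<kappa> + K + 1" using \<open>\<not> \<kappa> + s \<le> r1\<close> s_le by (auto simp: j0_def)
  let ?P = "v ` {..<j0} \<union> w ` {..<K}"
  have covec_P: "covec i \<in> fv.span ?P" if "i < n" for i
    by (rule span_monoD[OF eliminate[OF that]]) (use j0 in auto)
  have "v j0 \<in> fv.span ?P"
  proof (cases "s = 0")
    case True
    hence "j0 < \<kappa>" using \<kappa>_pos by (simp add: j0_def)
    hence "v j0 \<in> fv.span (covec ` {..<n})" using supported_span v_low by blast
    thus ?thesis by (rule span_subset_span[rotated]) (use covec_P in auto)
  next
    case False
    hence lt: "\<kappa>2 < K" using \<kappa>2_s by simp
    define \<eta> where "\<eta> = (\<lambda>c. w (\<kappa>2 + (s - 1)) c - b * v (\<kappa> + (s - 1)) c)"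
    have e: "\<kappa>2 + (s - 1) = K - 1" "\<kappa> + (s - 1) = j0" using False \<kappa>2_s by (auto simp: j0_def)
    let ?S = "covec ` {..<n} \<union> v ` {\<kappa>..<\<kappa> + (s - 1)}"
    have "\<eta> \<in> fv.span (?S \<union> Q {..<s - 1})"
      by (rule supported_decomp) (simp add: \<eta>_def difference_supp[OF lt])
    hence "\<eta> \<in> fv.span (?S \<union> Q {0..<0 + (s - 1)})" by (simp add: atLeast0LessThan)
    moreover have "\<eta> \<in> fv.span (G \<union> Q {..<0})" unfolding \<eta>_def Q_def lessThan_0 image_empty Un_empty_right
      by (rule span_lincomb[OF _ v_in_G]) (use w_G[of "K - 1"] K_pos e in simp)
    moreover have "?S \<subseteq> fv.span (G \<union> Q {..<0})" using v_in_G covec_in_G by (auto simp: Q_def)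
    ultimately have "\<eta> \<in> fv.span ?S" by (rule drop_Q)
    moreover have "v i \<in> fv.span ?P" if "i < j0" for i by (rule fv.span_base) (use that in auto)
    hence "?S \<subseteq> fv.span ?P" using covec_P e(2) by auto
    ultimately have 1: "\<eta> \<in> fv.span ?P" by (rule span_subset_span[rotated])
    have 2: "w (\<kappa>2 + (s - 1)) \<in> fv.span ?P"
      unfolding e by (rule fv.span_base) (use K_pos in auto)
    have "b \<noteq> 0" using w_pivot[OF lt] v_pivot by (simp add: b_def)
    from span_lincombD2[OF 1[unfolded \<eta>_def] 2 this] show ?thesis unfolding e(2) .
  qed
  moreover have "v j0 \<notin> fv.span ?P"
  proof -
    have "F (Inl j0) \<notin> fv.span (F ` (Inl ` {..<j0} \<union> (Inr \<circ> Inl) ` {..<K}))"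
      by (rule indep_notin'[OF indep_vw[of K]]) (use j0 in auto)
    thus ?thesis by (simp add: image_Un image_image)
  qed
  ultimately show False by blast
qed

lemma s_bound: "s + n \<le> r1 + r2"
  using r1_ge K_le count by simp

text \<open>Since n = \<kappa> + K, the independent family behind \<open>count_le\<close> is as
  large as the generating set \<open>P0\<close>, hence it spans.\<close>

lemma P0_I0: "P0 \<subseteq> fv.span (v ` {..<\<kappa> + s} \<union> w ` {..<K})"
proof
  fix t assume "t \<in> P0"
  hence "t \<in> fv.span (F ` I0)"
    by (intro indep_spanning[OF indep_I0 card_I0(1) F_I0_P0 card_P0(1)])
       (use card_P0(2) card_I0(2) count in \<open>auto intro: fv.span_base\<close>)
  thus "t \<in> fv.span (v ` {..<\<kappa> + s} \<union> w ` {..<K})" by (simp only: F_I0)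
qed

lemma coordinate_span: "i < n \<Longrightarrow> covec i \<in> fv.span (v ` {..<\<kappa> + s} \<union> w ` {..<K})"
  using P0_I0 by (auto simp: P0_def)

text \<open>The support allows derivatives of the second input below order \<open>s\<close>, but
  \<open>w_Q\<close> admits only the second input itself, so the others drop out. This is why the
  coefficient a contains u2 but not D u2.\<close>

lemma drift_span:
  assumes "0 < s"
  shows "(\<lambda>c. w K c - b * v (\<kappa> + s) c) \<in> fv.span (insert (covec c1) (v ` {..<\<kappa> + s} \<union> w ` {..<K}))"
proof -
  have lt: "\<kappa>2 < K" using \<kappa>2_s assms by simp
  define \<eta> where "\<eta> = (\<lambda>c. w K c - b * v (\<kappa> + s) c)"
  have "\<eta> \<in> fv.span (P0 \<union> Q {..<s})"
    unfolding P0_def by (rule supported_decomp) (use difference_supp[OF lt, of s] in \<open>simp add: \<eta>_def \<kappa>2_s\<close>)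
  moreover have "P0 \<union> Q {..<s} = insert (covec c1) P0 \<union> Q {1..<1 + (s - 1)}"
  proof -
    have "{..<s} = insert 0 {1..<1 + (s - 1)}" using assms by auto
    thus ?thesis by (auto simp: Q_def)
  qed
  ultimately have "\<eta> \<in> fv.span (insert (covec c1) P0 \<union> Q {1..<1 + (s - 1)})" by simp
  moreover have "\<eta> \<in> fv.span (G \<union> Q {..<1})" unfolding \<eta>_def
    by (rule span_lincomb[OF _ span_monoD[OF v_in_G]]) (use w_Q[of 0] in auto)
  moreover have "insert (covec c1) P0 \<subseteq> fv.span (G \<union> Q {..<1})"
  proof -
    have "covec c1 \<in> fv.span (G \<union> Q {..<1})" by (rule fv.span_base) (auto simp: Q_def)
    moreover have "P0 \<subseteq> fv.span (G \<union> Q {..<1})" using P0_G span_monoD[of _ G "G \<union> Q {..<1}"] by blast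
    ultimately show ?thesis by blast
  qed
  ultimately have "\<eta> \<in> fv.span (insert (covec c1) P0)" by (rule drop_Q)
  thus ?thesis unfolding \<eta>_def
  proof (rule span_subset_span[rotated])
    have "P0 \<subseteq> fv.span (insert (covec c1) (v ` {..<\<kappa> + s} \<union> w ` {..<K}))"
      using P0_I0 span_monoD[of _ "v ` {..<\<kappa> + s} \<union> w ` {..<K}"] by blast
    thus "insert (covec c1) P0 \<subseteq> fv.span (insert (covec c1) (v ` {..<\<kappa> + s} \<union> w ` {..<K}))"
      by (auto intro: fv.span_base)
  qed
qed

text \<open>The source of the regularity condition of the triangular form: a cannot be independent
  of u2.\<close>

lemma wK_notin: "w K \<notin> fv.span (insert (v (\<kappa> + s)) (v ` {..<\<kappa> + s} \<union> w ` {..<K} \<union> covec ` {..<n}))"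
proof
  assume "w K \<in> fv.span (insert (v (\<kappa> + s)) (v ` {..<\<kappa> + s} \<union> w ` {..<K} \<union> covec ` {..<n}))"
  hence "w K \<in> fv.span G"
    by (rule span_subset_span[rotated]) (use w_G v_in_G covec_in_G in auto)
  thus False using w_new[of 0] by (simp add: Q_def)
qed

text \<open>The order of coordinates in the triangular form: \<kappa> + s derivatives of \<psi>,
  \<open>K\<close> of \<zeta>, \<open>s\<close> of u2, with n = \<kappa> + K. The two inputs follow
  at n + 2 s and n + 2 s + 1. Without prolongation the second one is \<zeta>_K rather than a
  derivative of u2.\<close>

definition \<iota> :: "nat \<Rightarrow> nat + nat + nat" where
  "\<iota> i = (if i < \<kappa> + s then Inl i else if i < n + s then Inr (Inl (i - (\<kappa> + s)))
          else if i < n + 2 * s then Inr (Inr (i - (n + s)))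
          else if i = n + 2 * s then Inl (\<kappa> + s)
          else if s = 0 then Inr (Inl K) else Inr (Inr s))"

lemma indep_chart: "indep (F \<circ> \<iota>) {..<n + 2 * s + 2}"
proof (rule indep_comp)
  show "inj_on \<iota> {..<n + 2 * s + 2}"
    unfolding \<iota>_def using count by (intro inj_onI) (auto split: if_splits)
  show "indep F (\<iota> ` {..<n + 2 * s + 2})"
  proof (cases "s = 0")
    case True
    have "\<iota> x \<in> Inl ` {..<\<kappa> + K + 1} \<union> (Inr \<circ> Inl) ` {..<Suc K}" if "x < n + 2 * s + 2" for x
      using that True count unfolding \<iota>_def by (auto split: if_splits)
    thus ?thesis by (intro indep_subset[OF indep_vwK]) blast
  next
    case False
    have "\<iota> x \<in> Inl ` {..<\<kappa> + K + 1} \<union> (Inr \<circ> Inl) ` {..<K} \<union> (Inr \<circ> Inr) ` {..<Suc s}"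
      if "x < n + 2 * s + 2" for x
      using that False s_le count unfolding \<iota>_def by (auto split: if_splits)
    thus ?thesis by (intro indep_subset[OF indep_vwQ[of "Suc s"]]) blast
  qed
qed

end

section \<open>Generic points of a flat output\<close>

abbreviation (input) coord :: "nat \<Rightarrow> (nat \<Rightarrow> real) \<Rightarrow> real" where "coord c \<equiv> \<lambda>p. p c"

text \<open>Each condition is attainable inside every nonempty open subset and survives further
  shrinking, so they are imposed one after another.\<close>

lemma shrink_finitely:
  assumes "open V0" "V0 \<noteq> {}"
    and "\<And>k V. k < m \<Longrightarrow> open V \<Longrightarrow> V \<noteq> {} \<Longrightarrow> V \<subseteq> V0 \<Longrightarrow>
           \<exists>V'. open V' \<and> V' \<noteq> {} \<and> V' \<subseteq> V \<and> (\<forall>q\<in>V'. R k q)"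
  shows "\<exists>V. open V \<and> V \<noteq> {} \<and> V \<subseteq> V0 \<and> (\<forall>q\<in>V. \<forall>k<m. R (k::nat) q)"
  using assms(3)
proof (induction m)
  case 0
  thus ?case using assms(1,2) by blast
next
  case (Suc m)
  have "\<exists>V. open V \<and> V \<noteq> {} \<and> V \<subseteq> V0 \<and> (\<forall>q\<in>V. \<forall>k<m. R k q)"
    by (rule Suc.IH) (rule Suc.prems[OF less_SucI])
  then obtain V where V: "open V" "V \<noteq> {}" "V \<subseteq> V0" "\<forall>q\<in>V. \<forall>k<m. R k q" by blast
  from Suc.prems[OF lessI V(1-3)]
  obtain V' where V': "open V'" "V' \<noteq> {}" "V' \<subseteq> V" "\<forall>q\<in>V'. R m q" by blast
  have "\<forall>q\<in>V'. \<forall>k<Suc m. R k q" using V(4) V'(3,4) by (auto simp: less_Suc_eq)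
  thus ?case using V(3) V'(1-3) by (intro exI[of _ V'] conjI) auto
qed

lemma form_span_supported:
  assumes "open U" "fsmooth U h" "\<And>p c. p \<in> U \<Longrightarrow> c \<ge> m \<Longrightarrow> pd c h p = 0"
  shows "form_span U (exact_form ` coord ` {..<m}) (exact_form h)"
proof -
  have "form_span U (exact_form ` coord ` {..<m}) (\<lambda>c p. \<Sum>i<m. pd i h p * exact_form (coord i) c p)"
    by (rule form_span_sum[OF assms(1)], rule form_span_scale[OF assms(1) fsmooth_pd[OF assms(2)]], rule form_span_base) auto
  thus ?thesis
  proof (rule form_span_cong)
    fix p c assume p: "p \<in> U"
    have "(\<Sum>i<m. pd i h p * exact_form (coord i) c p) = (\<Sum>i<m. if i = c then pd i h p else 0)"
      by (rule sum.cong) (auto simp: exact_form_def pd_coord)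
    also have "\<dots> = exact_form h c p" using assms(3)[OF p, of c] by (auto simp: exact_form_def)
    finally show "(\<Sum>i<m. pd i h p * exact_form (coord i) c p) = exact_form h c p" .
  qed
qed

text \<open>\<open>W c\<close> is the total time derivative of the \<open>c\<close>-th jet coordinate.\<close>

locale control_field =
  fixes n :: nat and W :: "nat \<Rightarrow> (nat \<Rightarrow> real) \<Rightarrow> real" and Om :: "(nat \<Rightarrow> real) set"
  assumes open_Om: "open Om"
    and W_fsmooth: "\<And>c. fsmooth Om (W c)"
    and W_jet: "\<And>c. c \<ge> n \<Longrightarrow> W c = coord (c + 2)"
    and W_depends_below: "\<And>i. i < n \<Longrightarrow> depends_below (n + 2) (W i)"
begin

abbreviation D where "D \<equiv> total_deriv W"

lemma D_coord: "D (coord c) = W c"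
proof
  fix p
  have "D (coord c) p = (\<Sum>c'<Suc c. W c' p * pd c' (coord c) p)" by (rule total_deriv_eq[OF depends_below_coord]) simp
  also have "\<dots> = (\<Sum>c'<Suc c. if c' = c then W c' p else 0)"
    by (rule sum.cong) (auto simp: pd_coord)
  finally show "D (coord c) p = W c p" by simp
qed

lemma fsmooth_D: "fsmooth Om h \<Longrightarrow> fsmooth Om (D h)"
  by (rule fsmooth_total_deriv[OF open_Om W_fsmooth])

text \<open>When the derivative in direction \<open>c\<close> vanishes on an open set, only the
  commutator with D remains: the dependence of the right-hand sides on \<open>c\<close> and, for a
  derivative of an input, the coordinate two places lower, whose time derivative is coordinate
  \<open>c\<close>.\<close>

lemma pd_D:
  assumes U: "open U" "U \<subseteq> Om" and h: "fsmooth Om h" and p: "p \<in> U" and c: "c \<ge> n"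
    and z: "\<And>q. q \<in> U \<Longrightarrow> pd c h q = 0"
  shows "pd c (D h) p = (\<Sum>i<n. pd c (W i) p * pd i h p) + (if c \<ge> n + 2 then pd (c - 2) h p else 0)"
proof -
  obtain M0 where "depends_below M0 h" using h by (auto simp: fsmooth_def)
  define M where "M = max M0 n"
  have M: "depends_below M h" "n \<le> M" using depends_below_mono[OF \<open>depends_below M0 h\<close>, of M] by (auto simp: M_def)
  have "pd c (D h) p = (\<Sum>i<M. pd c (W i) p * pd i h p + W i p * pd i (pd c h) p)"
    by (rule pd_total_deriv[OF open_Om W_fsmooth h M(1)]) (use p U in blast)
  also have "\<dots> = (\<Sum>i<M. pd c (W i) p * pd i h p)"
  proof (rule sum.cong)
    fix i
    have "pd i (pd c h) p = pd i (\<lambda>q. 0) p" by (rule pd_cong[OF U(1) p]) (rule z)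
    thus "pd c (W i) p * pd i h p + W i p * pd i (pd c h) p = pd c (W i) p * pd i h p"
      by (simp add: pd_const)
  qed simp
  also have "\<dots> = (\<Sum>i<n. pd c (W i) p * pd i h p) + (\<Sum>i\<in>{n..<M}. pd c (W i) p * pd i h p)"
    using sum.atLeastLessThan_concat[of 0 n M "\<lambda>i. pd c (W i) p * pd i h p"] M(2)
    by (simp add: atLeast0LessThan)
  also have "(\<Sum>i\<in>{n..<M}. pd c (W i) p * pd i h p) = (\<Sum>i\<in>{n..<M}. if i = c - 2 \<and> c \<ge> n + 2 then pd i h p else 0)"
    by (rule sum.cong) (auto simp: W_jet pd_coord)
  also have "\<dots> = (if c \<ge> n + 2 then pd (c - 2) h p else 0)"
  proof (cases "c \<ge> n + 2")
    case True
    have "(\<Sum>i\<in>{n..<M}. if i = c - 2 \<and> c \<ge> n + 2 then pd i h p else 0)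
        = (\<Sum>i\<in>{n..<M}. if i = c - 2 then pd i h p else 0)" using True by simp
    also have "\<dots> = (if c - 2 \<in> {n..<M} then pd (c - 2) h p else 0)" by simp
    also have "\<dots> = pd (c - 2) h p" using True depends_below_pd_zero[OF M(1), of "c - 2" p] by auto
    finally show ?thesis using True by simp
  qed simp
  finally show ?thesis .
qed

lemma pd_D_top:
  assumes "open U" "U \<subseteq> Om" "fsmooth Om h" "p \<in> U" "c \<ge> n + 2" "\<And>q. q \<in> U \<Longrightarrow> pd c h q = 0"
  shows "pd c (D h) p = pd (c - 2) h p"
  using pd_D[OF assms(1-4) _ assms(6)] assms(5) depends_below_pd_zero[OF W_depends_below, of _ c p] by simp

definition jetseq :: "(nat \<Rightarrow> (nat \<Rightarrow> real) \<Rightarrow> real) \<Rightarrow> bool" where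
  "jetseq h \<longleftrightarrow> (\<forall>k. fsmooth Om (h k)) \<and> (\<forall>k. h (Suc k) = D (h k)) \<and> (\<forall>p\<in>Om. \<forall>c\<ge>n. pd c (h 0) p = 0)"

text \<open>D raises the order by one, so the first derivative that may contain inputs contains none
  of their derivatives.\<close>

lemma jetseq_low:
  assumes "jetseq h" "open U" "U \<subseteq> Om" "\<And>k q c. k < \<kappa> \<Longrightarrow> q \<in> U \<Longrightarrow> c \<ge> n \<Longrightarrow> pd c (h k) q = 0"
    and "q \<in> U" "c \<ge> n + 2"
  shows "pd c (h \<kappa>) q = 0"
proof (cases \<kappa>)
  case 0
  thus ?thesis using assms by (auto simp: jetseq_def)
next
  case (Suc k)
  have "pd c (D (h k)) q = pd (c - 2) (h k) q"
    by (rule pd_D_top[of U]) (use assms Suc in \<open>auto simp: jetseq_def\<close>)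
  also have "\<dots> = 0" using assms(4)[of k q "c - 2"] Suc assms(5,6) by simp
  finally show ?thesis using assms(1) Suc by (simp add: jetseq_def)
qed

lemma jetseq_supp:
  assumes "jetseq h" "open U" "U \<subseteq> Om" "\<And>q c. q \<in> U \<Longrightarrow> c \<ge> n + 2 \<Longrightarrow> pd c (h \<kappa>) q = 0"
  shows "q \<in> U \<Longrightarrow> c \<ge> n + 2 + 2 * j \<Longrightarrow> pd c (h (\<kappa> + j)) q = 0"
proof (induction j arbitrary: q c)
  case 0
  thus ?case using assms(4) by simp
next
  case (Suc j)
  have "pd c (D (h (\<kappa> + j))) q = pd (c - 2) (h (\<kappa> + j)) q"
    by (rule pd_D_top[of U]) (use assms Suc in \<open>auto simp: jetseq_def\<close>)
  also have "\<dots> = 0" using Suc.IH[of q "c - 2"] Suc.prems by simp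
  finally show ?case using assms(1) by (simp add: jetseq_def)
qed

text \<open>The highest terms repeat under D with the same coefficients. This supplies the staircase
  of the pointwise linear algebra.\<close>

lemma jetseq_shift:
  assumes "jetseq h" "open U" "U \<subseteq> Om" "\<And>q c. q \<in> U \<Longrightarrow> c \<ge> n + 2 \<Longrightarrow> pd c (h \<kappa>) q = 0"
    and "c \<ge> n"
  shows "q \<in> U \<Longrightarrow> pd (c + 2 * j) (h (\<kappa> + j)) q = pd c (h \<kappa>) q"
proof (induction j)
  case (Suc j)
  have "pd (c + 2 * Suc j) (D (h (\<kappa> + j))) q = pd (c + 2 * Suc j - 2) (h (\<kappa> + j)) q"
  proof (rule pd_D_top[OF assms(2,3) _ Suc.prems])
    show "fsmooth Om (h (\<kappa> + j))" using assms(1) by (simp add: jetseq_def)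
    show "n + 2 \<le> c + 2 * Suc j" using assms(5) by simp
    show "pd (c + 2 * Suc j) (h (\<kappa> + j)) q' = 0" if "q' \<in> U" for q'
      by (rule jetseq_supp[OF assms(1-3) _ that]) (use assms(4,5) in auto)
  qed
  also have "\<dots> = pd c (h \<kappa>) q" using Suc by simp
  finally show ?case using assms(1) by (simp add: jetseq_def)
qed simp

lemma form_span_D:
  assumes V: "open V" "V \<subseteq> Om" and S: "\<And>g. g \<in> S \<Longrightarrow> fsmooth Om g" and h: "fsmooth Om h"
    and s: "form_span V (exact_form ` S) (exact_form h)"
    and S': "\<And>g. g \<in> S \<Longrightarrow> form_span V (exact_form ` S') (exact_form g)" "\<And>g. g \<in> S \<Longrightarrow> form_span V (exact_form ` S') (exact_form (D g))"
  shows "form_span V (exact_form ` S') (exact_form (D h))"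
proof (rule form_span_trans[OF V(1)])
  show "form_span V (exact_form ` (S \<union> D ` S)) (exact_form (D h))"
    by (rule form_span_total_deriv[OF V(1) _ _ _ s]) (use W_fsmooth h S fsmooth_subset[OF _ V(2)] in auto)
  show "form_span V (exact_form ` S') \<omega>" if "\<omega> \<in> exact_form ` (S \<union> D ` S)" for \<omega>
    using that S' by auto
qed

end

text \<open>Flatness in linearised form: the relations x = F_x and u = F_u, differentiated at each
  point.\<close>

locale flat_jets = control_field +
  fixes \<psi> \<zeta> :: "nat \<Rightarrow> (nat \<Rightarrow> real) \<Rightarrow> real" and r1 r2 :: nat
  assumes \<psi>: "jetseq \<psi>" and \<zeta>: "jetseq \<zeta>"
    and flat_x: "\<And>p i. p \<in> Om \<Longrightarrow> i < n \<Longrightarrow> covec i \<in> fv.span (diff_at p ` (\<psi> ` {..<r1} \<union> \<zeta> ` {..<r2}))"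
    and flat_u: "\<And>p j. p \<in> Om \<Longrightarrow> j < 2 \<Longrightarrow> covec (n + j) \<in> fv.span (diff_at p ` (\<psi> ` {..r1} \<union> \<zeta> ` {..r2}))"
begin

lemma \<psi>_fsmooth: "fsmooth Om (\<psi> k)" and \<psi>_Suc: "\<psi> (Suc k) = D (\<psi> k)"
  and \<zeta>_fsmooth: "fsmooth Om (\<zeta> k)" and \<zeta>_Suc: "\<zeta> (Suc k) = D (\<zeta> k)"
  using \<psi> \<zeta> by (auto simp: jetseq_def)

end

text \<open>\<open>c0\<close> is the input that \<psi>_\<kappa> replaces, \<open>c1\<close> the
  remaining one.\<close>

locale pivot_jets = flat_jets +
  fixes U :: "(nat \<Rightarrow> real) set" and \<kappa> c0 c1 :: nat
  assumes U: "open U" "U \<noteq> {}" "U \<subseteq> Om"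
    and c01: "{c0, c1} = {n, n + 1}"
    and low: "\<And>k q c. k < \<kappa> \<Longrightarrow> q \<in> U \<Longrightarrow> c \<ge> n \<Longrightarrow> pd c (\<psi> k) q = 0"
    and pivot: "\<And>q. q \<in> U \<Longrightarrow> pd c0 (\<psi> \<kappa>) q \<noteq> 0"
begin

lemma \<psi>_top: "q \<in> U \<Longrightarrow> c \<ge> n + 2 \<Longrightarrow> pd c (\<psi> \<kappa>) q = 0"
  using jetseq_low[OF \<psi> U(1,3) low] by blast

lemma triangular: "q \<in> U \<Longrightarrow> triangular n \<kappa> c0 c1 (\<lambda>k. diff_at q (\<psi> k))"
  by standard
     (use c01 low jetseq_supp[OF \<psi> U(1,3) \<psi>_top] jetseq_shift[OF \<psi> U(1,3) \<psi>_top] pivot in \<open>auto simp: diff_at_def\<close>)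

lemma c_lt: "c0 < n + 2" "c1 < n + 2" "c0 \<ge> n" "c1 \<ge> n" "c0 \<noteq> c1"
  using c01 by (auto simp: doubleton_eq_iff)

text \<open>Functions whose differentials at a point form the sets \<open>Q\<close> and
  \<open>G\<close> of the pointwise setting.\<close>

definition XQ where "XQ I = (\<lambda>i. coord (c1 + 2 * i)) ` I"
definition GX where "GX = coord ` {..<n} \<union> range \<psi>"

lemma diff_at_GX: "diff_at q ` GX = triangular.G n (\<lambda>k. diff_at q (\<psi> k))" if "q \<in> U"
proof -
  interpret triangular n \<kappa> c0 c1 "\<lambda>k. diff_at q (\<psi> k)" by (rule triangular[OF that])
  show ?thesis by (auto simp: GX_def G_def image_Un image_image diff_at_coord)
qed

lemma diff_at_XQ: "diff_at q ` XQ I = triangular.Q c1 I" if "q \<in> U"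
proof -
  interpret triangular n \<kappa> c0 c1 "\<lambda>k. diff_at q (\<psi> k)" by (rule triangular[OF that])
  show ?thesis by (auto simp: XQ_def Q_def image_image diff_at_coord)
qed

lemma fsmooth_GX: "g \<in> GX \<Longrightarrow> fsmooth Om g"
  using fsmooth_coord \<psi>_fsmooth by (auto simp: GX_def)

lemma fsmooth_XQ: "g \<in> XQ I \<Longrightarrow> fsmooth Om g"
  using fsmooth_coord by (auto simp: XQ_def)

text \<open>d\<psi>_\<kappa> is solved for the differential of the first input, dividing by the
  pivot coefficient.\<close>

lemma form_span_c0:
  assumes V: "open V" "V \<subseteq> U"
  shows "form_span V (exact_form ` insert (coord c1) GX) (exact_form (coord c0))"
proof -
  let ?S = "exact_form ` insert (coord c1) GX"
  have SMV: "fsmooth Om h \<Longrightarrow> fsmooth V h" for h using fsmooth_subset V U by blast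
  have "form_span V ?S (\<lambda>c p. (1 / pd c0 (\<psi> \<kappa>) p) * (exact_form (\<psi> \<kappa>) c p -
      ((\<Sum>i<n. pd i (\<psi> \<kappa>) p * exact_form (coord i) c p) + pd c1 (\<psi> \<kappa>) p * exact_form (coord c1) c p)))"
  proof (intro form_span_scale[OF V(1)] form_span_diff[OF V(1)] form_span_add form_span_sum[OF V(1)])
    show "fsmooth V (\<lambda>p. 1 / pd c0 (\<psi> \<kappa>) p)"
      by (rule fsmooth_divide[OF V(1) fsmooth_const SMV[OF fsmooth_pd[OF \<psi>_fsmooth]]]) (use pivot V in blast)
    show "fsmooth V (pd c1 (\<psi> \<kappa>))" by (rule SMV[OF fsmooth_pd[OF \<psi>_fsmooth]])
    show "fsmooth V (pd i (\<psi> \<kappa>))" if "i < n" for i by (rule SMV[OF fsmooth_pd[OF \<psi>_fsmooth]])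
    show "form_span V ?S (exact_form (\<psi> \<kappa>))" by (rule form_span_base) (auto simp: GX_def)
    show "form_span V ?S (exact_form (coord c1))" by (rule form_span_base) auto
    show "form_span V ?S (exact_form (coord i))" if "i < n" for i by (rule form_span_base) (use that in \<open>auto simp: GX_def\<close>)
  qed
  thus ?thesis
  proof (rule form_span_cong)
    fix p c assume p: "p \<in> V"
    have "(\<Sum>i<n. pd i (\<psi> \<kappa>) p * exact_form (coord i) c p) = (\<Sum>i<n. if i = c then pd i (\<psi> \<kappa>) p else 0)"
      by (rule sum.cong) (auto simp: exact_form_def pd_coord)
    also have "\<dots> = (if c < n then pd c (\<psi> \<kappa>) p else 0)" by simp
    finally have e: "(\<Sum>i<n. pd i (\<psi> \<kappa>) p * exact_form (coord i) c p) = (if c < n then pd c (\<psi> \<kappa>) p else 0)" .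
    have "c < n \<or> c = c0 \<or> c = c1 \<or> c \<ge> n + 2" using c01 by (auto simp: doubleton_eq_iff)
    thus "(1 / pd c0 (\<psi> \<kappa>) p) * (exact_form (\<psi> \<kappa>) c p -
      ((\<Sum>i<n. pd i (\<psi> \<kappa>) p * exact_form (coord i) c p) + pd c1 (\<psi> \<kappa>) p * exact_form (coord c1) c p)) = exact_form (coord c0) c p"
      unfolding e using pivot[of p] \<psi>_top[of p c] p V c_lt
      by (auto simp: exact_form_def pd_coord)
  qed
qed

text \<open>D of a state coordinate contains both inputs: the first is expressed through
  d\<psi>_\<kappa>, the second has order zero and is covered even for j = 0. On the other generators
  D only raises an index.\<close>

lemma form_span_D_GXQ:
  assumes V: "open V" "V \<subseteq> U" and g: "g \<in> GX \<union> XQ {..<j}"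
  shows "form_span V (exact_form ` (GX \<union> XQ {..<Suc j})) (exact_form (D g))"
proof -
  let ?S = "GX \<union> XQ {..<Suc j}"
  have base: "form_span V (exact_form ` ?S) (exact_form g)" if "g \<in> ?S" for g
    by (rule form_span_base) (use that in blast)
  from g consider i where "i < n" "g = coord i" | k where "g = \<psi> k" | i where "i < j" "g = coord (c1 + 2 * i)"
    by (auto simp: GX_def XQ_def)
  thus ?thesis
  proof cases
    case 1
    have "form_span V (exact_form ` coord ` {..<n + 2}) (exact_form (W i))"
      by (rule form_span_supported[OF V(1)])
         (use W_fsmooth fsmooth_subset V U W_depends_below[OF 1(1)] depends_below_pd_zero in \<open>blast+\<close>)
    hence "form_span V (exact_form ` ?S) (exact_form (W i))"
    proof (rule form_span_trans[OF V(1)])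
      fix \<omega> assume "\<omega> \<in> exact_form ` coord ` {..<n + 2}"
      then obtain c where c: "c < n + 2" "\<omega> = exact_form (coord c)" by blast
      have sub: "insert (coord c1) GX \<subseteq> ?S" by (force simp: XQ_def)
      have "c < n \<or> c = c0 \<or> c = c1" using c(1) c01 by (auto simp: doubleton_eq_iff)
      thus "form_span V (exact_form ` ?S) \<omega>"
      proof (elim disjE)
        assume "c < n"
        thus ?thesis unfolding c(2) by (intro base) (auto simp: GX_def)
      next
        assume "c = c0"
        thus ?thesis unfolding c(2) using form_span_mono[OF form_span_c0[OF V] image_mono[OF sub]] by simp
      next
        assume "c = c1"
        thus ?thesis unfolding c(2) using base sub by blast
      qed
    qed
    thus ?thesis unfolding 1(2) D_coord .
  next
    case 2
    show ?thesis unfolding 2 \<psi>_Suc[symmetric] by (rule base) (auto simp: GX_def)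
  next
    case 3
    have "W (c1 + 2 * i) = coord (c1 + 2 * Suc i)" using W_jet[of "c1 + 2 * i"] c_lt(4) by simp
    hence "D g = coord (c1 + 2 * Suc i)" unfolding 3(2) D_coord .
    moreover have "coord (c1 + 2 * Suc i) \<in> ?S" unfolding XQ_def using 3(1) by blast
    ultimately show ?thesis using base[of "coord (c1 + 2 * Suc i)"] by simp
  qed
qed

lemma form_span_D_step:
  assumes V: "open V" "V \<subseteq> U" and "fsmooth Om h" "form_span V (exact_form ` (GX \<union> XQ {..<j})) (exact_form h)"
  shows "form_span V (exact_form ` (GX \<union> XQ {..<Suc j})) (exact_form (D h))"
proof (rule form_span_D[OF V(1) _ _ assms(3,4)])
  fix g assume g: "g \<in> GX \<union> XQ {..<j}"
  show "fsmooth Om g" using g fsmooth_GX fsmooth_XQ by blast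
  show "form_span V (exact_form ` (GX \<union> XQ {..<Suc j})) (exact_form g)"
    by (rule form_span_base) (use g in \<open>auto simp: XQ_def\<close>)
  show "form_span V (exact_form ` (GX \<union> XQ {..<Suc j})) (exact_form (D g))" by (rule form_span_D_GXQ[OF V g])
qed (use V U in blast)

lemma span_GXQ:
  assumes "form_span V (exact_form ` (GX \<union> XQ I)) (exact_form h)" "q \<in> V" "V \<subseteq> U"
  shows "diff_at q h \<in> fv.span (triangular.G n (\<lambda>k. diff_at q (\<psi> k)) \<union> triangular.Q c1 I)"
proof -
  have "q \<in> U" using assms by blast
  thus ?thesis using form_span_diff_at_span[OF assms(1,2)] by (simp only: image_Un diff_at_GX diff_at_XQ)
qed

lemma span_GX:
  assumes "form_span V (exact_form ` GX) (exact_form h)" "q \<in> V" "V \<subseteq> U"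
  shows "diff_at q h \<in> fv.span (triangular.G n (\<lambda>k. diff_at q (\<psi> k)))"
proof -
  have "q \<in> U" using assms by blast
  thus ?thesis using form_span_diff_at_span[OF assms(1,2)] by (simp only: diff_at_GX)
qed

lemma c1_notin_G: "q \<in> U \<Longrightarrow> covec c1 \<notin> fv.span (triangular.G n (\<lambda>k. diff_at q (\<psi> k)))"
proof -
  assume "q \<in> U"
  then interpret triangular n \<kappa> c0 c1 "\<lambda>k. diff_at q (\<psi> k)" by (rule triangular)
  show ?thesis using Q_notin'[of 0 "{}" G] fv.span_superset by (auto simp: Q_def)
qed

text \<open>Otherwise the linearised relation u = F_u would put the differential of u2 into the span
  of \<open>G\<close> at a point.\<close>

lemma exists_K: "\<exists>k\<le>r2. \<not> form_span U (exact_form ` GX) (exact_form (\<zeta> k))"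
proof (rule ccontr)
  assume *: "\<not> ?thesis"
  obtain q where q: "q \<in> U" using U(2) by blast
  obtain j where j: "j < 2" "c1 = n + j"
    using c_lt by (metis add_diff_inverse_nat less_diff_conv2 not_less add.commute)
  have "covec c1 \<in> fv.span (diff_at q ` (\<psi> ` {..r1} \<union> \<zeta> ` {..r2}))" unfolding j(2)
    by (rule flat_u) (use q U j in auto)
  moreover have "diff_at q ` (\<psi> ` {..r1} \<union> \<zeta> ` {..r2}) \<subseteq> fv.span (triangular.G n (\<lambda>k. diff_at q (\<psi> k)))"
  proof -
    have "diff_at q (\<zeta> k) \<in> fv.span (triangular.G n (\<lambda>k. diff_at q (\<psi> k)))" if "k \<le> r2" for k
      by (rule span_GX[OF _ q]) (use * that in auto)
    moreover have "diff_at q (\<psi> k) \<in> fv.span (triangular.G n (\<lambda>k. diff_at q (\<psi> k)))" for k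
      by (rule triangular.v_in_G[OF triangular[OF q], of k])
    ultimately show ?thesis by auto
  qed
  ultimately show False using c1_notin_G[OF q] span_subset_span by blast
qed

text \<open>Membership is asked for with smooth coefficients on all of \<open>U\<close>. Below
  \<open>K\<close> it can therefore be differentiated, and its failure at \<open>K\<close> leaves an
  open set on which the coefficient of u2 has no zero.\<close>

definition K where "K = (LEAST k. \<not> form_span U (exact_form ` GX) (exact_form (\<zeta> k)))"

lemma K_le: "K \<le> r2"
proof -
  obtain k where "k \<le> r2" "\<not> form_span U (exact_form ` GX) (exact_form (\<zeta> k))" using exists_K by blast
  thus ?thesis using Least_le[of "\<lambda>k. \<not> form_span U (exact_form ` GX) (exact_form (\<zeta> k))" k] by (simp add: K_def)
qed

lemma K_notin: "\<not> form_span U (exact_form ` GX) (exact_form (\<zeta> K))"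
  unfolding K_def by (rule LeastI_ex) (use exists_K in blast)

lemma less_K: "k < K \<Longrightarrow> form_span U (exact_form ` GX) (exact_form (\<zeta> k))"
  unfolding K_def by (drule not_less_Least) simp

lemma K_pos: "K \<ge> 1"
proof (rule ccontr)
  assume "\<not> K \<ge> 1"
  hence "K = 0" by simp
  have "form_span U (exact_form ` coord ` {..<n}) (exact_form (\<zeta> 0))"
    by (rule form_span_supported[OF U(1) fsmooth_subset[OF \<zeta>_fsmooth U(3)]]) (use \<zeta> U in \<open>auto simp: jetseq_def\<close>)
  hence "form_span U (exact_form ` GX) (exact_form (\<zeta> 0))" by (rule form_span_mono) (auto simp: GX_def)
  thus False using K_notin \<open>K = 0\<close> by simp
qed

text \<open>D, applied to the relation for \<zeta>_(K-1), expresses d\<zeta>_K by \<open>GX\<close>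
  and a multiple \<open>a\<close> of the differential of u2. By the choice of \<open>K\<close>,
  \<open>a\<close> is not identically zero; where it is nonzero, the differential of u2 can be
  recovered.\<close>

lemma exists_V1:
  obtains V1 where "open V1" "V1 \<noteq> {}" "V1 \<subseteq> U"
    "form_span V1 (exact_form ` insert (\<zeta> K) GX) (exact_form (coord c1))" "form_span V1 (exact_form ` (GX \<union> XQ {..<1})) (exact_form (\<zeta> K))"
proof -
  obtain k where k: "K = Suc k" using K_pos by (cases K) auto
  have "form_span U (exact_form ` (GX \<union> XQ {..<0})) (exact_form (\<zeta> k))" using less_K[of k] k by (simp add: XQ_def)
  from form_span_D_step[OF U(1) subset_refl \<zeta>_fsmooth this]
  have 1: "form_span U (exact_form ` (GX \<union> XQ {..<1})) (exact_form (\<zeta> K))" using k \<zeta>_Suc by simp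
  moreover have e: "exact_form ` (GX \<union> XQ {..<1}) = insert (exact_form (coord c1)) (exact_form ` GX)" by (auto simp: XQ_def)
  ultimately have "form_span U (insert (exact_form (coord c1)) (exact_form ` GX)) (exact_form (\<zeta> K))" by simp
  then obtain a where a: "fsmooth U a" "form_span U (exact_form ` GX) (\<lambda>c p. exact_form (\<zeta> K) c p - a p * exact_form (coord c1) c p)"
    using form_span_insertE[OF U(1)] by blast
  define V1 where "V1 = {q \<in> U. a q \<noteq> 0}"
  have V1: "open V1" "V1 \<subseteq> U" using open_nonzero[OF U(1) fsmooth_csmooth[OF a(1)]] by (auto simp: V1_def)
  have "V1 \<noteq> {}"
  proof
    assume "V1 = {}"
    hence "form_span U (exact_form ` GX) (exact_form (\<zeta> K))" by (intro form_span_cong[OF a(2)]) (auto simp: V1_def)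
    thus False using K_notin by blast
  qed
  have aV: "fsmooth V1 (\<lambda>p. 1 / a p)"
    by (rule fsmooth_divide[OF V1(1) fsmooth_const fsmooth_subset[OF a(1) V1(2)]]) (auto simp: V1_def)
  let ?S = "exact_form ` insert (\<zeta> K) GX"
  have "form_span V1 ?S (\<lambda>c p. exact_form (\<zeta> K) c p - a p * exact_form (coord c1) c p)"
    by (rule form_span_mono[OF form_span_subset[OF a(2) V1(2)]]) blast
  hence "form_span V1 ?S (\<lambda>c p. (1 / a p) * (exact_form (\<zeta> K) c p - (exact_form (\<zeta> K) c p - a p * exact_form (coord c1) c p)))"
    by (rule form_span_scale[OF V1(1) aV form_span_diff[OF V1(1) form_span_base[OF imageI[OF insertI1]]]])
  hence "form_span V1 ?S (exact_form (coord c1))" by (rule form_span_cong) (simp add: V1_def)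
  thus ?thesis using that V1 \<open>V1 \<noteq> {}\<close> form_span_subset[OF 1 V1(2)] by blast
qed

text \<open>Both directions of the exchange between \<zeta>_(K+j) and D^j u2 must be carried
  together: differentiating the second produces \<zeta>_(K+j+1) but also \<zeta>_(K+j), which the
  first removes.\<close>

lemma form_span_higher:
  assumes V: "open V" "V \<subseteq> U"
    and s: "form_span V (exact_form ` insert (\<zeta> K) GX) (exact_form (coord c1))" "form_span V (exact_form ` (GX \<union> XQ {..<1})) (exact_form (\<zeta> K))"
  shows "form_span V (exact_form ` (GX \<union> XQ {..<Suc j})) (exact_form (\<zeta> (K + j))) \<and>
         form_span V (exact_form ` insert (\<zeta> (K + j)) (GX \<union> XQ {..<j})) (exact_form (coord (c1 + 2 * j)))"
proof (induction j)
  case 0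
  show ?case using s by (simp add: XQ_def)
next
  case (Suc j)
  have 1: "form_span V (exact_form ` (GX \<union> XQ {..<Suc (Suc j)})) (exact_form (\<zeta> (K + Suc j)))"
    using form_span_D_step[OF V \<zeta>_fsmooth Suc.IH[THEN conjunct1]] \<zeta>_Suc[of "K + j"] by simp
  let ?S = "insert (\<zeta> (K + j)) (GX \<union> XQ {..<j})"
  let ?T = "insert (\<zeta> (K + Suc j)) (GX \<union> XQ {..<Suc j})"
  have "form_span V (exact_form ` ?T) (exact_form (D (coord (c1 + 2 * j))))"
  proof (rule form_span_D[OF V(1) _ _ fsmooth_coord Suc.IH[THEN conjunct2]])
    show "V \<subseteq> Om" using V U by blast
    fix g assume g: "g \<in> ?S"
    show "fsmooth Om g" using g fsmooth_GX fsmooth_XQ \<zeta>_fsmooth by blast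
    have sub: "exact_form ` (GX \<union> XQ {..<Suc j}) \<subseteq> exact_form ` ?T" by blast
    show "form_span V (exact_form ` ?T) (exact_form g)"
    proof (cases "g = \<zeta> (K + j)")
      case True
      thus ?thesis using form_span_mono[OF Suc.IH[THEN conjunct1] sub] by simp
    next
      case False
      hence "g \<in> ?T" using g by (auto simp: XQ_def)
      thus ?thesis by (intro form_span_base) blast
    qed
    show "form_span V (exact_form ` ?T) (exact_form (D g))"
    proof (cases "g = \<zeta> (K + j)")
      case True
      hence "D g = \<zeta> (K + Suc j)" using \<zeta>_Suc[of "K + j"] by simp
      thus ?thesis by (intro form_span_base) auto
    next
      case False
      hence "g \<in> GX \<union> XQ {..<j}" using g by blast
      thus ?thesis using form_span_mono[OF form_span_D_GXQ[OF V] sub] by blast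
    qed
  qed
  moreover have "D (coord (c1 + 2 * j)) = coord (c1 + 2 * Suc j)"
    unfolding D_coord using W_jet[of "c1 + 2 * j"] c_lt(4) by simp
  ultimately show ?case using 1 by simp
qed

text \<open>Since D^j u2 is recovered from \<zeta>_(K+j), its differential would otherwise depend on
  \<open>G\<close> and its lower-order companions.\<close>

lemma \<zeta>_new:
  assumes V: "open V" "V \<subseteq> U" "q \<in> V"
    and s: "form_span V (exact_form ` insert (\<zeta> K) GX) (exact_form (coord c1))" "form_span V (exact_form ` (GX \<union> XQ {..<1})) (exact_form (\<zeta> K))"
  shows "diff_at q (\<zeta> (K + j)) \<notin> fv.span (triangular.G n (\<lambda>k. diff_at q (\<psi> k)) \<union> triangular.Q c1 {..<j})"
proof
  have q: "q \<in> U" using V by blast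
  interpret triangular n \<kappa> c0 c1 "\<lambda>k. diff_at q (\<psi> k)" by (rule triangular[OF q])
  assume *: "diff_at q (\<zeta> (K + j)) \<in> fv.span (G \<union> Q {..<j})"
  have "covec (c1 + 2 * j) \<in> fv.span (diff_at q ` insert (\<zeta> (K + j)) (GX \<union> XQ {..<j}))"
    using form_span_diff_at_span[OF form_span_higher[OF V(1,2) s, THEN conjunct2] V(3)] by (simp only: diff_at_coord)
  also have "diff_at q ` insert (\<zeta> (K + j)) (GX \<union> XQ {..<j}) = insert (diff_at q (\<zeta> (K + j))) (G \<union> Q {..<j})"
    by (simp only: image_insert image_Un diff_at_GX[OF q] diff_at_XQ[OF q])
  finally have "covec (c1 + 2 * j) \<in> fv.span (G \<union> Q {..<j})"
    by (rule span_subset_span[rotated]) (use * fv.span_superset in blast)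
  thus False using Q_notin'[of j "{..<j}" "G \<union> Q {..<j}"] fv.span_superset by auto
qed

section \<open>Independence at generic points\<close>

lemma generic_diff_at:
  assumes V: "open V" "V \<noteq> {}" "V \<subseteq> Om" and S: "finite S" "\<And>g. g \<in> S \<Longrightarrow> fsmooth Om g" and h: "fsmooth Om h"
    and no: "\<And>V'. open V' \<Longrightarrow> V' \<noteq> {} \<Longrightarrow> V' \<subseteq> V \<Longrightarrow> \<not> form_span V' (exact_form ` S) (exact_form h)"
  shows "\<exists>V'. open V' \<and> V' \<noteq> {} \<and> V' \<subseteq> V \<and> (\<forall>q\<in>V'. diff_at q h \<notin> fv.span (diff_at q ` S))"
proof -
  have 1: "finite (exact_form ` S)" "\<forall>\<omega>\<in>exact_form ` S. smooth_form V \<omega>" "smooth_form V (exact_form h)"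
    using S h smooth_form_exact_form fsmooth_subset[OF _ V(3)] by auto
  show ?thesis
  proof (rule generic_dichotomy[OF 1 V(1,2)])
    fix V' assume "open V'" "V' \<noteq> {}" "V' \<subseteq> V" "form_span V' (exact_form ` S) (exact_form h)"
    thus ?thesis using no by blast
  next
    fix V' assume "open V'" "V' \<noteq> {}" "V' \<subseteq> V"
      "\<And>p. p \<in> V' \<Longrightarrow> covec_at p (exact_form h) \<notin> fv.span (covec_at p ` exact_form ` S)"
    thus ?thesis by (auto simp: covec_at_exact_form image_image)
  qed
qed

text \<open>A smooth dependency of d\<psi>_k on its predecessors on some open set spreads by D to
  all later derivatives. Then d\<psi>_\<kappa> would have no input component.\<close>

lemma generic_\<psi>:
  assumes V: "open V" "V \<noteq> {}" "V \<subseteq> U"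
  shows "\<exists>V'. open V' \<and> V' \<noteq> {} \<and> V' \<subseteq> V \<and> (\<forall>q\<in>V'. \<forall>k<\<kappa>. diff_at q (\<psi> k) \<notin> fv.span (diff_at q ` \<psi> ` {..<k}))"
proof (rule shrink_finitely[OF V(1,2)])
  fix k V1 assume k: "k < \<kappa>" and V1: "open V1" "V1 \<noteq> {}" "V1 \<subseteq> V"
  show "\<exists>V'. open V' \<and> V' \<noteq> {} \<and> V' \<subseteq> V1 \<and> (\<forall>q\<in>V'. diff_at q (\<psi> k) \<notin> fv.span (diff_at q ` \<psi> ` {..<k}))"
  proof (rule generic_diff_at[OF V1(1,2)])
    fix V2 assume V2: "open V2" "V2 \<noteq> {}" "V2 \<subseteq> V1"
    show "\<not> form_span V2 (exact_form ` \<psi> ` {..<k}) (exact_form (\<psi> k))"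
    proof
      assume s: "form_span V2 (exact_form ` \<psi> ` {..<k}) (exact_form (\<psi> k))"
      have "form_span V2 (exact_form ` \<psi> ` {..<k}) (exact_form (\<psi> (k + j)))" for j
      proof (induction j)
        case (Suc j)
        have "form_span V2 (exact_form ` \<psi> ` {..<k}) (exact_form (D (\<psi> (k + j))))"
        proof (rule form_span_D[OF V2(1) _ _ \<psi>_fsmooth Suc])
          fix g assume "g \<in> \<psi> ` {..<k}"
          then obtain i where i: "i < k" "g = \<psi> i" by blast
          show "form_span V2 (exact_form ` \<psi> ` {..<k}) (exact_form g)" by (rule form_span_base) (use i in blast)
          show "fsmooth Om g" using i \<psi>_fsmooth by simp
          show "form_span V2 (exact_form ` \<psi> ` {..<k}) (exact_form (D g))"
            unfolding i(2) \<psi>_Suc[symmetric]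
            by (cases "Suc i = k") (use s i form_span_base[of "exact_form (\<psi> (Suc i))" "exact_form ` \<psi> ` {..<k}"] in auto)
        qed (use V2 V1 V U in blast)
        thus ?case using \<psi>_Suc[of "k + j"] by simp
      qed (use s in simp)
      from this[of "\<kappa> - k"] have s: "form_span V2 (exact_form ` \<psi> ` {..<k}) (exact_form (\<psi> \<kappa>))" using k by simp
      obtain q where q: "q \<in> V2" using V2 by blast
      hence qU: "q \<in> U" using V2 V1 V by blast
      have "diff_at q (\<psi> \<kappa>) c0 = 0"
        by (rule span_component_zero[OF form_span_diff_at_span[OF s q]])
           (use low[OF _ qU c_lt(3)] k in \<open>auto simp: diff_at_def\<close>)
      thus False using pivot[OF qU] by (simp add: diff_at_def)
    qed
  qed (use V1 V U \<psi>_fsmooth in auto)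
qed

text \<open>The same propagation, now carried up to \<zeta>_K, which would then be free of u2 modulo
  \<open>G\<close>.\<close>

lemma generic_\<zeta>:
  assumes V: "open V" "V \<noteq> {}" "V \<subseteq> U"
    and s: "form_span V (exact_form ` insert (\<zeta> K) GX) (exact_form (coord c1))" "form_span V (exact_form ` (GX \<union> XQ {..<1})) (exact_form (\<zeta> K))"
  shows "\<exists>V'. open V' \<and> V' \<noteq> {} \<and> V' \<subseteq> V \<and>
    (\<forall>q\<in>V'. \<forall>k<K. diff_at q (\<zeta> k) \<notin> fv.span (diff_at q ` (\<psi> ` {..<J} \<union> \<zeta> ` {..<k})))"
proof (rule shrink_finitely[OF V(1,2)])
  fix k V1 assume k: "k < K" and V1: "open V1" "V1 \<noteq> {}" "V1 \<subseteq> V"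
  \<comment> \<open>\<open>?T\<close> takes all derivatives of \<psi>, since D leads out of the
    finite range in \<open>?S\<close>.\<close>
  let ?S = "\<psi> ` {..<J} \<union> \<zeta> ` {..<k}" and ?T = "range \<psi> \<union> \<zeta> ` {..<k}"
  show "\<exists>V'. open V' \<and> V' \<noteq> {} \<and> V' \<subseteq> V1 \<and> (\<forall>q\<in>V'. diff_at q (\<zeta> k) \<notin> fv.span (diff_at q ` ?S))"
  proof (rule generic_diff_at[OF V1(1,2)])
    fix V2 assume V2: "open V2" "V2 \<noteq> {}" "V2 \<subseteq> V1"
    show "\<not> form_span V2 (exact_form ` ?S) (exact_form (\<zeta> k))"
    proof
      assume "form_span V2 (exact_form ` ?S) (exact_form (\<zeta> k))"
      hence s1: "form_span V2 (exact_form ` ?T) (exact_form (\<zeta> k))" by (rule form_span_mono) blast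
      have "form_span V2 (exact_form ` ?T) (exact_form (\<zeta> (k + j)))" for j
      proof (induction j)
        case (Suc j)
        have "form_span V2 (exact_form ` ?T) (exact_form (D (\<zeta> (k + j))))"
        proof (rule form_span_D[OF V2(1) _ _ \<zeta>_fsmooth Suc])
          fix g assume g: "g \<in> ?T"
          show "form_span V2 (exact_form ` ?T) (exact_form g)" by (rule form_span_base) (use g in blast)
          show "fsmooth Om g" using g \<psi>_fsmooth \<zeta>_fsmooth by blast
          show "form_span V2 (exact_form ` ?T) (exact_form (D g))"
          proof (cases "g \<in> range \<psi>")
            case True
            then obtain i where "g = \<psi> i" by blast
            thus ?thesis unfolding \<psi>_Suc[symmetric] by (intro form_span_base) (simp flip: \<psi>_Suc)
          next
            case False
            then obtain i where i: "i < k" "g = \<zeta> i" using g by blast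
            show ?thesis
            proof (cases "Suc i = k")
              case True
              thus ?thesis using s1 by (simp add: i(2) flip: \<zeta>_Suc)
            next
              case False
              thus ?thesis unfolding i(2) \<zeta>_Suc[symmetric] by (intro form_span_base) (use i in auto)
            qed
          qed
        qed (use V2 V1 V U in blast)
        thus ?case using \<zeta>_Suc[of "k + j"] by simp
      qed (use s1 in simp)
      from this[of "K - k"] have s2: "form_span V2 (exact_form ` ?T) (exact_form (\<zeta> K))" using k by simp
      obtain q where q: "q \<in> V2" using V2 by blast
      have qV: "q \<in> V" and qU: "q \<in> U" using q V2 V1 V by blast+
      interpret triangular n \<kappa> c0 c1 "\<lambda>k. diff_at q (\<psi> k)" by (rule triangular[OF qU])
      have "diff_at q (\<zeta> i) \<in> fv.span G" if "i < k" for i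
        by (rule span_GX[OF less_K qU subset_refl]) (use that k in simp)
      hence "diff_at q ` ?T \<subseteq> fv.span G" using v_in_G by auto
      hence "diff_at q (\<zeta> K) \<in> fv.span G"
        by (rule span_subset_span) (rule form_span_diff_at_span[OF s2 q])
      thus False using \<zeta>_new[OF V(1,3) qV s, of 0] by (simp add: Q_def)
    qed
  qed (use V1 V U \<psi>_fsmooth \<zeta>_fsmooth in auto)
qed

text \<open>If inputs occur before order \<open>K\<close>, the coefficient of the first input cannot
  vanish at the point found: the second input alone would then be solved for within
  \<open>G\<close>. If none occurs, \<kappa>2 = K.\<close>

lemma exists_\<kappa>2:
  assumes V: "open V" "V \<noteq> {}" "V \<subseteq> U"
  shows "\<exists>V' \<kappa>2. open V' \<and> V' \<noteq> {} \<and> V' \<subseteq> V \<and> \<kappa>2 \<le> K \<and>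
     (\<forall>q\<in>V'. (\<forall>k<\<kappa>2. \<forall>c\<ge>n. pd c (\<zeta> k) q = 0) \<and> (\<kappa>2 < K \<longrightarrow> pd c0 (\<zeta> \<kappa>2) q \<noteq> 0))"
proof (cases "\<exists>k<K. \<exists>q\<in>V. \<exists>c\<ge>n. pd c (\<zeta> k) q \<noteq> 0")
  case False
  thus ?thesis using V by (intro exI[of _ V] exI[of _ K]) auto
next
  case True
  let ?P = "\<lambda>k. k < K \<and> (\<exists>q\<in>V. \<exists>c\<ge>n. pd c (\<zeta> k) q \<noteq> 0)"
  define \<kappa>2 where "\<kappa>2 = (LEAST k. ?P k)"
  have "?P \<kappa>2" unfolding \<kappa>2_def by (rule LeastI_ex) (use True in blast)
  then obtain q c where q: "\<kappa>2 < K" "q \<in> V" "c \<ge> n" "pd c (\<zeta> \<kappa>2) q \<noteq> 0" by blast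
  have lt: "pd c (\<zeta> k) q = 0" if "k < \<kappa>2" "q \<in> V" "c \<ge> n" for k q c
    using not_less_Least[of k ?P] that q(1) unfolding \<kappa>2_def[symmetric] by auto
  have top: "pd c (\<zeta> \<kappa>2) q = 0" if "q \<in> V" "c \<ge> n + 2" for q c
    by (rule jetseq_low[OF \<zeta> V(1) _ lt]) (use V U that in blast)+
  have qU: "q \<in> U" using q V by blast
  have nz: "pd c0 (\<zeta> \<kappa>2) q \<noteq> 0"
  proof
    assume z: "pd c0 (\<zeta> \<kappa>2) q = 0"
    interpret triangular n \<kappa> c0 c1 "\<lambda>k. diff_at q (\<psi> k)" by (rule triangular[OF qU])
    have "c < n + 2" using top q by (meson not_less)
    hence "c = c0 \<or> c = c1" using q(3) c_top[of 0 c] by simp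
    hence k: "pd c1 (\<zeta> \<kappa>2) q \<noteq> 0" using q z by auto
    have \<eta>: "diff_at q (\<zeta> \<kappa>2) \<in> fv.span G"
      by (rule span_GX[OF less_K[OF q(1)] qU subset_refl])
    have "(\<lambda>c. diff_at q (\<zeta> \<kappa>2) c - pd c1 (\<zeta> \<kappa>2) q * covec c1 c) \<in> fv.span (covec ` {..<n})"
    proof (rule supported_span)
      fix c assume "c \<ge> n"
      hence "c = c0 \<or> c = c1 \<or> c \<ge> n + 2" using c_top[of 0 c] by auto
      thus "diff_at q (\<zeta> \<kappa>2) c - pd c1 (\<zeta> \<kappa>2) q * covec c1 c = 0"
        using z top[OF q(2)] c_lt by (auto simp: diff_at_def covec_def)
    qed
    hence "(\<lambda>c. diff_at q (\<zeta> \<kappa>2) c - pd c1 (\<zeta> \<kappa>2) q * covec c1 c) \<in> fv.span G"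
      by (rule span_monoD) (auto simp: G_def)
    from span_lincombD2[OF this \<eta> k] show False using c1_notin_G[OF qU] by blast
  qed
  define V' where "V' = {q \<in> V. pd c0 (\<zeta> \<kappa>2) q \<noteq> 0}"
  have "open V'" unfolding V'_def
    by (rule open_nonzero[OF V(1)]) (use fsmooth_csmooth[OF fsmooth_pd[OF fsmooth_subset[OF \<zeta>_fsmooth]]] V U in blast)
  moreover have "q \<in> V'" using nz q by (simp add: V'_def)
  ultimately show ?thesis using q(1) lt
    by (intro exI[of _ V'] exI[of _ \<kappa>2]) (auto simp: V'_def)
qed

theorem generic_flat_point:
  assumes "\<kappa> \<ge> 1"
  shows "\<exists>V \<kappa>2. open V \<and> V \<noteq> {} \<and> V \<subseteq> U \<and>
    (\<forall>q\<in>V. flat_point n \<kappa> c0 c1 (\<lambda>k. diff_at q (\<psi> k)) (\<lambda>k. diff_at q (\<zeta> k)) K \<kappa>2 r1 r2)"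
proof -
  obtain V1 where V1: "open V1" "V1 \<noteq> {}" "V1 \<subseteq> U"
    and s1: "form_span V1 (exact_form ` insert (\<zeta> K) GX) (exact_form (coord c1))" "form_span V1 (exact_form ` (GX \<union> XQ {..<1})) (exact_form (\<zeta> K))"
    by (rule exists_V1)
  obtain V2 where V2: "open V2" "V2 \<noteq> {}" "V2 \<subseteq> V1"
    and i2: "\<forall>q\<in>V2. \<forall>k<K. diff_at q (\<zeta> k) \<notin> fv.span (diff_at q ` (\<psi> ` {..<\<kappa> + K + 1} \<union> \<zeta> ` {..<k}))"
    using generic_\<zeta>[OF V1 s1] by blast
  have "V2 \<subseteq> U" using V2 V1 by blast
  then obtain V3 where V3: "open V3" "V3 \<noteq> {}" "V3 \<subseteq> V2"
    and i3: "\<forall>q\<in>V3. \<forall>k<\<kappa>. diff_at q (\<psi> k) \<notin> fv.span (diff_at q ` \<psi> ` {..<k})"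
    using generic_\<psi>[OF V2(1,2)] by blast
  have "V3 \<subseteq> U" using V3 V2 V1 by blast
  then obtain V \<kappa>2 where V: "open V" "V \<noteq> {}" "V \<subseteq> V3" and \<kappa>2: "\<kappa>2 \<le> K"
    and low2: "\<And>q k c. q \<in> V \<Longrightarrow> k < \<kappa>2 \<Longrightarrow> c \<ge> n \<Longrightarrow> pd c (\<zeta> k) q = 0"
    and piv2: "\<And>q. q \<in> V \<Longrightarrow> \<kappa>2 < K \<Longrightarrow> pd c0 (\<zeta> \<kappa>2) q \<noteq> 0"
    using exists_\<kappa>2[OF V3(1,2)] by blast
  have sub: "V \<subseteq> U" "V \<subseteq> Om" "V \<subseteq> V1" "V \<subseteq> V2" using V V3 V2 V1 U by blast+
  have top2: "pd c (\<zeta> \<kappa>2) q = 0" if "q \<in> V" "c \<ge> n + 2" for q c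
    by (rule jetseq_low[OF \<zeta> V(1) sub(2) low2]) (use that in auto)
  have "flat_point n \<kappa> c0 c1 (\<lambda>k. diff_at q (\<psi> k)) (\<lambda>k. diff_at q (\<zeta> k)) K \<kappa>2 r1 r2" if q: "q \<in> V" for q
  proof -
    have qU: "q \<in> U" and q1: "q \<in> V1" and q2: "q \<in> V2" and q3: "q \<in> V3" and qO: "q \<in> Om"
      using q sub V by blast+
    interpret triangular n \<kappa> c0 c1 "\<lambda>k. diff_at q (\<psi> k)" by (rule triangular[OF qU])
    show ?thesis
    proof unfold_locales
      show "1 \<le> \<kappa>" "1 \<le> K" "\<kappa>2 \<le> K" "K \<le> r2" using assms K_pos \<kappa>2 K_le .
      show "diff_at q (\<psi> k) \<notin> fv.span ((\<lambda>k. diff_at q (\<psi> k)) ` {..<k})" if "k < \<kappa>" for k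
        using i3 q3 that by (auto simp: image_image)
      show "diff_at q (\<zeta> k) \<notin> fv.span ((\<lambda>k. diff_at q (\<psi> k)) ` {..<\<kappa> + K + 1} \<union> (\<lambda>k. diff_at q (\<zeta> k)) ` {..<k})"
        if "k < K" for k
        using i2 q2 that by (auto simp: image_image image_Un)
      show "diff_at q (\<zeta> k) \<in> fv.span G" if "k < K" for k
        by (rule span_GX[OF less_K[OF that] qU subset_refl])
      show "diff_at q (\<zeta> (K + j)) \<notin> fv.span (G \<union> Q {..<j})" for j
        by (rule \<zeta>_new[OF V1(1,3) q1 s1])
      show "diff_at q (\<zeta> (K + j)) \<in> fv.span (G \<union> Q {..<Suc j})" for j
        by (rule span_GXQ[OF form_span_higher[OF V1(1,3) s1, THEN conjunct1] q1 V1(3)])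
      show "diff_at q (\<zeta> k) c = 0" if "k < \<kappa>2" "c \<ge> n" for k c
        using low2[OF q that] by (simp add: diff_at_def)
      show "diff_at q (\<zeta> (\<kappa>2 + j)) c = 0" if "c \<ge> n + 2 + 2 * j" for j c
        using jetseq_supp[OF \<zeta> V(1) sub(2) top2 q that] by (simp add: diff_at_def)
      show "diff_at q (\<zeta> (\<kappa>2 + j)) (c + 2 * j) = diff_at q (\<zeta> \<kappa>2) c" if "c \<ge> n" for j c
        using jetseq_shift[OF \<zeta> V(1) sub(2) top2 that q] by (simp add: diff_at_def)
      show "diff_at q (\<zeta> \<kappa>2) c0 \<noteq> 0" if "\<kappa>2 < K"
        using piv2[OF q that] by (simp add: diff_at_def)
      show "covec i \<in> fv.span ((\<lambda>k. diff_at q (\<psi> k)) ` {..<r1} \<union> (\<lambda>k. diff_at q (\<zeta> k)) ` {..<r2})" if "i < n" for i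
        using flat_x[OF qO that] by (simp add: image_image image_Un)
    qed
  qed
  thus ?thesis using V sub(1) by blast
qed

end

section \<open>Inverse function theorem\<close>

text \<open>Open cylinders over the first \<open>m\<close> coordinates represent the open subsets of
  R^m inside jet space.\<close>

definition cylinder :: "nat \<Rightarrow> (nat \<Rightarrow> real) set \<Rightarrow> bool" where
  "cylinder m U \<longleftrightarrow> (\<forall>q r. (\<forall>i<m. q i = r i) \<longrightarrow> q \<in> U \<longrightarrow> r \<in> U)"

lemma cylinderD: "cylinder m U \<Longrightarrow> q \<in> U \<Longrightarrow> (\<And>i. i < m \<Longrightarrow> q i = r i) \<Longrightarrow> r \<in> U"
  unfolding cylinder_def by blast

lemma cylinder_mono: "cylinder m U \<Longrightarrow> m \<le> m' \<Longrightarrow> cylinder m' U"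
  unfolding cylinder_def by (meson less_le_trans)

lemma cylinder_box: "cylinder m (box_nbhd p m \<delta>)"
  by (simp add: cylinder_def box_nbhd_def)

lemma cylinder_contains_box:
  assumes "open U" "cylinder m U" "p \<in> U"
  obtains \<delta> where "\<delta> > 0" "box_nbhd p m \<delta> \<subseteq> U"
proof -
  obtain M \<delta> where \<delta>: "\<delta> > 0" "M \<ge> m" "box_nbhd p M \<delta> \<subseteq> U"
    using open_contains_box_nbhd_ge assms(1,3) by blast
  have "box_nbhd p m \<delta> \<subseteq> U"
  proof
    fix q assume q: "q \<in> box_nbhd p m \<delta>"
    define r where "r = (\<lambda>i. if i < m then q i else p i)"
    have "r \<in> box_nbhd p M \<delta>" using q \<delta>(1) by (auto simp: r_def box_nbhd_def)
    hence "r \<in> U" using \<delta>(3) by blast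
    thus "q \<in> U" by (rule cylinderD[OF assms(2)]) (simp add: r_def)
  qed
  thus ?thesis using that \<delta>(1) by blast
qed

lemma open_Collect_pos:
  fixes f :: "(nat \<Rightarrow> real) \<Rightarrow> real"
  assumes "open U" "continuous_on U f"
  shows "open {q \<in> U. f q > 0}"
proof -
  have "open (U \<inter> f -` {0<..})"
    by (rule continuous_open_preimage[OF assms(2,1)]) auto
  also have "U \<inter> f -` {0<..} = {q \<in> U. f q > 0}" by auto
  finally show ?thesis .
qed

text \<open>A diffeomorphism between open sets of R^m, extended by the identity in the remaining
  coordinates, with its inverse as an explicit argument. In this form the calculus of jet space
  applies to it directly.\<close>

definition ldiffeo :: "nat \<Rightarrow> (nat \<Rightarrow> real) set \<Rightarrow> (nat \<Rightarrow> real) set \<Rightarrow> ((nat \<Rightarrow> real) \<Rightarrow> nat \<Rightarrow> real)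
    \<Rightarrow> ((nat \<Rightarrow> real) \<Rightarrow> nat \<Rightarrow> real) \<Rightarrow> bool" where
  "ldiffeo m U V T G \<longleftrightarrow> open U \<and> open V \<and> cylinder m U \<and> cylinder m V \<and>
     (\<forall>q\<in>U. T q \<in> V \<and> G (T q) = q) \<and> (\<forall>w\<in>V. G w \<in> U \<and> T (G w) = w) \<and>
     (\<forall>i. csmooth U (\<lambda>q. T q i)) \<and> (\<forall>i. csmooth V (\<lambda>w. G w i)) \<and>
     (\<forall>i<m. depends_below m (\<lambda>q. T q i) \<and> depends_below m (\<lambda>w. G w i)) \<and>
     (\<forall>i\<ge>m. \<forall>q. T q i = q i \<and> G q i = q i)"

lemma ldiffeoD:
  assumes "ldiffeo m U V T G"
  shows "open U" "open V" "cylinder m U" "cylinder m V"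
    "\<And>q. q \<in> U \<Longrightarrow> T q \<in> V" "\<And>q. q \<in> U \<Longrightarrow> G (T q) = q"
    "\<And>w. w \<in> V \<Longrightarrow> G w \<in> U" "\<And>w. w \<in> V \<Longrightarrow> T (G w) = w"
    "\<And>i. csmooth U (\<lambda>q. T q i)" "\<And>i. csmooth V (\<lambda>w. G w i)"
    "\<And>i. i < m \<Longrightarrow> depends_below m (\<lambda>q. T q i)" "\<And>i. i < m \<Longrightarrow> depends_below m (\<lambda>w. G w i)"
    "\<And>i q. i \<ge> m \<Longrightarrow> T q i = q i" "\<And>i q. i \<ge> m \<Longrightarrow> G q i = q i"
  using assms unfolding ldiffeo_def by auto

lemma csmooth_comp_continuous: "(\<And>i. csmooth U (\<lambda>q. T q i)) \<Longrightarrow> continuous_on U T"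
  by (rule continuous_on_coordinatewise_then_product) (rule csmooth_continuous)

lemma open_preimage:
  assumes "open U" "\<And>i. csmooth U (\<lambda>q. T q i)" "open V"
  shows "open {q \<in> U. T q \<in> V}"
proof -
  have "open (U \<inter> T -` V)" by (rule continuous_open_preimage[OF csmooth_comp_continuous[OF assms(2)] assms(1,3)])
  also have "U \<inter> T -` V = {q \<in> U. T q \<in> V}" by auto
  finally show ?thesis .
qed

lemma ldiffeo_agree:
  assumes "ldiffeo m U V T G" "\<And>i. i < m \<Longrightarrow> q i = r i" "i < m"
  shows "T q i = T r i" "G q i = G r i"
proof -
  show "T q i = T r i" by (rule depends_below_eq[OF ldiffeoD(11)[OF assms(1,3)], of q r]) (erule assms(2))
  show "G q i = G r i" by (rule depends_below_eq[OF ldiffeoD(12)[OF assms(1,3)], of q r]) (erule assms(2))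
qed

lemma ldiffeo_compose:
  assumes 1: "ldiffeo m U V T G" and 2: "ldiffeo m U' V' T' G'"
  shows "ldiffeo m {q \<in> U. T q \<in> U'} {w \<in> V'. G' w \<in> V} (\<lambda>q. T' (T q)) (\<lambda>w. G (G' w))"
    (is "ldiffeo m ?A ?B _ _")
proof -
  note d1 = ldiffeoD[OF 1] and d2 = ldiffeoD[OF 2]
  have A: "open ?A" by (rule open_preimage[OF d1(1,9) d2(1)])
  have B: "open ?B" by (rule open_preimage[OF d2(2,10) d1(2)])
  have cA: "cylinder m ?A" unfolding cylinder_def
  proof (intro allI impI)
    fix q r assume e: "\<forall>i<m. q i = r i" and q: "q \<in> ?A"
    have "r \<in> U" by (rule cylinderD[OF d1(3), of q]) (use q e in auto)
    moreover have "T r \<in> U'"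
    proof (rule cylinderD[OF d2(3), of "T q"])
      show "T q i = T r i" if "i < m" for i by (rule ldiffeo_agree(1)[OF 1 _ that]) (use e in blast)
    qed (use q in blast)
    ultimately show "r \<in> ?A" by blast
  qed
  have cB: "cylinder m ?B" unfolding cylinder_def
  proof (intro allI impI)
    fix q r assume e: "\<forall>i<m. q i = r i" and q: "q \<in> ?B"
    have "r \<in> V'" by (rule cylinderD[OF d2(4), of q]) (use q e in auto)
    moreover have "G' r \<in> V"
    proof (rule cylinderD[OF d1(4), of "G' q"])
      show "G' q i = G' r i" if "i < m" for i by (rule ldiffeo_agree(2)[OF 2 _ that]) (use e in blast)
    qed (use q in blast)
    ultimately show "r \<in> ?B" by blast
  qed
  have sA: "csmooth ?A (\<lambda>q. T' (T q) i)" for i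
  proof (cases "i < m")
    case True
    show ?thesis
      by (rule csmooth_comp[OF A d2(1,9) d2(11)[OF True]]) (use csmooth_subset[OF d1(9)] in auto)
  next
    case False
    hence "(\<lambda>q. T' (T q) i) = (\<lambda>q. q i)" using d1(13) d2(13) by auto
    thus ?thesis using csmooth_coord by simp
  qed
  have sB: "csmooth ?B (\<lambda>w. G (G' w) i)" for i
  proof (cases "i < m")
    case True
    show ?thesis
      by (rule csmooth_comp[OF B d1(2,10) d1(12)[OF True]]) (use csmooth_subset[OF d2(10)] in auto)
  next
    case False
    hence "(\<lambda>q. G (G' q) i) = (\<lambda>q. q i)" using d1(14) d2(14) by auto
    thus ?thesis using csmooth_coord by simp
  qed
  have fA: "depends_below m (\<lambda>q. T' (T q) i)" if "i < m" for i
  proof (rule depends_belowI)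
    fix q r :: "nat \<Rightarrow> real" assume e: "\<And>i. i < m \<Longrightarrow> q i = r i"
    show "T' (T q) i = T' (T r) i"
      by (rule ldiffeo_agree(1)[OF 2 _ that]) (rule ldiffeo_agree(1)[OF 1 e])
  qed
  have fB: "depends_below m (\<lambda>q. G (G' q) i)" if "i < m" for i
  proof (rule depends_belowI)
    fix q r :: "nat \<Rightarrow> real" assume e: "\<And>i. i < m \<Longrightarrow> q i = r i"
    show "G (G' q) i = G (G' r) i"
      by (rule ldiffeo_agree(2)[OF 1 _ that]) (rule ldiffeo_agree(2)[OF 2 e])
  qed
  show ?thesis unfolding ldiffeo_def
    using A B cA cB sA sB fA fB d1 d2 by simp
qed

lemma ldiffeo_id: "open U \<Longrightarrow> cylinder m U \<Longrightarrow> ldiffeo m U U (\<lambda>q. q) (\<lambda>q. q)"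
  unfolding ldiffeo_def using csmooth_coord depends_below_coord by simp

lemma ldiffeo_permute:
  assumes "bij_betw \<sigma> {..<m} {..<m}"
  shows "ldiffeo m UNIV UNIV (\<lambda>q i. if i < m then q (\<sigma> i) else q i)
           (\<lambda>q i. if i < m then q (inv_into {..<m} \<sigma> i) else q i)"
proof -
  have 1: "i < m \<Longrightarrow> \<sigma> i < m" "i < m \<Longrightarrow> inv_into {..<m} \<sigma> i < m"
    "i < m \<Longrightarrow> inv_into {..<m} \<sigma> (\<sigma> i) = i" "i < m \<Longrightarrow> \<sigma> (inv_into {..<m} \<sigma> i) = i" for i
    using assms by (auto simp: bij_betw_def f_inv_into_f) (metis imageI inv_into_into lessThan_iff)
  have "csmooth UNIV (\<lambda>q. if i < m then q (\<tau> i) else q i)" for i \<tau>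
    using csmooth_coord by (cases "i < m") auto
  moreover have "cylinder m UNIV" by (simp add: cylinder_def)
  ultimately show ?thesis unfolding ldiffeo_def
    using 1 depends_below_coord by (simp add: fun_eq_iff)
qed

text \<open>The implicit function theorem for one coordinate: \<open>h\<close> can replace the coordinate \<open>c\<close>.
  The general inverse function theorem below iterates this exchange.\<close>

lemma exchange:
  assumes "open \<Omega>" "cylinder m \<Omega>" "csmooth \<Omega> h" "depends_below m h" "c < m" "p \<in> \<Omega>" "pd c h p \<noteq> 0"
  shows "\<exists>U V G. ldiffeo m U V (\<lambda>q. q(c := h q)) G \<and> p \<in> U \<and> U \<subseteq> \<Omega>"
proof -
  \<comment> \<open>With this sign \<open>\<sigma> * h\<close> is increasing in direction
    \<open>c\<close>, so both signs of the derivative are treated at once.\<close>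
  define \<sigma> where "\<sigma> = sgn (pd c h p)"
  have \<sigma>: "\<sigma> * \<sigma> = 1" "\<sigma> \<noteq> 0" using assms(7) by (auto simp: \<sigma>_def sgn_mult_self_eq[symmetric] sgn_if)
  define \<Omega>' where "\<Omega>' = {q \<in> \<Omega>. \<sigma> * pd c h q > 0}"
  have \<Omega>': "open \<Omega>'" unfolding \<Omega>'_def
    by (rule open_Collect_pos[OF assms(1)]) (intro continuous_intros csmooth_continuous csmooth_pd assms(3))
  have "cylinder m \<Omega>'" unfolding cylinder_def \<Omega>'_def
  proof (intro allI impI)
    fix q r assume e: "\<forall>i<m. q i = r i" and q: "q \<in> {q \<in> \<Omega>. \<sigma> * pd c h q > 0}"
    have "r \<in> \<Omega>" by (rule cylinderD[OF assms(2), of q]) (use q e in auto)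
    moreover have "pd c h q = pd c h r" by (rule depends_below_eq[OF depends_below_pd[OF assms(4)]]) (use e in blast)
    ultimately show "r \<in> {q \<in> \<Omega>. \<sigma> * pd c h q > 0}" using q by simp
  qed
  moreover have "p \<in> \<Omega>'" using assms(6,7) by (auto simp: \<Omega>'_def \<sigma>_def sgn_if)
  ultimately obtain \<delta> where \<delta>: "\<delta> > 0" "box_nbhd p m \<delta> \<subseteq> \<Omega>'" using cylinder_contains_box \<Omega>' by blast
  \<comment> \<open>Half the size, so that the closed interval from \<open>lo\<close> to
    \<open>hi\<close> still fits into the box.\<close>
  define \<epsilon> where "\<epsilon> = \<delta> / 2"
  have \<epsilon>: "\<epsilon> > 0" "\<epsilon> < \<delta>" using \<delta>(1) by (auto simp: \<epsilon>_def)
  define lo hi where "lo = p c - \<epsilon>" and "hi = p c + \<epsilon>"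
  define B0 where "B0 = {w. \<forall>i<m. i \<noteq> c \<longrightarrow> \<bar>w i - p i\<bar> < \<epsilon>}"
  have B0_eq: "B0 = {w \<in> UNIV. w(c := p c) \<in> box_nbhd p m \<epsilon>}"
    using \<epsilon>(1) by (auto simp: B0_def box_nbhd_def)
  have csmooth_upd: "csmooth U (\<lambda>q. (q(c := t)) i)" for U t i
    by (cases "i = c") (simp_all add: csmooth_const csmooth_coord)
  have B0: "open B0" unfolding B0_eq by (rule open_preimage[OF open_UNIV csmooth_upd open_box_nbhd])
  have inbox: "w(c := t) \<in> \<Omega>'" if "w \<in> B0" "lo \<le> t" "t \<le> hi" for w t
  proof -
    have "w(c := t) \<in> box_nbhd p m \<delta>"
      using that \<epsilon> by (auto simp: box_nbhd_def B0_def lo_def hi_def abs_if split: if_splits)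
    thus ?thesis using \<delta>(2) by blast
  qed
  have sub: "\<Omega>' \<subseteq> \<Omega>" by (auto simp: \<Omega>'_def)
  have mono: "\<sigma> * h (w(c := a)) < \<sigma> * h (w(c := b))" if "w \<in> B0" "lo \<le> a" "a < b" "b \<le> hi" for w a b
  proof (rule DERIV_pos_imp_increasing[OF that(3)])
    fix t assume t: "a \<le> t" "t \<le> b"
    have i: "w(c := t) \<in> \<Omega>'" by (rule inbox) (use that t in auto)
    have "((\<lambda>t. \<sigma> * h (w(c := t))) has_real_derivative \<sigma> * pd c h (w(c := t))) (at t)"
      by (rule DERIV_cmult[OF csmooth_DERIV_upd[OF assms(3)]]) (use i sub in blast)
    moreover have "\<sigma> * pd c h (w(c := t)) > 0" using i by (simp add: \<Omega>'_def)
    ultimately show "\<exists>y. ((\<lambda>t. \<sigma> * h (w(c := t))) has_real_derivative y) (at t) \<and> 0 < y" by blast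
  qed
  have inj: "a = b" if "w \<in> B0" "lo \<le> a" "a \<le> hi" "lo \<le> b" "b \<le> hi" "h (w(c := a)) = h (w(c := b))" for w a b
    using mono[of w a b] mono[of w b a] that by (metis less_irrefl linorder_neqE_linordered_idom)
  define U where "U = box_nbhd p m \<epsilon>"
  \<comment> \<open>Up to the sign, coordinate \<open>c\<close> of \<open>w\<close> lies strictly
    between the values of \<open>h\<close> at the two ends: there the intermediate value theorem
    solves the equation, and the strict inequalities make the set open.\<close>
  define V where "V = {w \<in> {w \<in> B0. \<sigma> * w c - \<sigma> * h (w(c := lo)) > 0}. \<sigma> * h (w(c := hi)) - \<sigma> * w c > 0}"
  have B0_upd: "w(c := t) \<in> B0 \<longleftrightarrow> w \<in> B0" for w t by (auto simp: B0_def)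
  have lohi: "lo < hi" using \<epsilon> by (simp add: lo_def hi_def)
  have UB: "q \<in> U \<longleftrightarrow> q \<in> B0 \<and> lo < q c \<and> q c < hi" for q
    using assms(5) by (auto simp: U_def B0_def box_nbhd_def lo_def hi_def abs_less_iff)
  have smh: "csmooth B0 (\<lambda>w. h (w(c := t)))" if "lo \<le> t" "t \<le> hi" for t
    by (rule csmooth_comp[OF B0 assms(1,3,4) csmooth_upd]) (use inbox that sub in blast)
  have contV: "continuous_on B0 (\<lambda>w. \<sigma> * w c - \<sigma> * h (w(c := t)))"
    "continuous_on B0 (\<lambda>w. \<sigma> * h (w(c := t)) - \<sigma> * w c)" if "lo \<le> t" "t \<le> hi" for t
    using csmooth_continuous[OF smh[OF that]] continuous_on_coord[of B0 c] by (auto intro!: continuous_intros)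
  have V: "open V" unfolding V_def
    by (intro open_Collect_pos B0 contV continuous_on_subset[OF contV(2)[of hi]]) (use lohi in auto)
  have VB: "w \<in> V \<longleftrightarrow> w \<in> B0 \<and> \<sigma> * h (w(c := lo)) < \<sigma> * w c \<and> \<sigma> * w c < \<sigma> * h (w(c := hi))" for w
    by (auto simp: V_def)
  have ex: "\<exists>t. lo < t \<and> t < hi \<and> h (w(c := t)) = w c" if w: "w \<in> V" for w
  proof -
    have "\<exists>t\<ge>lo. t \<le> hi \<and> \<sigma> * h (w(c := t)) = \<sigma> * w c"
    proof (rule IVT')
      show "continuous_on {lo..hi} (\<lambda>t. \<sigma> * h (w(c := t)))"
      proof (intro continuous_intros)
        show "continuous_on {lo..hi} (\<lambda>t. h (w(c := t)))"
          by (rule continuous_on_compose2[OF csmooth_continuous[OF assms(3)] continuous_on_fun_upd])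
             (use inbox w VB sub in auto)
      qed
    qed (use w VB lohi in auto)
    then obtain t where t: "lo \<le> t" "t \<le> hi" "\<sigma> * h (w(c := t)) = \<sigma> * w c" by blast
    hence "t \<noteq> lo" "t \<noteq> hi" using w VB by auto
    thus ?thesis using t \<sigma>(2) by (intro exI[of _ t]) auto
  qed
  define g where "g = (\<lambda>w. THE t. lo < t \<and> t < hi \<and> h (w(c := t)) = w c)"
  have g_eq: "g w = t" if "w \<in> B0" "lo < t" "t < hi" "h (w(c := t)) = w c" for w t
    unfolding g_def by (rule the_equality) (use that inj[of w _ t] in auto)
  have g: "lo < g w" "g w < hi" "h (w(c := g w)) = w c" if "w \<in> V" for w
    using ex[OF that] g_eq[of w] that VB by metis+
  \<comment> \<open>By monotonicity, bounds on \<open>g\<close> become strict inequalities between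
    continuous functions; continuity of \<open>g\<close> follows.\<close>
  have ggt: "a < g w \<longleftrightarrow> \<sigma> * h (w(c := a)) < \<sigma> * w c" and glt: "g w < a \<longleftrightarrow> \<sigma> * w c < \<sigma> * h (w(c := a))"
    if "w \<in> V" "lo \<le> a" "a \<le> hi" for w a
  proof -
    have "w \<in> B0" using that VB by blast
    have 1: "a < g w \<Longrightarrow> \<sigma> * h (w(c := a)) < \<sigma> * w c"
      using mono[OF \<open>w \<in> B0\<close> that(2), of "g w"] g[OF that(1)] by simp
    have 2: "g w < a \<Longrightarrow> \<sigma> * w c < \<sigma> * h (w(c := a))"
      using mono[OF \<open>w \<in> B0\<close> _ _ that(3), of "g w"] g[OF that(1)] by simp
    have 3: "g w = a \<Longrightarrow> \<sigma> * w c = \<sigma> * h (w(c := a))" using g(3)[OF that(1)] by simp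
    show "a < g w \<longleftrightarrow> \<sigma> * h (w(c := a)) < \<sigma> * w c" "g w < a \<longleftrightarrow> \<sigma> * w c < \<sigma> * h (w(c := a))"
      using 1 2 3 by (metis less_irrefl less_asym linorder_neqE_linordered_idom)+
  qed
  have gcont: "isCont g w" if w: "w \<in> V" for w
    unfolding isCont_def
  proof (rule order_tendstoI)
    fix a assume a: "a < g w"
    show "\<forall>\<^sub>F x in at w. a < g x"
    proof (cases "lo \<le> a")
      case True
      have ahi: "a \<le> hi" using a g[OF w] by simp
      let ?O = "{x \<in> B0. \<sigma> * x c - \<sigma> * h (x(c := a)) > 0}"
      have "open (V \<inter> ?O)" by (intro open_Int V open_Collect_pos B0 contV True ahi)
      moreover have "w \<in> V \<inter> ?O" using w ggt[OF w True ahi] a VB by auto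
      ultimately have "\<forall>\<^sub>F x in at w. x \<in> V \<inter> ?O" by (rule eventually_at_in_open')
      thus ?thesis by eventually_elim (use ggt[OF _ True ahi] in auto)
    next
      case False
      have "\<forall>\<^sub>F x in at w. x \<in> V" by (rule eventually_at_in_open'[OF V w])
      thus ?thesis by eventually_elim (use g(1) False in force)
    qed
  next
    fix a assume a: "g w < a"
    show "\<forall>\<^sub>F x in at w. g x < a"
    proof (cases "a \<le> hi")
      case True
      have alo: "lo \<le> a" using a g[OF w] by simp
      let ?O = "{x \<in> B0. \<sigma> * h (x(c := a)) - \<sigma> * x c > 0}"
      have "open (V \<inter> ?O)" by (intro open_Int V open_Collect_pos B0 contV True alo)
      moreover have "w \<in> V \<inter> ?O" using w glt[OF w alo True] a VB by auto
      ultimately have "\<forall>\<^sub>F x in at w. x \<in> V \<inter> ?O" by (rule eventually_at_in_open')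
      thus ?thesis by eventually_elim (use glt[OF _ alo True] in auto)
    next
      case False
      have "\<forall>\<^sub>F x in at w. x \<in> V" by (rule eventually_at_in_open'[OF V w])
      thus ?thesis by eventually_elim (use g(2) False in force)
    qed
  qed
  define G where "G = (\<lambda>w. w(c := g w))"
  have GU: "G w \<in> U" if "w \<in> V" for w
    using g[OF that] that VB B0_upd by (simp add: UB G_def)
  have Uin: "q \<in> \<Omega>'" if "q \<in> U" for q
    using inbox[of q "q c"] that UB by simp
  have nz: "pd c h q \<noteq> 0" if "q \<in> U" for q using Uin[OF that] by (auto simp: \<Omega>'_def)
  \<comment> \<open>Implicit differentiation of the equation
    \<open>h (w(c := g w)) = w c\<close>.\<close>
  define dg where "dg = (\<lambda>i q. if i = c then 1 / pd c h q else - pd i h q / pd c h q)"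
  have gder: "((\<lambda>t. g (w(i := t))) has_real_derivative dg i (G w)) (at (w i))" if w: "w \<in> V" for w i
  proof -
    define \<phi> where "\<phi> = (\<lambda>t. g (w(i := t)))"
    have \<phi>0: "\<phi> (w i) = g w" by (simp add: \<phi>_def)
    have \<phi>lim: "(\<phi> \<longlongrightarrow> g w) (at (w i))"
    proof -
      have "((\<lambda>t. w(i := t)) \<longlongrightarrow> w) (at (w i))"
      proof (rule tendsto_pointwiseI)
        fix j
        show "((\<lambda>t. (w(i := t)) j) \<longlongrightarrow> w j) (at (w i))" by (cases "j = i") auto
      qed
      thus ?thesis unfolding \<phi>_def by (rule isCont_tendsto_compose[OF gcont[OF w]])
    qed
    have covec: "\<forall>\<^sub>F t in at (w i). w(i := t) \<in> V"
      using eventually_upd[OF V w, of i] unfolding eventually_at_filter by eventually_elim simp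
    \<comment> \<open>The change of \<open>h\<close> which moving coordinate \<open>c\<close> from
      \<open>g w\<close> to \<open>\<phi> t\<close> must produce. It is known exactly, while the
      mean value theorem expresses it by the increment of \<open>g\<close>.\<close>
    define R where "R = (\<lambda>t. if i = c then t - w i else - (h ((G w)(i := t)) - h (G w)))"
    define good where "good = (\<lambda>t \<xi>. \<bar>\<xi> - g w\<bar> \<le> \<bar>\<phi> t - g w\<bar> \<and>
       R t = pd c h (w(i := t, c := \<xi>)) * (\<phi> t - g w) \<and> w(i := t, c := \<xi>) \<in> U)"
    have exg: "\<exists>\<xi>. good t \<xi>" if t: "w(i := t) \<in> V" for t
    proof -
      define q where "q = w(i := t, c := g w)"
      have B: "w(i := t) \<in> B0" using t VB by blast
      have q_upd: "q(c := s) = w(i := t, c := s)" for s by (simp add: q_def)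
      have seg: "lo < s \<and> s < hi \<and> \<bar>s - g w\<bar> \<le> \<bar>\<phi> t - g w\<bar>" if "s \<in> closed_segment (q c) (\<phi> t)" for s
        using that g(1,2)[OF t] g(1,2)[OF w]
        by (auto simp: q_def \<phi>_def closed_segment_eq_real_ivl split: if_splits)
      have qin: "q(c := s) \<in> U" if "s \<in> closed_segment (q c) (\<phi> t)" for s
        using seg[OF that] B unfolding UB q_upd by (simp add: B0_upd)
      obtain \<xi> where \<xi>: "\<xi> \<in> closed_segment (q c) (\<phi> t)"
        "h (q(c := \<phi> t)) - h q = pd c h (q(c := \<xi>)) * (\<phi> t - q c)"
        using pd_MVT[OF assms(3), of q c "\<phi> t"] qin Uin sub by blast
      have "h (q(c := \<phi> t)) = (w(i := t)) c" unfolding q_upd \<phi>_def by (rule g(3)[OF t])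
      moreover have "h q = (if i = c then w i else h ((G w)(i := t)))"
        using g(3)[OF w] by (auto simp: q_def G_def fun_upd_twist)
      moreover have "h (G w) = w c" using g(3)[OF w] by (simp add: G_def)
      ultimately have "R t = h (q(c := \<phi> t)) - h q" by (auto simp: R_def)
      thus ?thesis using \<xi> seg[OF \<xi>(1)] qin[OF \<xi>(1)] unfolding good_def q_upd
        by (intro exI[of _ \<xi>]) (simp add: q_def)
    qed
    define \<xi> where "\<xi> = (\<lambda>t. if \<exists>s. good t s then SOME s. good t s else g w)"
    have \<xi>: "good t (\<xi> t)" if "w(i := t) \<in> V" for t
      using someI_ex[OF exg[OF that]] exg[OF that] by (auto simp: \<xi>_def)
    have \<xi>le: "\<bar>\<xi> t - g w\<bar> \<le> \<bar>\<phi> t - g w\<bar>" for t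
      using someI_ex[of "good t"] by (auto simp: \<xi>_def good_def)
    have \<xi>lim: "(\<xi> \<longlongrightarrow> g w) (at (w i))"
    proof -
      have "((\<lambda>t. \<bar>\<phi> t - g w\<bar>) \<longlongrightarrow> 0) (at (w i))"
        using tendsto_rabs_zero[OF LIM_zero[OF \<phi>lim]] .
      hence "((\<lambda>t. \<xi> t - g w) \<longlongrightarrow> 0) (at (w i))"
        by (rule Lim_null_comparison[rotated]) (use \<xi>le in auto)
      thus ?thesis by (rule LIM_zero_cancel)
    qed
    have "((\<lambda>t. w(i := t, c := \<xi> t)) \<longlongrightarrow> G w) (at (w i))"
    proof (rule tendsto_pointwiseI)
      fix j
      show "((\<lambda>t. (w(i := t, c := \<xi> t)) j) \<longlongrightarrow> G w j) (at (w i))"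
        using \<xi>lim by (cases "j = c"; cases "j = i") (auto simp: G_def)
    qed
    moreover have "isCont (pd c h) (G w)"
      using csmooth_continuous[OF csmooth_pd[OF assms(3)]] assms(1) Uin[OF GU[OF w]] sub continuous_on_eq_continuous_at by blast
    ultimately have l1: "((\<lambda>t. pd c h (w(i := t, c := \<xi> t))) \<longlongrightarrow> pd c h (G w)) (at (w i))"
      by (rule isCont_tendsto_compose[rotated])
    have l2: "((\<lambda>t. R t / (t - w i)) \<longlongrightarrow> dg i (G w) * pd c h (G w)) (at (w i))"
    proof (cases "i = c")
      case True
      have "\<forall>\<^sub>F t in at (w i). 1 = R t / (t - w i)"
        unfolding eventually_at_filter by (rule always_eventually) (use True in \<open>simp add: R_def\<close>)
      moreover have "dg i (G w) * pd c h (G w) = 1" using True nz[OF GU[OF w]] by (simp add: dg_def)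
      ultimately show ?thesis using Lim_transform_eventually[OF tendsto_const] by metis
    next
      case False
      have "((\<lambda>t. h ((G w)(i := t))) has_real_derivative pd i h (G w)) (at (G w i))"
        by (rule csmooth_DERIV[OF assms(3)]) (use Uin[OF GU[OF w]] sub in blast)
      hence "((\<lambda>t. (h ((G w)(i := t)) - h (G w)) / (t - w i)) \<longlongrightarrow> pd i h (G w)) (at (w i))"
        unfolding has_field_derivative_iff fun_upd_triv using False by (simp add: G_def)
      hence l: "((\<lambda>t. - ((h ((G w)(i := t)) - h (G w)) / (t - w i))) \<longlongrightarrow> - pd i h (G w)) (at (w i))"
        by (rule tendsto_minus)
      have "R = (\<lambda>t. - (h ((G w)(i := t)) - h (G w)))" using False by (simp add: R_def)
      moreover have "dg i (G w) * pd c h (G w) = - pd i h (G w)"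
        using False nz[OF GU[OF w]] by (simp add: dg_def)
      ultimately show ?thesis using l by (simp only: minus_divide_left)
    qed
    have "((\<lambda>t. (R t / (t - w i)) / pd c h (w(i := t, c := \<xi> t))) \<longlongrightarrow> (dg i (G w) * pd c h (G w)) / pd c h (G w)) (at (w i))"
      by (rule tendsto_divide[OF l2 l1 nz[OF GU[OF w]]])
    moreover have "\<forall>\<^sub>F t in at (w i). (R t / (t - w i)) / pd c h (w(i := t, c := \<xi> t)) = (\<phi> t - \<phi> (w i)) / (t - w i)"
      using covec
    proof eventually_elim
      case (elim t)
      have "pd c h (w(i := t, c := \<xi> t)) \<noteq> 0" using \<xi>[OF elim] nz by (simp add: good_def)
      thus ?case using \<xi>[OF elim] by (simp add: good_def \<phi>0)
    qed
    ultimately have "((\<lambda>t. (\<phi> t - \<phi> (w i)) / (t - w i)) \<longlongrightarrow> (dg i (G w) * pd c h (G w)) / pd c h (G w)) (at (w i))"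
      by (rule Lim_transform_eventually)
    hence "((\<lambda>t. (\<phi> t - \<phi> (w i)) / (t - w i)) \<longlongrightarrow> dg i (G w)) (at (w i))" using nz[OF GU[OF w]] by simp
    thus ?thesis unfolding \<phi>_def by (simp add: has_field_derivative_iff)
  qed
  have Gder: "((\<lambda>t. G (w(i := t)) j) has_real_derivative (if j = c then dg i (G w) else if j = i then 1 else 0)) (at (w i))"
    if w: "w \<in> V" for w i j
    using gder[OF w, of i] by (cases "j = c"; cases "j = i") (auto simp: G_def)
  have Uopen: "open U" by (simp add: U_def open_box_nbhd)
  have UO: "U \<subseteq> \<Omega>" using Uin sub by blast
  have dg: "csmooth U (dg i)" "depends_below m (dg i)" for i
  proof -
    have "csmooth U (\<lambda>q. 1 / pd c h q)" "csmooth U (\<lambda>q. (- 1 * pd i h q) / pd c h q)"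
      by (intro csmooth_divide csmooth_mult Uopen csmooth_const csmooth_subset[OF csmooth_pd[OF assms(3)] UO] nz; assumption)+
    thus "csmooth U (dg i)" unfolding dg_def by (cases "i = c") auto
    show "depends_below m (dg i)"
      using depends_below_pd[OF assms(4), of c] depends_below_pd[OF assms(4), of i] by (auto simp: dg_def depends_below_def)
  qed
  \<comment> \<open>Partial derivatives of a function of \<open>G w\<close> are again functions of
    \<open>G w\<close>, because those of \<open>G\<close> are; coinduction then gives
    smoothness.\<close>
  have smG: "csmooth V (\<lambda>w. H (G w))" if H: "csmooth U H" "depends_below m H" for H
  proof (rule csmooth_coinduct[where C = "\<lambda>k. \<exists>H. csmooth U H \<and> depends_below m H \<and> k = (\<lambda>w. H (G w))", OF V])
    show "\<exists>H'. csmooth U H' \<and> depends_below m H' \<and> (\<lambda>w. H (G w)) = (\<lambda>w. H' (G w))" using H by blast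
  next
    fix k assume "\<exists>H. csmooth U H \<and> depends_below m H \<and> k = (\<lambda>w. H (G w))"
    then obtain H where H: "csmooth U H" "depends_below m H" "k = (\<lambda>w. H (G w))" by blast
    have Gc: "continuous_on V G"
    proof (rule continuous_on_coordinatewise_then_product)
      fix j
      have "continuous_on V g" using gcont continuous_at_imp_continuous_on by blast
      thus "continuous_on V (\<lambda>w. G w j)" using continuous_on_coord[of V j] by (cases "j = c") (auto simp: G_def)
    qed
    have "continuous_on V k" unfolding H(3)
      by (rule continuous_on_compose2[OF csmooth_continuous[OF H(1)] Gc]) (use GU in blast)
    moreover have "\<exists>k'. (\<exists>H. csmooth U H \<and> depends_below m H \<and> k' = (\<lambda>w. H (G w))) \<and>
        (\<forall>p\<in>V. ((\<lambda>t. k (p(i := t))) has_real_derivative k' p) (at (p i)))" for i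
    proof -
      define d where "d = (\<lambda>j q. if j = c then dg i q else if j = i then 1 else 0)"
      define H' where "H' = (\<lambda>q. \<Sum>j<m. pd j H q * d j q)"
      have d: "csmooth U (d j)" "depends_below m (d j)" for j
        using dg csmooth_const depends_below_const unfolding d_def by (cases "j = c"; cases "j = i"; simp)+
      have "csmooth U H'" unfolding H'_def by (intro csmooth_sum csmooth_mult Uopen csmooth_pd H(1) d) simp
      moreover have "depends_below m H'" using d(2) depends_below_pd[OF H(2)] by (simp add: H'_def depends_below_def)
      moreover have "((\<lambda>t. k (p(i := t))) has_real_derivative H' (G p)) (at (p i))" if p: "p \<in> V" for p
      proof -
        have "((\<lambda>t. H (G (p(i := t)))) has_real_derivative (\<Sum>j<m. pd j H (G (p(i := p i))) * d j (G p))) (at (p i))"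
          by (rule chain_rule[OF Uopen H(1,2)]) (use GU[OF p] Gder[OF p] in \<open>auto simp: d_def\<close>)
        thus ?thesis by (simp add: H(3) H'_def)
      qed
      ultimately show ?thesis by (intro exI[of _ "\<lambda>w. H' (G w)"]) blast
    qed
    ultimately show "continuous_on V k \<and> (\<forall>i. \<exists>k'. (\<exists>H. csmooth U H \<and> depends_below m H \<and> k' = (\<lambda>w. H (G w))) \<and>
        (\<forall>p\<in>V. ((\<lambda>t. k (p(i := t))) has_real_derivative k' p) (at (p i))))" by blast
  qed
  define T where "T = (\<lambda>q. q(c := h q))"
  have TV: "T q \<in> V \<and> G (T q) = q" if q: "q \<in> U" for q
  proof -
    have qB: "q \<in> B0" "lo < q c" "q c < hi" using q UB by auto
    have "T q \<in> V"
      using mono[OF qB(1), of lo "q c"] mono[OF qB(1), of "q c" hi] qB by (simp add: VB T_def B0_upd)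
    moreover have "g (T q) = q c" by (rule g_eq) (use qB in \<open>auto simp: T_def B0_upd\<close>)
    ultimately show ?thesis by (simp add: G_def T_def)
  qed
  have GT: "T (G w) = w" if "w \<in> V" for w
    using g(3)[OF that] by (simp add: T_def G_def)
  have cU: "cylinder m U" by (simp add: U_def cylinder_box)
  have fing: "depends_below m g"
  proof (rule depends_belowI)
    fix q r :: "nat \<Rightarrow> real" assume e: "\<And>i. i < m \<Longrightarrow> q i = r i"
    have "h (q(c := t)) = h (r(c := t))" for t by (rule depends_below_eq[OF assms(4)]) (use e in auto)
    thus "g q = g r" unfolding g_def using e[OF assms(5)] by simp
  qed
  have cV: "cylinder m V" unfolding cylinder_def
  proof (intro allI impI)
    fix q r :: "nat \<Rightarrow> real" assume e: "\<forall>i<m. q i = r i" and q: "q \<in> V"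
    have "h (q(c := t)) = h (r(c := t))" for t by (rule depends_below_eq[OF assms(4)]) (use e in auto)
    moreover have "r \<in> B0" using q e VB by (auto simp: B0_def)
    ultimately show "r \<in> V" using q e assms(5) VB by auto
  qed
  have "csmooth U (\<lambda>q. T q i)" for i
    using csmooth_subset[OF assms(3) UO] csmooth_coord by (cases "i = c") (auto simp: T_def)
  moreover have "csmooth V (\<lambda>w. G w i)" for i
  proof (cases "i < m")
    case True
    show ?thesis by (rule smG[OF csmooth_coord depends_below_coord[OF True]])
  next
    case False
    hence "(\<lambda>w. G w i) = (\<lambda>w. w i)" using assms(5) by (auto simp: G_def)
    thus ?thesis using csmooth_coord by simp
  qed
  moreover have "depends_below m (\<lambda>q. T q i) \<and> depends_below m (\<lambda>w. G w i)" if "i < m" for i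
    using assms(4) fing depends_below_coord[OF that] by (cases "i = c") (auto simp: T_def G_def)
  moreover have "T q i = q i \<and> G q i = q i" if "i \<ge> m" for i q
    using that assms(5) by (auto simp: T_def G_def)
  ultimately have "ldiffeo m U V T G" unfolding ldiffeo_def
    using Uopen V cU cV TV GU GT by (intro conjI) blast+
  moreover have "p \<in> U" unfolding U_def by (rule center_in_box_nbhd[OF \<epsilon>(1)])
  ultimately show ?thesis using UO unfolding T_def
    by (intro exI[of _ U] exI[of _ V] exI[of _ G] conjI)
qed

lemma span_sum_family:
  assumes "finite J" "\<And>j. j \<in> J \<Longrightarrow> a j \<noteq> 0 \<Longrightarrow> v j \<in> fv.span S"
  shows "(\<lambda>c. \<Sum>j\<in>J. a j * v j c) \<in> fv.span S"
  using assms
proof (induction J rule: finite_induct)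
  case empty
  have "(0::nat \<Rightarrow> real) \<in> fv.span S" by (rule fv.span_zero)
  thus ?case by (simp add: zero_fun_def)
next
  case (insert j J)
  have "(\<lambda>c. a j * v j c) \<in> fv.span S"
  proof (cases "a j = 0")
    case True
    have "(0::nat \<Rightarrow> real) \<in> fv.span S" by (rule fv.span_zero)
    thus ?thesis using True by (simp add: zero_fun_def)
  next
    case False
    thus ?thesis using insert.prems by (intro fv.span_scale) auto
  qed
  hence "(\<lambda>c. a j * v j c) + (\<lambda>c. \<Sum>j\<in>J. a j * v j c) \<in> fv.span S"
    using insert by (intro fv.span_add) auto
  thus ?case using insert.hyps by (simp add: plus_fun_def)
qed

text \<open>Steinitz exchange: in a chart already containing the first \<open>k\<close> functions,
  \<open>z k\<close> must vary in a direction not yet used, since otherwise its differential would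
  depend on the previous ones. That coordinate is replaced by \<open>z k\<close>. A permutation
  finally restores the order.\<close>

theorem inverse_function:
  assumes "open \<Omega>" "cylinder m \<Omega>" "p \<in> \<Omega>"
    and z: "\<And>i. i < m \<Longrightarrow> csmooth \<Omega> (z i)" "\<And>i. i < m \<Longrightarrow> depends_below m (z i)"
    and indep: "indep (\<lambda>i. diff_at p (z i)) {..<m}"
  shows "\<exists>U V G. ldiffeo m U V (\<lambda>q i. if i < m then z i q else q i) G \<and> p \<in> U \<and> U \<subseteq> \<Omega>"
proof -
  have "\<exists>\<sigma> U V T G. inj_on \<sigma> {..<k} \<and> \<sigma> ` {..<k} \<subseteq> {..<m} \<and> ldiffeo m U V T G \<and> p \<in> U \<and> U \<subseteq> \<Omega> \<and>
      (\<forall>q\<in>U. \<forall>i<k. T q (\<sigma> i) = z i q)" if "k \<le> m" for k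
    using that
  proof (induction k)
    case 0
    show ?case using ldiffeo_id[OF assms(1,2)] assms(3) by (intro exI[of _ id] exI) auto
  next
    case (Suc k)
    then obtain \<sigma> U V T G where \<sigma>: "inj_on \<sigma> {..<k}" "\<sigma> ` {..<k} \<subseteq> {..<m}" and d: "ldiffeo m U V T G"
      and U: "p \<in> U" "U \<subseteq> \<Omega>" and Tz: "\<And>q i. q \<in> U \<Longrightarrow> i < k \<Longrightarrow> T q (\<sigma> i) = z i q"
      by (metis Suc_leD)
    note D = ldiffeoD[OF d]
    have km: "k < m" using Suc.prems by simp
    define h where "h = (\<lambda>w. z k (G w))"
    have h: "csmooth V h" unfolding h_def
      by (rule csmooth_comp[OF D(2) assms(1) z[OF km] D(10)]) (use D(7) U in blast)
    have fh: "depends_below m h"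
    proof (rule depends_belowI)
      fix q r :: "nat \<Rightarrow> real" assume e: "\<And>i. i < m \<Longrightarrow> q i = r i"
      show "h q = h r" unfolding h_def by (rule depends_below_eq[OF z(2)[OF km]]) (rule ldiffeo_agree(2)[OF d e])
    qed
    have zh: "z k q = h (T q)" if "q \<in> U" for q using D(6)[OF that] by (simp add: h_def)
    have dz: "diff_at p (z k) = (\<lambda>c. \<Sum>j<m. pd j h (T p) * diff_at p (\<lambda>q. T q j) c)"
    proof
      fix c
      have "pd c (z k) p = pd c (\<lambda>q. h (T q)) p" by (rule pd_cong[OF D(1) U(1) zh])
      also have "\<dots> = (\<Sum>j<m. pd j h (T p) * pd c (\<lambda>q. T q j) p)"
        by (rule pd_comp[OF D(1,2) h fh D(9) U(1) D(5)[OF U(1)]])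
      finally show "diff_at p (z k) c = (\<Sum>j<m. pd j h (T p) * diff_at p (\<lambda>q. T q j) c)" by (simp add: diff_at_def)
    qed
    have "\<exists>j<m. j \<notin> \<sigma> ` {..<k} \<and> pd j h (T p) \<noteq> 0"
    proof (rule ccontr)
      assume no: "\<not> ?thesis"
      have "diff_at p (z k) \<in> fv.span ((\<lambda>i. diff_at p (z i)) ` {..<k})" unfolding dz
      proof (rule span_sum_family)
        fix j assume "j \<in> {..<m}" "pd j h (T p) \<noteq> 0"
        then obtain i where i: "i < k" "j = \<sigma> i" using no by auto
        have "diff_at p (\<lambda>q. T q j) = diff_at p (z i)" unfolding diff_at_def
          by (intro ext pd_cong[OF D(1) U(1)]) (use Tz i in simp)
        thus "diff_at p (\<lambda>q. T q j) \<in> fv.span ((\<lambda>i. diff_at p (z i)) ` {..<k})"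
          using i by (auto intro: fv.span_base)
      qed simp
      moreover have "diff_at p (z k) \<notin> fv.span ((\<lambda>i. diff_at p (z i)) ` {..<k})"
        by (rule indep_notin'[OF indep]) (use km in auto)
      ultimately show False by blast
    qed
    then obtain j where j: "j < m" "j \<notin> \<sigma> ` {..<k}" "pd j h (T p) \<noteq> 0" by blast
    obtain U' V' G' where e: "ldiffeo m U' V' (\<lambda>q. q(j := h q)) G'" "T p \<in> U'" "U' \<subseteq> V"
      using exchange[OF D(2,4) h fh j(1) D(5)[OF U(1)] j(3)] by blast
    have "ldiffeo m {q \<in> U. T q \<in> U'} {w \<in> V'. G' w \<in> V} (\<lambda>q. (T q)(j := h (T q))) (\<lambda>w. G (G' w))"
      by (rule ldiffeo_compose[OF d e(1)])
    moreover have "inj_on (\<sigma>(k := j)) {..<Suc k}" using \<sigma>(1) j(2) by (auto simp: inj_on_def lessThan_Suc)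
    moreover have "(\<sigma>(k := j)) ` {..<Suc k} \<subseteq> {..<m}" using \<sigma>(2) j(1) by (auto simp: lessThan_Suc)
    moreover have "((T q)(j := h (T q))) ((\<sigma>(k := j)) i) = z i q" if "q \<in> U" "i < Suc k" for q i
    proof (cases "i = k")
      case True
      thus ?thesis using zh[OF that(1)] by simp
    next
      case False
      hence "i < k" using that by simp
      moreover have "\<sigma> i \<noteq> j" using j(2) \<open>i < k\<close> by blast
      ultimately show ?thesis using False Tz[OF that(1)] by simp
    qed
    ultimately show ?case using U e(2) by (intro exI[of _ "\<sigma>(k := j)"] exI conjI) (assumption | auto)+
  qed
  then obtain \<sigma> U V T G where \<sigma>: "inj_on \<sigma> {..<m}" "\<sigma> ` {..<m} \<subseteq> {..<m}" and d: "ldiffeo m U V T G"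
    and U: "p \<in> U" "U \<subseteq> \<Omega>" and Tz: "\<And>q i. q \<in> U \<Longrightarrow> i < m \<Longrightarrow> T q (\<sigma> i) = z i q"
    by (metis order_refl)
  have "bij_betw \<sigma> {..<m} {..<m}"
    using \<sigma> by (simp add: bij_betw_def endo_inj_surj)
  from ldiffeo_compose[OF d ldiffeo_permute[OF this]]
  obtain V' G' where d': "ldiffeo m U V' (\<lambda>q i. if i < m then T q (\<sigma> i) else T q i) G'" by auto
  note D = ldiffeoD[OF d']
  let ?Z = "\<lambda>q i. if i < m then z i q else q i"
  have eq: "(\<lambda>i. if i < m then T q (\<sigma> i) else T q i) = ?Z q" if "q \<in> U" for q
    using Tz[OF that] ldiffeoD(13)[OF d] by auto
  have "csmooth U (\<lambda>q. ?Z q i)" for i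
    using csmooth_subset[OF z(1) U(2)] csmooth_coord by (cases "i < m") auto
  moreover have "depends_below m (\<lambda>q. ?Z q i)" if "i < m" for i using z(2) that by simp
  ultimately have "ldiffeo m U V' ?Z G'"
    using D(1-4) D(5-8) D(10,12,14) eq unfolding ldiffeo_def by simp
  thus ?thesis using U by blast
qed

section \<open>Charts, jets and total derivatives\<close>

lemma tr_in_Rsp: "tr m q \<in> Rsp m" by (simp add: tr_def Rsp_def)

lemma tr_Rsp: "y \<in> Rsp m \<Longrightarrow> tr m y = y"
  by (auto simp: tr_def Rsp_def fun_eq_iff not_less)

lemma tr_upd: "i < m \<Longrightarrow> tr m (q(i := t)) = (tr m q)(i := t)"
  by (auto simp: tr_def)

lemma open_tr_vimage:
  assumes "open T"
  shows "open {q. tr m q \<in> T}"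
proof -
  have "csmooth UNIV (\<lambda>q. tr m q i)" for i
    using csmooth_coord csmooth_const by (cases "i < m") (auto simp: tr_def)
  from open_preimage[OF open_UNIV this assms] show ?thesis by simp
qed

text \<open>The bridge between relatively open subsets of \<open>Rsp m\<close> and open cylinders,
  where the calculus of jet space applies.\<close>

lemma ropen_iff: "ropen m U \<longleftrightarrow> U \<subseteq> Rsp m \<and> open {q. tr m q \<in> U}"
proof
  assume U: "ropen m U"
  then obtain T where T: "open T" "U = Rsp m \<inter> T"
    unfolding ropen_def openin_open by blast
  have "{q. tr m q \<in> U} = {q. tr m q \<in> T}" using T(2) tr_in_Rsp by auto
  thus "U \<subseteq> Rsp m \<and> open {q. tr m q \<in> U}" using open_tr_vimage[OF T(1)] T(2) by auto
next
  assume U: "U \<subseteq> Rsp m \<and> open {q. tr m q \<in> U}"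
  hence "U = Rsp m \<inter> {q. tr m q \<in> U}" using tr_Rsp by auto
  thus "ropen m U" using U unfolding ropen_def openin_open by blast
qed

lemma ropen_cylinder:
  assumes "open U" "cylinder m U"
  shows "ropen m (Rsp m \<inter> U)"
proof -
  have "tr m q \<in> U \<longleftrightarrow> q \<in> U" for q
    using assms(2) unfolding cylinder_def by (metis tr_def)
  hence "{q. tr m q \<in> Rsp m \<inter> U} = U" using tr_in_Rsp by auto
  thus ?thesis using assms(1) by (simp add: ropen_iff)
qed

lemma depends_below_tr: "n \<le> m \<Longrightarrow> depends_below m (\<lambda>p. h (tr n p))"
proof (rule depends_belowI)
  fix p q :: "nat \<Rightarrow> real" assume "n \<le> m" "\<And>i. i < m \<Longrightarrow> p i = q i"
  hence "tr n p = tr n q" by (auto simp: tr_def)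
  thus "h (tr n p) = h (tr n q)" by simp
qed

text \<open>Truncation commutes with derivatives below \<open>m\<close> and makes all others vanish,
  hence the two alternatives.\<close>

lemma ipd_tr:
  "set is \<subseteq> {..<m} \<and> ipd is (\<lambda>q. h (tr m q)) = (\<lambda>q. ipd is h (tr m q))
     \<or> ipd is (\<lambda>q. h (tr m q)) = (\<lambda>q. 0)"
proof (induction "is")
  case (Cons i "is")
  have 0: "pd i (\<lambda>q. 0) = (\<lambda>q. 0)" by (rule ext) (rule pd_const)
  from Cons show ?case
  proof (elim disjE conjE)
    assume e: "ipd is (\<lambda>q. h (tr m q)) = (\<lambda>q. ipd is h (tr m q))" and s: "set is \<subseteq> {..<m}"
    show ?thesis
    proof (cases "i < m")
      case True
      have "pd i (\<lambda>q. ipd is h (tr m q)) = (\<lambda>q. pd i (ipd is h) (tr m q))"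
      proof
        fix q
        have "(tr m q) i = q i" using True by (simp add: tr_def)
        thus "pd i (\<lambda>q. ipd is h (tr m q)) q = pd i (ipd is h) (tr m q)"
          unfolding pd_def tr_upd[OF True] by simp
      qed
      thus ?thesis using e s True by simp
    next
      case False
      have "depends_below m (\<lambda>q. ipd is h (tr m q))" by (rule depends_below_tr) simp
      hence "pd i (\<lambda>q. ipd is h (tr m q)) = (\<lambda>q. 0)" using depends_below_pd_zero False by (auto simp: fun_eq_iff)
      thus ?thesis using e by simp
    qed
  next
    assume "ipd is (\<lambda>q. h (tr m q)) = (\<lambda>q. 0)"
    thus ?thesis using 0 by simp
  qed
qed simp

lemma smooth_fun_imp_csmooth:
  assumes "smooth_fun m U h"
  shows "csmooth {q. tr m q \<in> U} (\<lambda>q. h (tr m q))"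
  unfolding csmooth_def
proof (intro allI conjI ballI)
  fix "is"
  let ?h = "\<lambda>q. h (tr m q)"
  have ctr: "continuous_on {q. tr m q \<in> U} (tr m)"
  proof (rule continuous_on_coordinatewise_then_product)
    fix i show "continuous_on {q. tr m q \<in> U} (\<lambda>q. tr m q i)"
      using continuous_on_coord by (cases "i < m") (auto simp: tr_def)
  qed
  show "continuous_on {q. tr m q \<in> U} (ipd is ?h)"
    using ipd_tr[of "is" m h]
  proof (elim disjE conjE)
    assume e: "ipd is ?h = (\<lambda>q. ipd is h (tr m q))" and s: "set is \<subseteq> {..<m}"
    have "continuous_on U (ipd is h)" using assms s by (simp add: smooth_fun_def)
    thus ?thesis unfolding e by (rule continuous_on_compose2[OF _ ctr]) auto
  next
    assume "ipd is ?h = (\<lambda>q. 0)"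
    thus ?thesis by simp
  qed
  fix p i assume p: "p \<in> {q. tr m q \<in> U}"
  show "(\<lambda>t. ipd is ?h (p(i := t))) differentiable at (p i)"
    using ipd_tr[of "is" m h]
  proof (elim disjE conjE)
    assume e: "ipd is ?h = (\<lambda>q. ipd is h (tr m q))" and s: "set is \<subseteq> {..<m}"
    show ?thesis
    proof (cases "i < m")
      case True
      have "(\<lambda>t. ipd is h ((tr m p)(i := t))) differentiable at ((tr m p) i)"
        using assms s p True by (auto simp: smooth_fun_def simp del: fun_upd_apply)
      moreover have "(tr m p) i = p i" using True by (simp add: tr_def)
      ultimately show ?thesis unfolding e tr_upd[OF True] by simp
    next
      case False
      have "tr m (p(i := t)) = tr m p" for t using False by (auto simp: tr_def)
      thus ?thesis unfolding e by simp
    qed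
  next
    assume "ipd is ?h = (\<lambda>q. 0)"
    thus ?thesis by simp
  qed
qed

lemma smooth_fun_imp_fsmooth:
  assumes "smooth_fun m U h" "\<And>q. q \<in> Om \<Longrightarrow> tr m q \<in> U"
  shows "fsmooth Om (\<lambda>q. h (tr m q))"
proof -
  have "depends_below m (\<lambda>q. h (tr m q))" by (rule depends_below_tr) simp
  thus ?thesis using csmooth_subset[OF smooth_fun_imp_csmooth[OF assms(1)], of Om] assms(2)
    unfolding fsmooth_def by blast
qed

text \<open>\<open>Rsp m\<close> has empty interior in jet space, but lines in the directions below
  \<open>m\<close> stay inside it, and \<open>smooth_fun\<close> differentiates along these
  only.\<close>

lemma smooth_fun_congI:
  assumes U: "ropen m U" and "csmooth U' k" "U \<subseteq> U'" and e: "\<And>y. y \<in> U \<Longrightarrow> h y = k y"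
  shows "smooth_fun m U h"
proof -
  have opn: "open {t. y(i := t) \<in> U}" if "i < m" "y \<in> U" for y i
  proof -
    have "{t. y(i := t) \<in> U} = {t. y(i := t) \<in> {q. tr m q \<in> U}}"
    proof -
      have "y(i := t) \<in> Rsp m" for t using that U by (auto simp: ropen_def Rsp_def)
      thus ?thesis using tr_Rsp by auto
    qed
    thus ?thesis using open_upd_vimage[of "{q. tr m q \<in> U}" y i] U by (simp add: ropen_iff)
  qed
  have eq: "set is \<subseteq> {..<m} \<Longrightarrow> y \<in> U \<Longrightarrow> ipd is h y = ipd is k y" for "is" y
  proof (induction "is" arbitrary: y)
    case (Cons i "is")
    have i: "i < m" using Cons.prems by simp
    have "\<forall>\<^sub>F t in nhds (y i). y(i := t) \<in> U"
      using opn[OF i Cons.prems(2)] Cons.prems(2) by (subst eventually_nhds) (rule exI[of _ "{t. y(i := t) \<in> U}"], simp)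
    hence "\<forall>\<^sub>F t in nhds (y i). ipd is h (y(i := t)) = ipd is k (y(i := t))"
      by eventually_elim (use Cons in auto)
    thus ?case by (simp add: pd_def deriv_cong_ev)
  qed (use e in simp)
  show ?thesis unfolding smooth_fun_def
  proof (intro conjI allI impI ballI U)
    fix "is" assume s: "set is \<subseteq> {..<m}"
    have "continuous_on U (ipd is k)" using assms(2,3) unfolding csmooth_def by (meson continuous_on_subset)
    thus "continuous_on U (ipd is h)" using eq[OF s] by (metis (no_types, lifting) continuous_on_cong)
    fix y i assume y: "y \<in> U" "i < m"
    have "(\<lambda>t. ipd is k (y(i := t))) differentiable at (y i)" using assms(2,3) y unfolding csmooth_def by blast
    then obtain d where "((\<lambda>t. ipd is k (y(i := t))) has_real_derivative d) (at (y i))"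
      unfolding real_differentiable_def by blast
    hence "((\<lambda>t. ipd is h (y(i := t))) has_real_derivative d) (at (y i))"
      by (rule has_field_derivative_transform_within_open[OF _ opn[OF y(2,1)]]) (use y eq[OF s] in auto)
    thus "(\<lambda>t. ipd is h (y(i := t))) differentiable at (y i)" unfolding real_differentiable_def by blast
  qed
qed

text \<open>Both maps depend below \<open>m\<close> on coordinates below \<open>m\<close> only, so
  restricting to \<open>Rsp m\<close> and truncating the inverse changes nothing there.\<close>

lemma diffeo_of_ldiffeo:
  assumes d: "ldiffeo m U V T G"
    and e: "\<And>y i. y \<in> Rsp m \<Longrightarrow> y \<in> U \<Longrightarrow> i < m \<Longrightarrow> \<Theta> y i = T y i"
    and z: "\<And>y i. i \<ge> m \<Longrightarrow> \<Theta> y i = 0"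
  shows "diffeo m (Rsp m \<inter> U) (Rsp m \<inter> V) \<Theta>"
proof -
  note D = ldiffeoD[OF d]
  have in_Rsp: "\<Theta> y \<in> Rsp m" for y using z by (simp add: Rsp_def)
  have lft: "tr m (G (\<Theta> y)) = y" if y: "y \<in> Rsp m" "y \<in> U" for y
  proof
    fix i
    show "tr m (G (\<Theta> y)) i = y i"
    proof (cases "i < m")
      case True
      have "G (\<Theta> y) i = G (T y) i" by (rule ldiffeo_agree(2)[OF d e[OF y] True])
      thus ?thesis using True D(6)[OF y(2)] by (simp add: tr_def)
    next
      case False
      thus ?thesis using y by (simp add: tr_def Rsp_def)
    qed
  qed
  have mapsto: "\<Theta> y \<in> V" if y: "y \<in> Rsp m" "y \<in> U" for y
    by (rule cylinderD[OF D(4) D(5)[OF y(2)]]) (use e[OF y] in simp)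
  have bck: "tr m (G w) \<in> U" if "w \<in> V" for w
    by (rule cylinderD[OF D(3) D(7)[OF that]]) (simp add: tr_def)
  have rgt: "\<Theta> (tr m (G w)) = w" if w: "w \<in> Rsp m" "w \<in> V" for w
  proof
    fix i
    show "\<Theta> (tr m (G w)) i = w i"
    proof (cases "i < m")
      case True
      have "\<Theta> (tr m (G w)) i = T (tr m (G w)) i" by (rule e[OF tr_in_Rsp bck[OF w(2)] True])
      also have "\<dots> = T (G w) i" by (rule ldiffeo_agree(1)[OF d _ True]) (simp add: tr_def)
      finally show ?thesis using D(8)[OF w(2)] by simp
    next
      case False
      thus ?thesis using z w by (simp add: Rsp_def)
    qed
  qed
  have bij: "bij_betw \<Theta> (Rsp m \<inter> U) (Rsp m \<inter> V)"
    by (rule bij_betw_byWitness[where f' = "\<lambda>w. tr m (G w)"])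
       (use lft rgt mapsto bck in_Rsp tr_in_Rsp in auto)
  have inv: "the_inv_into (Rsp m \<inter> U) \<Theta> w = tr m (G w)" if "w \<in> Rsp m \<inter> V" for w
    by (rule the_inv_into_f_eq) (use bij rgt bck tr_in_Rsp that in \<open>auto simp: bij_betw_def\<close>)
  have rU: "ropen m (Rsp m \<inter> U)" and rV: "ropen m (Rsp m \<inter> V)" using ropen_cylinder D by blast+
  have "smooth_fun m (Rsp m \<inter> U) (\<lambda>y. \<Theta> y i)" if "i < m" for i
    by (rule smooth_fun_congI[OF rU D(9)[of i]]) (use e that in auto)
  moreover have "smooth_fun m (Rsp m \<inter> V) (\<lambda>w. the_inv_into (Rsp m \<inter> U) \<Theta> w i)" if "i < m" for i
    by (rule smooth_fun_congI[OF rV D(10)[of i]]) (use inv that in \<open>auto simp: tr_def\<close>)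
  ultimately show ?thesis unfolding diffeo_def using rU rV bij by blast
qed

lemma ldiffeo_restrict_codomain:
  assumes "ldiffeo m U V T G" "open V'" "cylinder m V'" "V' \<subseteq> V"
  shows "ldiffeo m {q \<in> U. T q \<in> V'} V' T G"
proof -
  have "{w \<in> V'. w \<in> V} = V'" using assms(4) by blast
  thus ?thesis using ldiffeo_compose[OF assms(1) ldiffeo_id[OF assms(2,3)]] by simp
qed

lemma ldiffeo_restrict_domain:
  assumes "ldiffeo m U V T G" "open U'" "cylinder m U'" "U' \<subseteq> U"
  shows "ldiffeo m U' {w \<in> V. G w \<in> U'} T G"
proof -
  have "{q \<in> U'. q \<in> U} = U'" using assms(4) by blast
  thus ?thesis using ldiffeo_compose[OF ldiffeo_id[OF assms(2,3)] assms(1)] by simp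
qed

text \<open>One walks from \<open>q\<close> to \<open>r\<close> one coordinate at a time. In a box
  all intermediate points stay inside, unlike in a general connected open set; finite order of
  \<open>h\<close> makes finitely many steps enough.\<close>

lemma constant_on_box:
  assumes "csmooth (box_nbhd p M \<delta>) h" "depends_below k h"
    and z: "\<And>q c. q \<in> box_nbhd p M \<delta> \<Longrightarrow> c \<ge> m \<Longrightarrow> pd c h q = 0"
    and q: "q \<in> box_nbhd p M \<delta>" and r: "r \<in> box_nbhd p M \<delta>" and e: "\<And>i. i < m \<Longrightarrow> q i = r i"
  shows "h q = h r"
proof -
  define mix where "mix = (\<lambda>j i. if i < j then r i else q i)"
  have "h (mix (m + j)) = h q" for j
  proof (induction j)
    case 0
    have "mix (m + 0) = q" using e by (auto simp: mix_def)
    thus ?case by simp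
  next
    case (Suc j)
    let ?c = "m + j"
    have up: "(mix ?c)(?c := r ?c) = mix (m + Suc j)" by (auto simp: mix_def less_Suc_eq)
    have "(mix ?c)(?c := t) \<in> box_nbhd p M \<delta>" if "t \<in> closed_segment (mix ?c ?c) (r ?c)" for t
    proof -
      have "\<bar>t - p ?c\<bar> < \<delta>" if "?c < M"
      proof -
        have "\<bar>q ?c - p ?c\<bar> < \<delta>" "\<bar>r ?c - p ?c\<bar> < \<delta>" using q r that by (auto simp: box_nbhd_def)
        thus ?thesis using \<open>t \<in> _\<close> by (auto simp: mix_def closed_segment_eq_real_ivl split: if_splits)
      qed
      thus ?thesis using q r by (auto simp: box_nbhd_def mix_def)
    qed
    from pd_MVT[OF assms(1) this] obtain \<xi> where "\<xi> \<in> closed_segment (mix ?c ?c) (r ?c)"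
      "h ((mix ?c)(?c := r ?c)) - h (mix ?c) = pd ?c h ((mix ?c)(?c := \<xi>)) * (r ?c - mix ?c ?c)"
      "(mix ?c)(?c := \<xi>) \<in> box_nbhd p M \<delta>"
      by (metis \<open>\<And>t. t \<in> closed_segment (mix (m + j) (m + j)) (r (m + j)) \<Longrightarrow> (mix (m + j))(m + j := t) \<in> box_nbhd p M \<delta>\<close>)
    thus ?case using z[of _ ?c] up Suc by simp
  qed
  moreover have "h (mix (m + k)) = h r" by (rule depends_below_eq[OF assms(2)]) (simp add: mix_def)
  ultimately show ?thesis by metis
qed

text \<open>The total derivative as one vector field on jet space, of which \<open>tder\<close> is
  the restriction to functions of a given order.\<close>

definition jetW :: "nat \<Rightarrow> (nat \<Rightarrow> (nat \<Rightarrow> real) \<Rightarrow> real) \<Rightarrow> (nat \<Rightarrow> (nat \<Rightarrow> real) \<Rightarrow> real)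
    \<Rightarrow> (nat \<Rightarrow> (nat \<Rightarrow> real) \<Rightarrow> real) \<Rightarrow> nat \<Rightarrow> (nat \<Rightarrow> real) \<Rightarrow> real" where
  "jetW n f g1 g2 c = (if c < n then (\<lambda>p. f c (tr n p) + g1 c (tr n p) * p n + g2 c (tr n p) * p (Suc n))
                       else (\<lambda>p. p (c + 2)))"

lemma tder_eq:
  assumes "n \<le> m"
  shows "tder n f g1 g2 m h p = (\<Sum>c<m. jetW n f g1 g2 c p * pd c h (tr m p))"
proof -
  have "(\<Sum>c<m. jetW n f g1 g2 c p * pd c h (tr m p)) =
     (\<Sum>c<n. jetW n f g1 g2 c p * pd c h (tr m p)) + (\<Sum>c\<in>{n..<m}. jetW n f g1 g2 c p * pd c h (tr m p))"
    using sum.atLeastLessThan_concat[of 0 n m "\<lambda>c. jetW n f g1 g2 c p * pd c h (tr m p)"] assms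
    by (simp add: atLeast0LessThan)
  thus ?thesis by (simp add: tder_def jetW_def)
qed

lemma depends_below_jetW: "c < m \<Longrightarrow> n \<le> m \<Longrightarrow> depends_below (m + 2) (jetW n f g1 g2 c)"
proof -
  assume *: "c < m" "n \<le> m"
  have 1: "tr n (tr (m + 2) p) = tr n p" for p using * by (auto simp: tr_def)
  show ?thesis using * 1 by (auto simp: jetW_def depends_below_def) (auto simp: tr_def)
qed

lemma depends_below_jder: "depends_below (n + 2 * k) (jder n f g1 g2 k h)"
proof (induction k)
  case 0
  show ?case using depends_below_tr[of n n h] by simp
next
  case (Suc k)
  have "depends_below (n + 2 * Suc k) (\<lambda>p. \<Sum>c<n + 2 * k. jetW n f g1 g2 c p * pd c (jder n f g1 g2 k h) (tr (n + 2 * k) p))"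
  proof (rule depends_belowI)
    fix p q :: "nat \<Rightarrow> real" assume e: "\<And>i. i < n + 2 * Suc k \<Longrightarrow> p i = q i"
    have t: "tr (n + 2 * k) p = tr (n + 2 * k) q" using e by (auto simp: tr_def)
    have w: "jetW n f g1 g2 c p = jetW n f g1 g2 c q" if "c < n + 2 * k" for c
      by (rule depends_below_eq[OF depends_below_jetW[OF that]]) (use e in auto)
    show "(\<Sum>c<n + 2 * k. jetW n f g1 g2 c p * pd c (jder n f g1 g2 k h) (tr (n + 2 * k) p)) =
          (\<Sum>c<n + 2 * k. jetW n f g1 g2 c q * pd c (jder n f g1 g2 k h) (tr (n + 2 * k) q))"
      by (rule sum.cong) (use t w in auto)
  qed
  moreover have "jder n f g1 g2 (Suc k) h =
      (\<lambda>p. \<Sum>c<n + 2 * k. jetW n f g1 g2 c p * pd c (jder n f g1 g2 k h) (tr (n + 2 * k) p))"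
    by (rule ext) (simp add: tder_eq)
  ultimately show ?case by simp
qed

lemma jder_Suc: "jder n f g1 g2 (Suc k) h = total_deriv (jetW n f g1 g2) (jder n f g1 g2 k h)"
proof
  fix p
  have "pd c (jder n f g1 g2 k h) (tr (n + 2 * k) p) = pd c (jder n f g1 g2 k h) p" for c
    using depends_below_pd[OF depends_below_jder] by (simp add: depends_below_def)
  thus "jder n f g1 g2 (Suc k) h p = total_deriv (jetW n f g1 g2) (jder n f g1 g2 k h) p"
    by (simp add: tder_eq total_deriv_eq[OF depends_below_jder])
qed

text \<open>Differentiating the identity \<open>p i = F (Y p)\<close> by the chain rule.\<close>

lemma composite_span:
  assumes "open Om" "smooth_fun m V F" "\<And>k. k < m \<Longrightarrow> csmooth Om (\<lambda>p. Y p k)"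
    and Y: "\<And>p. p \<in> Om \<Longrightarrow> Y p \<in> V" and e: "\<And>p. p \<in> Om \<Longrightarrow> p i = F (Y p)" and p: "p \<in> Om"
  shows "covec i \<in> fv.span ((\<lambda>k. diff_at p (\<lambda>p. Y p k)) ` {..<m})"
proof -
  have V: "ropen m V" using assms(2) by (simp add: smooth_fun_def)
  have VR: "V \<subseteq> Rsp m" using V by (simp add: ropen_def)
  have oV: "open {q. tr m q \<in> V}" using V by (simp add: ropen_iff)
  have trY: "tr m (Y p) = Y p" if "p \<in> Om" for p using tr_Rsp Y[OF that] VR by blast
  have "covec i = (\<lambda>c. \<Sum>j<m. pd j (\<lambda>q. F (tr m q)) (Y p) * diff_at p (\<lambda>p. Y p j) c)"
  proof
    fix c
    have "covec i c = pd c (\<lambda>q. q i) p" by (simp add: pd_coord covec_def)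
    also have "\<dots> = pd c (\<lambda>q. F (tr m (Y q))) p"
      by (rule pd_cong[OF assms(1) p]) (use e trY in simp)
    also have "\<dots> = (\<Sum>j<m. pd j (\<lambda>q. F (tr m q)) (Y p) * pd c (\<lambda>p. Y p j) p)"
      by (rule pd_comp[OF assms(1) oV smooth_fun_imp_csmooth[OF assms(2)] depends_below_tr[OF order_refl] assms(3) p])
         (use Y[OF p] trY[OF p] in auto)
    finally show "covec i c = (\<Sum>j<m. pd j (\<lambda>q. F (tr m q)) (Y p) * diff_at p (\<lambda>p. Y p j) c)" by (simp add: diff_at_def)
  qed
  moreover have "\<dots> \<in> fv.span ((\<lambda>k. diff_at p (\<lambda>p. Y p k)) ` {..<m})"
    by (rule span_sum_family) (auto intro: fv.span_base)
  ultimately show ?thesis by simp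
qed

text \<open>Uniqueness of coefficients. Applied to differentials in a chart, it turns membership in
  a span into the vanishing of partial derivatives.\<close>

lemma coefficient_zero:
  fixes N r j :: nat
  assumes "indep v {..<N}" "x = (\<lambda>c. \<Sum>j<N. a j * v j c)" "x \<in> fv.span (v ` {..<r})" "r \<le> j" "j < N"
  shows "a j = 0"
proof (rule ccontr)
  assume ne: "a j \<noteq> 0"
  let ?S = "v ` ({..<N} - {j})"
  have "v ` {..<r} \<subseteq> ?S" by (rule image_mono) (use assms(4,5) in auto)
  hence "v ` {..<r} \<subseteq> fv.span ?S" using fv.span_superset by blast
  hence x: "x \<in> fv.span ?S" using assms(3) span_subset_span by blast
  have y: "(\<lambda>c. \<Sum>i\<in>{..<N} - {j}. a i * v i c) \<in> fv.span ?S"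
    by (rule span_sum_family) (auto intro: fv.span_base)
  have "(\<lambda>c. (\<Sum>i\<in>{..<N} - {j}. a i * v i c) - (- a j) * v j c) = x"
    unfolding assms(2) using assms(5) by (auto simp: sum.remove[of "{..<N}" j])
  hence "(\<lambda>c. (\<Sum>i\<in>{..<N} - {j}. a i * v i c) - (- a j) * v j c) \<in> fv.span ?S" using x by simp
  from span_lincombD2[OF this y] ne have "v j \<in> fv.span ?S" by simp
  thus False using indep_notin[OF assms(1), of j] assms(5) by simp
qed

lemma coefficient_nonzero:
  fixes N r :: nat
  assumes "indep v {..<N}" "x = (\<lambda>c. \<Sum>j<N. a j * v j c)" "x \<in> fv.span (v ` {..<Suc r})"
    "x \<notin> fv.span (v ` {..<r})"
  shows "a r \<noteq> 0"
proof
  assume "a r = 0"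
  have "x \<in> fv.span (v ` {..<r})" unfolding assms(2)
  proof (rule span_sum_family)
    fix j assume j: "j \<in> {..<N}" "a j \<noteq> 0"
    hence "\<not> Suc r \<le> j" using coefficient_zero[OF assms(1-3), of j] by auto
    hence "j < r" using j \<open>a r = 0\<close> by (cases "j = r") auto
    thus "v j \<in> fv.span (v ` {..<r})" by (intro fv.span_base) auto
  qed simp
  thus False using assms(4) by blast
qed

section \<open>The triangular form at a generic point\<close>

lemma indep_cong: "(\<And>i. i \<in> I \<Longrightarrow> v i = w i) \<Longrightarrow> indep v I \<longleftrightarrow> indep w I"
  unfolding indep_def by (metis image_cong inj_on_cong)

text \<open>All points of the box share the same integers, so one list of functions serves them all.
  The box shape ensures that a function with vanishing partial derivatives from some index on is
  determined by the coordinates below it.\<close>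

locale gtf_chart = flat_jets n W Om \<psi> \<zeta> r1 r2
  for n W Om \<psi> \<zeta> r1 r2 +
  fixes f g1 g2 :: "nat \<Rightarrow> (nat \<Rightarrow> real) \<Rightarrow> real" and \<phi>1 \<phi>2 :: "(nat \<Rightarrow> real) \<Rightarrow> real"
    and p :: "nat \<Rightarrow> real" and M :: nat and \<delta> :: real and \<kappa> c0 c1 K \<kappa>2 :: nat
  assumes W_eq: "W = jetW n f g1 g2"
    and \<psi>_0: "\<psi> 0 = (\<lambda>q. \<phi>1 (tr n q))" and \<zeta>_0: "\<zeta> 0 = (\<lambda>q. \<phi>2 (tr n q))"
    and \<delta>: "\<delta> > 0" and M_ge: "M \<ge> n + 2 * flat_point.s K \<kappa>2 + 2"
    and box: "box_nbhd p M \<delta> \<subseteq> Om"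
    and fp: "\<And>q. q \<in> box_nbhd p M \<delta> \<Longrightarrow>
       flat_point n \<kappa> c0 c1 (\<lambda>k. diff_at q (\<psi> k)) (\<lambda>k. diff_at q (\<zeta> k)) K \<kappa>2 r1 r2"
begin

abbreviation \<Omega> where "\<Omega> \<equiv> box_nbhd p M \<delta>"
abbreviation \<nu> where "\<nu> \<equiv> flat_point.s K \<kappa>2"
abbreviation N where "N \<equiv> n + 2 * \<nu>"

definition z :: "nat \<Rightarrow> (nat \<Rightarrow> real) \<Rightarrow> real" where
  "z i = (case flat_point.\<iota> n \<kappa> K \<kappa>2 i of Inl k \<Rightarrow> \<psi> k | Inr (Inl k) \<Rightarrow> \<zeta> k | Inr (Inr j) \<Rightarrow> coord (c1 + 2 * j))"

lemma open_\<Omega>: "open \<Omega>" by (rule open_box_nbhd)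
lemma p_in: "p \<in> \<Omega>" by (rule center_in_box_nbhd[OF \<delta>])

lemma dims: "n = \<kappa> + K" "\<kappa> \<ge> 1" "K \<ge> 1" "\<kappa>2 + \<nu> = K" "c1 \<ge> n" "c1 < n + 2" "c0 \<ge> n" "c0 < n + 2" "\<nu> + n \<le> r1 + r2"
proof -
  interpret flat_point n \<kappa> c0 c1 "\<lambda>k. diff_at p (\<psi> k)" "\<lambda>k. diff_at p (\<zeta> k)" K \<kappa>2 r1 r2 by (rule fp[OF p_in])
  show "n = \<kappa> + K" "\<kappa> \<ge> 1" "K \<ge> 1" "\<kappa>2 + \<nu> = K" "c1 \<ge> n" "c1 < n + 2" "c0 \<ge> n" "c0 < n + 2" "\<nu> + n \<le> r1 + r2"
    using count \<kappa>_pos K_pos \<kappa>2_s c1_ge c1_lt c0_ge c0_lt s_bound by auto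
qed

lemma z_eq:
  "i < \<kappa> + \<nu> \<Longrightarrow> z i = \<psi> i"
  "\<kappa> + \<nu> \<le> i \<Longrightarrow> i < n + \<nu> \<Longrightarrow> z i = \<zeta> (i - (\<kappa> + \<nu>))"
  "n + \<nu> \<le> i \<Longrightarrow> i < N \<Longrightarrow> z i = coord (c1 + 2 * (i - (n + \<nu>)))"
  "z N = \<psi> (\<kappa> + \<nu>)"
  "z (Suc N) = (if \<nu> = 0 then \<zeta> K else coord (c1 + 2 * \<nu>))"
proof -
  interpret flat_point n \<kappa> c0 c1 "\<lambda>k. diff_at p (\<psi> k)" "\<lambda>k. diff_at p (\<zeta> k)" K \<kappa>2 r1 r2 by (rule fp[OF p_in])
  have "\<kappa> \<le> n" using dims(1) by simp
  thus "i < \<kappa> + \<nu> \<Longrightarrow> z i = \<psi> i"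
    "\<kappa> + \<nu> \<le> i \<Longrightarrow> i < n + \<nu> \<Longrightarrow> z i = \<zeta> (i - (\<kappa> + \<nu>))"
    "n + \<nu> \<le> i \<Longrightarrow> i < N \<Longrightarrow> z i = coord (c1 + 2 * (i - (n + \<nu>)))"
    "z N = \<psi> (\<kappa> + \<nu>)"
    "z (Suc N) = (if \<nu> = 0 then \<zeta> K else coord (c1 + 2 * \<nu>))"
    by (auto simp: z_def \<iota>_def)
qed

lemma z_fsmooth: "fsmooth Om (z i)"
  unfolding z_def using \<psi>_fsmooth \<zeta>_fsmooth fsmooth_coord by (auto split: sum.split)

lemma indep_z: "q \<in> \<Omega> \<Longrightarrow> indep (\<lambda>i. diff_at q (z i)) {..<N + 2}"
proof -
  assume "q \<in> \<Omega>"
  then interpret flat_point n \<kappa> c0 c1 "\<lambda>k. diff_at q (\<psi> k)" "\<lambda>k. diff_at q (\<zeta> k)" K \<kappa>2 r1 r2 by (rule fp)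
  have "(\<lambda>i. diff_at q (z i)) = F \<circ> \<iota>"
    by (auto simp: z_def F_def diff_at_coord fun_eq_iff split: sum.split)
  thus ?thesis using indep_chart by simp
qed

text \<open>The first N functions contain inputs only to orders below \<nu>, which makes them
  functions on the prolonged state space.\<close>

lemma z_supp: "q \<in> \<Omega> \<Longrightarrow> i < N \<Longrightarrow> c \<ge> N \<Longrightarrow> pd c (z i) q = 0"
proof -
  assume q: "q \<in> \<Omega>" and i: "i < N" and c: "c \<ge> N"
  interpret flat_point n \<kappa> c0 c1 "\<lambda>k. diff_at q (\<psi> k)" "\<lambda>k. diff_at q (\<zeta> k)" K \<kappa>2 r1 r2 by (rule fp[OF q])
  consider "i < \<kappa>" | "\<kappa> \<le> i" "i < \<kappa> + \<nu>" | "\<kappa> + \<nu> \<le> i" "i < n + \<nu>" | "n + \<nu> \<le> i" by linarith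
  thus ?thesis
  proof cases
    case 1
    thus ?thesis using v_low[of i c] c z_eq(1)[of i] by (simp add: diff_at_def)
  next
    case 2
    thus ?thesis using v_supp[of "i - \<kappa>" c] c z_eq(1)[of i] by (simp add: diff_at_def)
  next
    case 3
    hence "i - (\<kappa> + \<nu>) < K" using dims(1) by linarith
    thus ?thesis using w_supp_K[of "i - (\<kappa> + \<nu>)" c] c z_eq(2)[OF 3] by (simp add: diff_at_def)
  next
    case 4
    hence "c \<noteq> c1 + 2 * (i - (n + \<nu>))" using c i dims(6) by linarith
    thus ?thesis using z_eq(3)[OF 4 i] by (simp add: pd_coord)
  qed
qed

lemma z_supp2: "q \<in> \<Omega> \<Longrightarrow> i < N + 2 \<Longrightarrow> c \<ge> N + 2 \<Longrightarrow> pd c (z i) q = 0"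
proof -
  assume q: "q \<in> \<Omega>" and i: "i < N + 2" and c: "c \<ge> N + 2"
  interpret flat_point n \<kappa> c0 c1 "\<lambda>k. diff_at q (\<psi> k)" "\<lambda>k. diff_at q (\<zeta> k)" K \<kappa>2 r1 r2 by (rule fp[OF q])
  consider "i < N" | "i = N" | "i = Suc N" using i by linarith
  thus ?thesis
  proof cases
    case 1
    thus ?thesis using z_supp[OF q, of i c] c by simp
  next
    case 2
    thus ?thesis using v_supp[of \<nu> c] c z_eq(4) by (simp add: diff_at_def)
  next
    case 3
    have "pd c (\<zeta> K) q = 0" using w_supp[of \<nu> c] c \<kappa>2_s by (simp add: diff_at_def)
    moreover have "c \<noteq> c1 + 2 * \<nu>" using c dims(6) by linarith
    ultimately show ?thesis using 3 z_eq(5) by (simp add: pd_coord)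
  qed
qed

text \<open>Freezing the coordinates from \<open>m\<close> on at the base point turns a function on jet space into a
  function of the first \<open>m\<close> coordinates. The sets \<open>\<Omega>m m\<close> are chosen accordingly, since points of
  \<open>Rsp m\<close> need not lie in \<open>\<Omega>\<close>.\<close>

definition pad :: "nat \<Rightarrow> (nat \<Rightarrow> real) \<Rightarrow> nat \<Rightarrow> real" where
  "pad m q = (\<lambda>i. if i < m then q i else p i)"

lemma pad_p: "pad m p = p" by (simp add: pad_def)

lemma pad_agree: "(\<And>i. i < m \<Longrightarrow> q i = r i) \<Longrightarrow> pad m q = pad m r"
  by (auto simp: pad_def)

lemma pd_pad: "c < m \<Longrightarrow> pd c (\<lambda>q. h (pad m q)) q = pd c h (pad m q)"
proof -
  assume c: "c < m"
  have "pad m (q(c := t)) = (pad m q)(c := t)" for t using c by (auto simp: pad_def)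
  moreover have "(pad m q) c = q c" using c by (simp add: pad_def)
  ultimately show ?thesis by (simp add: pd_def)
qed

lemma depends_below_pad: "depends_below m (\<lambda>q. h (pad m q))"
proof (rule depends_belowI)
  fix q r :: "nat \<Rightarrow> real" assume e: "\<And>i. i < m \<Longrightarrow> q i = r i"
  have "pad m q = pad m r" by (rule pad_agree) (rule e)
  thus "h (pad m q) = h (pad m r)" by simp
qed

definition \<Omega>m where "\<Omega>m m = {q. pad m q \<in> \<Omega>}"

lemma csmooth_pad_coord: "csmooth V (\<lambda>q. pad m q i)"
  using csmooth_coord csmooth_const by (cases "i < m") (auto simp: pad_def)

lemma open_\<Omega>m: "open (\<Omega>m m)"
  using open_preimage[OF open_UNIV csmooth_pad_coord open_\<Omega>] by (simp add: \<Omega>m_def)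

lemma cylinder_\<Omega>m: "cylinder m (\<Omega>m m)"
  unfolding cylinder_def \<Omega>m_def
proof (intro allI impI)
  fix q r :: "nat \<Rightarrow> real" assume "\<forall>i<m. q i = r i" "q \<in> {q. pad m q \<in> \<Omega>}"
  thus "r \<in> {q. pad m q \<in> \<Omega>}" using pad_agree[of m q r] by simp
qed

lemma csmooth_pad: "fsmooth \<Omega> h \<Longrightarrow> csmooth (\<Omega>m m) (\<lambda>q. h (pad m q))"
proof -
  assume h: "fsmooth \<Omega> h"
  then obtain k where k: "depends_below k h" by (auto simp: fsmooth_def)
  show ?thesis
    by (rule csmooth_comp[OF open_\<Omega>m open_\<Omega> fsmooth_csmooth[OF h] k csmooth_pad_coord]) (simp add: \<Omega>m_def)
qed

lemma fsmooth_\<Omega>: "fsmooth Om h \<Longrightarrow> fsmooth \<Omega> h" using fsmooth_subset box by blast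

lemma same_value:
  assumes "fsmooth \<Omega> h" "\<And>q c. q \<in> \<Omega> \<Longrightarrow> c \<ge> m \<Longrightarrow> pd c h q = 0"
    and "q \<in> \<Omega>" "r \<in> \<Omega>" "\<And>i. i < m \<Longrightarrow> q i = r i"
  shows "h q = h r"
proof -
  obtain k where k: "depends_below k h" using assms(1) by (auto simp: fsmooth_def)
  show ?thesis by (rule constant_on_box[OF fsmooth_csmooth[OF assms(1)] k assms(2-5)])
qed

lemma chart:
  assumes "m \<le> N + 2" "\<And>q i c. q \<in> \<Omega> \<Longrightarrow> i < m \<Longrightarrow> c \<ge> m \<Longrightarrow> pd c (z i) q = 0"
  shows "\<exists>U V G. ldiffeo m U V (\<lambda>q i. if i < m then z i (pad m q) else q i) G \<and> p \<in> U \<and> U \<subseteq> \<Omega>m m"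
proof (rule inverse_function[OF open_\<Omega>m cylinder_\<Omega>m])
  show "p \<in> \<Omega>m m" using p_in by (simp add: \<Omega>m_def pad_p)
  show "csmooth (\<Omega>m m) (\<lambda>q. z i (pad m q))" for i by (rule csmooth_pad[OF fsmooth_\<Omega>[OF z_fsmooth]])
  show "depends_below m (\<lambda>q. z i (pad m q))" for i by (rule depends_below_pad)
  have "diff_at p (\<lambda>q. z i (pad m q)) = diff_at p (z i)" if "i \<in> {..<m}" for i
  proof
    fix c
    show "diff_at p (\<lambda>q. z i (pad m q)) c = diff_at p (z i) c"
    proof (cases "c < m")
      case True
      thus ?thesis by (simp add: diff_at_def pd_pad pad_p)
    next
      case False
      thus ?thesis using depends_below_pd_zero[OF depends_below_pad, of m c "z i" p] assms(2)[OF p_in, of i c] that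
        by (simp add: diff_at_def)
    qed
  qed
  moreover have "indep (\<lambda>i. diff_at p (z i)) {..<m}"
    by (rule indep_subset[OF indep_z[OF p_in]]) (use assms(1) in auto)
  ultimately show "indep (\<lambda>i. diff_at p (\<lambda>q. z i (pad m q))) {..<m}"
    using indep_cong[of "{..<m}" "\<lambda>i. diff_at p (\<lambda>q. z i (pad m q))" "\<lambda>i. diff_at p (z i)"] by blast
qed

text \<open>The pointwise ratio \<open>b\<close> of \<open>flat_point\<close> as a function;
  \<open>acoef\<close> is the remainder that makes \<zeta>_K = a + b \<psi>_(\<kappa>+\<nu>) an
  identity.\<close>

definition bcoef :: "(nat \<Rightarrow> real) \<Rightarrow> real" where
  "bcoef q = pd c0 (\<zeta> \<kappa>2) q / pd c0 (\<psi> \<kappa>) q"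

definition acoef :: "(nat \<Rightarrow> real) \<Rightarrow> real" where
  "acoef q = \<zeta> K q - bcoef q * \<psi> (\<kappa> + \<nu>) q"

lemma pivot_nz: "q \<in> \<Omega> \<Longrightarrow> pd c0 (\<psi> \<kappa>) q \<noteq> 0"
proof -
  assume "q \<in> \<Omega>"
  then interpret flat_point n \<kappa> c0 c1 "\<lambda>k. diff_at q (\<psi> k)" "\<lambda>k. diff_at q (\<zeta> k)" K \<kappa>2 r1 r2 by (rule fp)
  show ?thesis using v_pivot by (simp add: diff_at_def)
qed

lemma bcoef_nz: "q \<in> \<Omega> \<Longrightarrow> \<nu> > 0 \<Longrightarrow> bcoef q \<noteq> 0"
proof -
  assume q: "q \<in> \<Omega>" and "\<nu> > 0"
  then interpret flat_point n \<kappa> c0 c1 "\<lambda>k. diff_at q (\<psi> k)" "\<lambda>k. diff_at q (\<zeta> k)" K \<kappa>2 r1 r2 by (intro fp)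
  have "\<kappa>2 < K" using \<open>\<nu> > 0\<close> \<kappa>2_s by linarith
  thus ?thesis using w_pivot pivot_nz[OF q] by (simp add: diff_at_def bcoef_def)
qed

lemma bcoef_fsmooth: "fsmooth \<Omega> bcoef"
  unfolding bcoef_def by (rule fsmooth_divide[OF open_\<Omega>]) (use fsmooth_\<Omega>[OF fsmooth_pd] \<psi>_fsmooth \<zeta>_fsmooth pivot_nz in auto)

lemma acoef_fsmooth: "fsmooth \<Omega> acoef"
  unfolding acoef_def
  by (rule fsmooth_diff[OF open_\<Omega> fsmooth_\<Omega>[OF \<zeta>_fsmooth] fsmooth_mult[OF open_\<Omega> bcoef_fsmooth fsmooth_\<Omega>[OF \<psi>_fsmooth]]])

text \<open>Here the inputs being affine is decisive: the coefficient of an input in the first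
  derivative that may contain it is the derivative of the preceding function along \<open>g1\<close>
  or \<open>g2\<close>, and that function depends on the state alone.\<close>

lemma input_coefficient_x:
  assumes h: "jetseq h" and lo: "\<And>q c k. q \<in> \<Omega> \<Longrightarrow> k < j \<Longrightarrow> c \<ge> n \<Longrightarrow> pd c (h k) q = 0"
    and j: "j \<ge> 1" and q: "q \<in> \<Omega>" and c: "c \<ge> n"
  shows "pd c (pd c0 (h j)) q = 0"
proof -
  obtain k where k: "j = Suc k" using j by (cases j) auto
  have hS: "fsmooth Om (h k)" and hD: "h j = D (h k)" using h k by (auto simp: jetseq_def)
  have Wc: "pd c (pd c0 (W i)) r = 0" if "i < n" for i r
  proof -
    have "pd c0 (W i) r = (if c0 = n then g1 i (tr n r) else g2 i (tr n r))" for r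
    proof -
      have c0: "c0 = n \<or> c0 = Suc n" using dims(7,8) by linarith
      have t: "tr n (r(c0 := t)) = tr n r" for t using dims(7) by (auto simp: tr_def)
      have "((\<lambda>t. W i (r(c0 := t))) has_real_derivative (if c0 = n then g1 i (tr n r) else g2 i (tr n r))) (at (r c0))"
        unfolding W_eq jetW_def using that c0
        by (auto simp: t[unfolded fun_upd_def] fun_upd_def intro!: derivative_eq_intros)
      thus ?thesis unfolding pd_def by (rule DERIV_imp_deriv)
    qed
    hence "pd c0 (W i) = (\<lambda>r. (if c0 = n then g1 i else g2 i) (tr n r))" by auto
    thus ?thesis using depends_below_pd_zero[OF depends_below_tr[OF order_refl] c] by simp
  qed
  have "pd c (pd c0 (h j)) q = pd c (\<lambda>r. \<Sum>i<n. pd c0 (W i) r * pd i (h k) r) q"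
  proof (rule pd_cong[OF open_\<Omega> q])
    fix r assume r: "r \<in> \<Omega>"
    show "pd c0 (h j) r = (\<Sum>i<n. pd c0 (W i) r * pd i (h k) r)"
      unfolding hD using pd_D[OF open_\<Omega> box hS r dims(7)] lo[of _ k c0] k dims(7,8) by simp
  qed
  also have "\<dots> = (\<Sum>i<n. pd c (\<lambda>r. pd c0 (W i) r * pd i (h k) r) q)"
    by (rule pd_sum[of _ \<Omega>]) (use W_fsmooth hS fsmooth_\<Omega> q open_\<Omega> in \<open>auto intro!: fsmooth_csmooth fsmooth_mult fsmooth_pd\<close>)
  also have "\<dots> = 0"
  proof (rule sum.neutral, rule ballI)
    fix i assume i: "i \<in> {..<n}"
    have "pd c (pd i (h k)) q = pd i (pd c (h k)) q"
      by (rule pd_commute[OF open_\<Omega> fsmooth_csmooth[OF fsmooth_\<Omega>[OF hS]] q])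
    also have "\<dots> = pd i (\<lambda>r. 0) q"
      by (rule pd_cong[OF open_\<Omega> q]) (use lo[of _ k c] k c in simp)
    finally have 1: "pd c (pd i (h k)) q = 0" by (simp add: pd_const)
    have "pd c (\<lambda>r. pd c0 (W i) r * pd i (h k) r) q =
        pd c (pd c0 (W i)) q * pd i (h k) q + pd c0 (W i) q * pd c (pd i (h k)) q"
      by (rule pd_mult[OF fsmooth_csmooth[OF fsmooth_pd[OF fsmooth_\<Omega>[OF W_fsmooth]]] fsmooth_csmooth[OF fsmooth_pd[OF fsmooth_\<Omega>[OF hS]]] q])
    thus "pd c (\<lambda>r. pd c0 (W i) r * pd i (h k) r) q = 0" using 1 Wc i by simp
  qed
  finally show ?thesis .
qed

lemma bcoef_supp:
  assumes "q \<in> \<Omega>" "c \<ge> n" "\<nu> > 0"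
  shows "pd c bcoef q = 0"
proof -
  have low: "pd c (\<psi> k) q = 0" if "q \<in> \<Omega>" "k < \<kappa>" "c \<ge> n" for q c k
  proof -
    interpret flat_point n \<kappa> c0 c1 "\<lambda>k. diff_at q (\<psi> k)" "\<lambda>k. diff_at q (\<zeta> k)" K \<kappa>2 r1 r2 by (rule fp[OF that(1)])
    show ?thesis using v_low that by (simp add: diff_at_def)
  qed
  have low2: "pd c (\<zeta> k) q = 0" if "q \<in> \<Omega>" "k < \<kappa>2" "c \<ge> n" for q c k
  proof -
    interpret flat_point n \<kappa> c0 c1 "\<lambda>k. diff_at q (\<psi> k)" "\<lambda>k. diff_at q (\<zeta> k)" K \<kappa>2 r1 r2 by (rule fp[OF that(1)])
    show ?thesis using w_low that by (simp add: diff_at_def)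
  qed
  \<comment> \<open>\<zeta>_0 is a function of the state and has no input coefficient.\<close>
  have "\<kappa>2 \<ge> 1"
  proof (rule ccontr)
    assume "\<not> \<kappa>2 \<ge> 1"
    hence "\<kappa>2 = 0" by simp
    moreover have "pd c0 (\<zeta> 0) q = 0" using \<zeta> assms(1) box dims(7) by (auto simp: jetseq_def)
    ultimately have "pd c0 (\<zeta> \<kappa>2) q = 0" by simp
    thus False using bcoef_nz[OF assms(1,3)] by (simp add: bcoef_def)
  qed
  have 1: "pd c (pd c0 (\<psi> \<kappa>)) q = 0" by (rule input_coefficient_x[OF \<psi> low dims(2) assms(1,2)])
  have 2: "pd c (pd c0 (\<zeta> \<kappa>2)) q = 0" by (rule input_coefficient_x[OF \<zeta> low2 \<open>\<kappa>2 \<ge> 1\<close> assms(1,2)])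
  have "pd c (\<lambda>q. pd c0 (\<zeta> \<kappa>2) q / pd c0 (\<psi> \<kappa>) q) q = 0"
    using pd_divide[OF open_\<Omega> fsmooth_csmooth[OF fsmooth_pd[OF fsmooth_\<Omega>[OF \<zeta>_fsmooth]]] fsmooth_csmooth[OF fsmooth_pd[OF fsmooth_\<Omega>[OF \<psi>_fsmooth]]] assms(1) pivot_nz]
    by (simp add: 1 2)
  moreover have "bcoef = (\<lambda>q. pd c0 (\<zeta> \<kappa>2) q / pd c0 (\<psi> \<kappa>) q)" by (auto simp: bcoef_def)
  ultimately show ?thesis by simp
qed

lemma z_image:
  "(\<lambda>i. diff_at q (z i)) ` {..<n + \<nu>} = (\<lambda>k. diff_at q (\<psi> k)) ` {..<\<kappa> + \<nu>} \<union> (\<lambda>k. diff_at q (\<zeta> k)) ` {..<K}"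
proof -
  have "{..<n + \<nu>} = {..<\<kappa> + \<nu>} \<union> (\<lambda>k. k + (\<kappa> + \<nu>)) ` {..<K}"
  proof -
    have "(\<lambda>k. k + (\<kappa> + \<nu>)) ` {..<K} = {\<kappa> + \<nu>..<n + \<nu>}"
      using image_add_atLeastLessThan'[of "\<kappa> + \<nu>" 0 K] dims(1) by (simp add: atLeast0LessThan ac_simps)
    thus ?thesis using dims(1) by auto
  qed
  moreover have "(\<lambda>i. diff_at q (z i)) ` {..<\<kappa> + \<nu>} = (\<lambda>k. diff_at q (\<psi> k)) ` {..<\<kappa> + \<nu>}"
    by (rule image_cong) (simp_all add: z_eq(1))
  moreover have "(\<lambda>i. diff_at q (z i)) ` (\<lambda>k. k + (\<kappa> + \<nu>)) ` {..<K} = (\<lambda>k. diff_at q (\<zeta> k)) ` {..<K}"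
    unfolding image_image by (rule image_cong) (use dims(1) z_eq(2) in simp_all)
  ultimately show ?thesis by (simp only: image_Un)
qed

text \<open>db is a combination of the dx^i, and these are spanned by the first n + \<nu> chart
  functions.\<close>

lemma bcoef_span:
  assumes "q \<in> \<Omega>" "\<nu> > 0"
  shows "diff_at q bcoef \<in> fv.span ((\<lambda>i. diff_at q (z i)) ` {..<n + \<nu>})"
proof -
  interpret flat_point n \<kappa> c0 c1 "\<lambda>k. diff_at q (\<psi> k)" "\<lambda>k. diff_at q (\<zeta> k)" K \<kappa>2 r1 r2 by (rule fp[OF assms(1)])
  have "diff_at q bcoef \<in> fv.span (covec ` {..<n})"
    by (rule supported_span) (use bcoef_supp[OF assms(1)] assms(2) in \<open>simp add: diff_at_def\<close>)
  thus ?thesis unfolding z_image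
    by (rule span_subset_span[rotated]) (use coordinate_span in blast)
qed

lemma diff_at_acoef:
  assumes "q \<in> \<Omega>"
  shows "diff_at q acoef = (\<lambda>c. (diff_at q (\<zeta> K) c - bcoef q * diff_at q (\<psi> (\<kappa> + \<nu>)) c) - \<psi> (\<kappa> + \<nu>) q * diff_at q bcoef c)"
proof
  fix c
  note S = fsmooth_csmooth[OF fsmooth_\<Omega>[OF \<zeta>_fsmooth[of K]]] fsmooth_csmooth[OF bcoef_fsmooth] fsmooth_csmooth[OF fsmooth_\<Omega>[OF \<psi>_fsmooth[of "\<kappa> + \<nu>"]]]
  have e: "acoef = (\<lambda>q. \<zeta> K q - bcoef q * \<psi> (\<kappa> + \<nu>) q)" by (auto simp: acoef_def)
  have "pd c acoef q = pd c (\<zeta> K) q - (pd c bcoef q * \<psi> (\<kappa> + \<nu>) q + bcoef q * pd c (\<psi> (\<kappa> + \<nu>)) q)"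
    unfolding e using pd_diff[OF S(1) csmooth_mult[OF open_\<Omega> S(2,3)] assms, of c] pd_mult[OF S(2,3) assms, of c] by simp
  thus "diff_at q acoef c = (diff_at q (\<zeta> K) c - bcoef q * diff_at q (\<psi> (\<kappa> + \<nu>)) c) - \<psi> (\<kappa> + \<nu>) q * diff_at q bcoef c"
    by (simp add: diff_at_def algebra_simps)
qed

text \<open>Writing da = (d\<zeta>_K - b d\<psi>) - \<psi> db, with \<psi> of order \<kappa> +
  \<nu>, makes the pointwise results applicable: \<open>drift_span\<close> bounds the dependence by
  z_(n+\<nu>) = u2, \<open>wK_notin\<close> makes it effective, and \<open>difference_supp\<close>
  excludes the inputs of the prolonged system.\<close>

lemma acoef_span:
  assumes "q \<in> \<Omega>" "\<nu> > 0"
  shows "diff_at q acoef \<in> fv.span ((\<lambda>i. diff_at q (z i)) ` {..<Suc (n + \<nu>)})"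
    and "diff_at q acoef \<notin> fv.span ((\<lambda>i. diff_at q (z i)) ` {..<n + \<nu>})"
    and "c \<ge> N \<Longrightarrow> pd c acoef q = 0"
proof -
  interpret flat_point n \<kappa> c0 c1 "\<lambda>k. diff_at q (\<psi> k)" "\<lambda>k. diff_at q (\<zeta> k)" K \<kappa>2 r1 r2 by (rule fp[OF assms(1)])
  let ?v = "\<lambda>i. diff_at q (z i)"
  have b: "b = bcoef q" unfolding b_def by (simp add: bcoef_def diff_at_def)
  have zc1: "?v (n + \<nu>) = covec c1" using z_eq(3)[of "n + \<nu>"] assms(2) diff_at_coord by simp
  have im: "?v ` {..<Suc (n + \<nu>)} = insert (covec c1) (?v ` {..<n + \<nu>})"
    by (simp add: lessThan_Suc zc1)
  have 1: "(\<lambda>c. diff_at q (\<zeta> K) c - bcoef q * diff_at q (\<psi> (\<kappa> + \<nu>)) c) \<in> fv.span (?v ` {..<Suc (n + \<nu>)})"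
    unfolding im z_image using drift_span[OF assms(2)] b by simp
  have 2: "diff_at q bcoef \<in> fv.span (?v ` {..<Suc (n + \<nu>)})"
    by (rule span_monoD[OF bcoef_span[OF assms]]) auto
  show "diff_at q acoef \<in> fv.span (?v ` {..<Suc (n + \<nu>)})"
    unfolding diff_at_acoef[OF assms(1)] by (rule span_lincomb[OF 1 2])
  show "diff_at q acoef \<notin> fv.span (?v ` {..<n + \<nu>})"
  proof
    let ?T = "insert (diff_at q (\<psi> (\<kappa> + \<nu>))) ((\<lambda>k. diff_at q (\<psi> k)) ` {..<\<kappa> + \<nu>} \<union> (\<lambda>k. diff_at q (\<zeta> k)) ` {..<K} \<union> covec ` {..<n})"
    have sub: "?v ` {..<n + \<nu>} \<subseteq> ?T" unfolding z_image by blast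
    assume "diff_at q acoef \<in> fv.span (?v ` {..<n + \<nu>})"
    hence 3: "diff_at q acoef \<in> fv.span ?T" by (rule span_monoD[OF _ sub])
    have 4: "diff_at q bcoef \<in> fv.span ?T" by (rule span_monoD[OF bcoef_span[OF assms] sub])
    have 5: "diff_at q (\<psi> (\<kappa> + \<nu>)) \<in> fv.span ?T" by (rule fv.span_base) blast
    have "(\<lambda>c. diff_at q (\<zeta> K) c - bcoef q * diff_at q (\<psi> (\<kappa> + \<nu>)) c) \<in> fv.span ?T"
      by (rule span_lincombD[OF _ 4]) (use 3 in \<open>simp only: diff_at_acoef[OF assms(1)]\<close>)
    hence "diff_at q (\<zeta> K) \<in> fv.span ?T" by (rule span_lincombD[OF _ 5])
    thus False using wK_notin by blast
  qed
  show "pd c acoef q = 0" if "c \<ge> N"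
  proof -
    have lt: "\<kappa>2 < K" using assms(2) \<kappa>2_s by linarith
    have "diff_at q (\<zeta> K) c - bcoef q * diff_at q (\<psi> (\<kappa> + \<nu>)) c = 0"
      using difference_supp[OF lt that] b \<kappa>2_s by simp
    moreover have "pd c bcoef q = 0" using bcoef_supp[OF assms(1) _ assms(2)] that by simp
    ultimately show ?thesis using fun_cong[OF diff_at_acoef[OF assms(1)], of c] by (simp add: diff_at_def)
  qed
qed

text \<open>The chain rule in the chart: the coefficients of dh with respect to the dz are the
  partial derivatives of \<open>h\<close> in chart coordinates. Spans of differentials thereby tell
  on which \<open>z\<close> a coefficient depends.\<close>

lemma coordinate_expansion:
  assumes d: "ldiffeo N U B (\<lambda>q i. if i < N then z i (pad N q) else q i) G" and U: "U \<subseteq> \<Omega>m N"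
    and h: "fsmooth \<Omega> h" "\<And>q c. q \<in> \<Omega> \<Longrightarrow> c \<ge> N \<Longrightarrow> pd c h q = 0" and w: "w \<in> B"
  shows "diff_at (pad N (G w)) h = (\<lambda>c. \<Sum>j<N. pd j (\<lambda>w. h (pad N (G w))) w * diff_at (pad N (G w)) (z j) c)"
    and "csmooth B (\<lambda>w. h (pad N (G w)))" and "depends_below N (\<lambda>w. h (pad N (G w)))"
    and "pad N (G w) \<in> \<Omega>"
proof -
  note D = ldiffeoD[OF d]
  let ?q = "G w" and ?Fh = "\<lambda>w. h (pad N (G w))" and ?Z = "\<lambda>q i. if i < N then z i (pad N q) else q i"
  have q: "?q \<in> U" by (rule D(7)[OF w])
  show q\<Omega>: "pad N ?q \<in> \<Omega>" using q U by (auto simp: \<Omega>m_def)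
  show sF: "csmooth B ?Fh"
    by (rule csmooth_comp[OF D(2) open_\<Omega>m csmooth_pad[OF h(1)] depends_below_pad D(10)]) (use D(7) U in blast)
  show fF: "depends_below N ?Fh"
  proof (rule depends_belowI)
    fix q r :: "nat \<Rightarrow> real" assume e: "\<And>i. i < N \<Longrightarrow> q i = r i"
    have "pad N (G q) = pad N (G r)" by (rule pad_agree) (rule ldiffeo_agree(2)[OF d e])
    thus "h (pad N (G q)) = h (pad N (G r))" by simp
  qed
  show "diff_at (pad N ?q) h = (\<lambda>c. \<Sum>j<N. pd j ?Fh w * diff_at (pad N ?q) (z j) c)"
  proof
    fix c
    show "diff_at (pad N ?q) h c = (\<Sum>j<N. pd j ?Fh w * diff_at (pad N ?q) (z j) c)"
    proof (cases "c < N")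
      case False
      thus ?thesis using h(2)[OF q\<Omega>] z_supp[OF q\<Omega>] by (simp add: diff_at_def)
    next
      case True
      have "pd c h (pad N ?q) = pd c (\<lambda>q. h (pad N q)) ?q" by (rule pd_pad[OF True, symmetric])
      also have "\<dots> = pd c (\<lambda>q. ?Fh (?Z q)) ?q"
        by (rule pd_cong[OF D(1) q]) (simp only: D(6))
      also have "\<dots> = (\<Sum>j<N. pd j ?Fh (?Z ?q) * pd c (\<lambda>q. ?Z q j) ?q)"
        by (rule pd_comp[where T = ?Z, OF D(1,2) sF fF D(9) q D(5)[OF q]])
      also have "\<dots> = (\<Sum>j<N. pd j ?Fh w * pd c (z j) (pad N ?q))"
      proof (rule sum.cong)
        fix j assume "j \<in> {..<N}"
        hence "pd c (\<lambda>q. ?Z q j) ?q = pd c (z j) (pad N ?q)" by (simp add: pd_pad[OF True])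
        thus "pd j ?Fh (?Z ?q) * pd c (\<lambda>q. ?Z q j) ?q = pd j ?Fh w * pd c (z j) (pad N ?q)"
          by (simp only: D(8)[OF w])
      qed simp
      finally show ?thesis by (simp add: diff_at_def)
    qed
  qed
qed

end

section \<open>The triangular equations in the chart\<close>

context gtf_chart
begin

lemma D_z:
  assumes "i < N"
  shows "i < \<kappa> + \<nu> - 1 \<Longrightarrow> D (z i) = z (Suc i)"
    and "i = \<kappa> + \<nu> - 1 \<Longrightarrow> D (z i) = z N"
    and "\<kappa> + \<nu> \<le> i \<Longrightarrow> i < n + \<nu> - 1 \<Longrightarrow> D (z i) = z (Suc i)"
    and "i = n + \<nu> - 1 \<Longrightarrow> D (z i) = \<zeta> K"
    and "n + \<nu> \<le> i \<Longrightarrow> i < N - 1 \<Longrightarrow> D (z i) = z (Suc i)"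
    and "n + \<nu> \<le> i \<Longrightarrow> i = N - 1 \<Longrightarrow> D (z i) = z (Suc N)"
proof -
  note d = dims(1-3)
  show "D (z i) = z (Suc i)" if "i < \<kappa> + \<nu> - 1"
    using that z_eq(1)[of i] z_eq(1)[of "Suc i"] \<psi>_Suc[of i] by simp
  show "D (z i) = z N" if "i = \<kappa> + \<nu> - 1"
  proof -
    have "Suc i = \<kappa> + \<nu>" "i < \<kappa> + \<nu>" using that d by linarith+
    thus ?thesis using z_eq(1)[of i] z_eq(4) \<psi>_Suc[of i] by simp
  qed
  show "D (z i) = z (Suc i)" if i: "\<kappa> + \<nu> \<le> i" "i < n + \<nu> - 1"
  proof -
    have "Suc (i - (\<kappa> + \<nu>)) = Suc i - (\<kappa> + \<nu>)" using i by simp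
    thus ?thesis using i z_eq(2)[of i] z_eq(2)[of "Suc i"] \<zeta>_Suc[of "i - (\<kappa> + \<nu>)"] by simp
  qed
  show "D (z i) = \<zeta> K" if i: "i = n + \<nu> - 1"
  proof -
    have "Suc (i - (\<kappa> + \<nu>)) = K" "\<kappa> + \<nu> \<le> i" "i < n + \<nu>" using i d by linarith+
    thus ?thesis using z_eq(2)[of i] \<zeta>_Suc[of "i - (\<kappa> + \<nu>)"] by simp
  qed
  have jet: "D (coord (c1 + 2 * j)) = coord (c1 + 2 * Suc j)" for j
    unfolding D_coord using W_jet[of "c1 + 2 * j"] dims(5) by simp
  show "D (z i) = z (Suc i)" if i: "n + \<nu> \<le> i" "i < N - 1"
  proof -
    have "Suc i < N" "Suc (i - (n + \<nu>)) = Suc i - (n + \<nu>)" using i by simp_all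
    thus ?thesis using i z_eq(3)[of i] z_eq(3)[of "Suc i"] jet[of "i - (n + \<nu>)"] by simp
  qed
  show "D (z i) = z (Suc N)" if i: "n + \<nu> \<le> i" "i = N - 1"
  proof -
    have "Suc (i - (n + \<nu>)) = \<nu>" "\<nu> \<noteq> 0" using i assms by linarith+
    thus ?thesis using i assms z_eq(3)[of i] z_eq(5) jet[of "i - (n + \<nu>)"] by simp
  qed
qed

text \<open>The right-hand sides need the inputs, while the partial derivatives are taken at a
  truncated point. As the state functions do not see the inputs, both evaluations can be moved to
  the point frozen from N + 2 on.\<close>

lemma tder_z:
  assumes q: "pad N q \<in> \<Omega>" "pad (N + 2) q \<in> \<Omega>" and i: "i < N"
  shows "tder n f g1 g2 N (\<lambda>y. z i (pad N y)) q = D (z i) (pad (N + 2) q)"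
proof -
  let ?q1 = "pad N q" and ?q2 = "pad (N + 2) q"
  have tr1: "pad N (tr N q) = ?q1" by (rule pad_agree) (simp add: tr_def)
  have "tder n f g1 g2 N (\<lambda>y. z i (pad N y)) q = (\<Sum>c<N. jetW n f g1 g2 c q * pd c (\<lambda>y. z i (pad N y)) (tr N q))"
    by (rule tder_eq) simp
  also have "\<dots> = (\<Sum>c<N. W c ?q2 * pd c (z i) ?q2)"
  proof (rule sum.cong)
    fix c assume "c \<in> {..<N}"
    hence c: "c < N" by simp
    have "jetW n f g1 g2 c q = W c ?q2" unfolding W_eq
      by (rule depends_below_eq[OF depends_below_jetW[OF c]]) (auto simp: pad_def)
    moreover have "pd c (\<lambda>y. z i (pad N y)) (tr N q) = pd c (z i) ?q1"
      using pd_pad[OF c] tr1 by simp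
    moreover have "pd c (z i) ?q1 = pd c (z i) ?q2"
    proof (rule same_value[OF fsmooth_\<Omega>[OF fsmooth_pd[OF z_fsmooth]] _ q])
      fix r c' assume r: "r \<in> \<Omega>" and c': "N \<le> c'"
      have "pd c' (pd c (z i)) r = pd c (pd c' (z i)) r"
        by (rule pd_commute[OF open_\<Omega> fsmooth_csmooth[OF fsmooth_\<Omega>[OF z_fsmooth]] r])
      also have "\<dots> = pd c (\<lambda>r. 0) r"
        by (rule pd_cong[OF open_\<Omega> r]) (rule z_supp[OF _ i c'])
      finally show "pd c' (pd c (z i)) r = 0" by (simp add: pd_const)
    qed (simp add: pad_def)
    ultimately show "jetW n f g1 g2 c q * pd c (\<lambda>y. z i (pad N y)) (tr N q) = W c ?q2 * pd c (z i) ?q2"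
      by simp
  qed simp
  also have "\<dots> = D (z i) ?q2"
  proof -
    obtain k where k: "depends_below k (z i)" using z_fsmooth[of i] by (auto simp: fsmooth_def)
    have "D (z i) ?q2 = (\<Sum>c<max k N. W c ?q2 * pd c (z i) ?q2)"
      by (rule total_deriv_eq[OF depends_below_mono[OF k]]) simp
    also have "\<dots> = (\<Sum>c<N. W c ?q2 * pd c (z i) ?q2)"
      by (rule sum.mono_neutral_right) (use z_supp[OF q(2) i] in auto)
    finally show ?thesis by simp
  qed
  finally show ?thesis .
qed

text \<open>A chart of the state space and one of states with inputs must match: the domain of the
  second has to project onto the whole domain of the first.\<close>

lemma exists_charts:
  "\<exists>U V G U1 B G1 z0 \<epsilon>.
     ldiffeo (N + 2) U V (\<lambda>q i. if i < N + 2 then z i (pad (N + 2) q) else q i) G \<and>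
     ldiffeo N U1 B (\<lambda>q i. if i < N then z i (pad N q) else q i) G1 \<and>
     B = box_nbhd z0 N \<epsilon> \<and> \<epsilon> > 0 \<and> p \<in> U \<and> U \<subseteq> U1 \<and> U \<subseteq> \<Omega>m (N + 2) \<and> U1 \<subseteq> \<Omega>m N \<and>
     tr N ` (Rsp (N + 2) \<inter> U) = Rsp N \<inter> U1"
proof -
  let ?Z1 = "\<lambda>q i. if i < N then z i (pad N q) else q i"
  let ?Z2 = "\<lambda>q i. if i < N + 2 then z i (pad (N + 2) q) else q i"
  obtain U1 V1 G1 where d1: "ldiffeo N U1 V1 ?Z1 G1" "p \<in> U1" "U1 \<subseteq> \<Omega>m N"
    using chart[of N] z_supp by auto
  obtain U2 V2 G2 where d2: "ldiffeo (N + 2) U2 V2 ?Z2 G2" "p \<in> U2" "U2 \<subseteq> \<Omega>m (N + 2)"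
    using chart[of "N + 2"] z_supp2 by auto
  note D1 = ldiffeoD[OF d1(1)] and D2 = ldiffeoD[OF d2(1)]
  \<comment> \<open>The cylinder over the projection of both domains to the state; above each of its
    points there is a point of \<open>U2\<close>, which yields surjectivity at the end.\<close>
  define \<pi> where "\<pi> = {q. \<exists>r\<in>U2 \<inter> U1. \<forall>i<N. r i = q i}"
  have \<pi>_open: "open \<pi>"
  proof (subst open_subopen, rule ballI)
    fix q assume "q \<in> \<pi>"
    then obtain r where r: "r \<in> U2 \<inter> U1" "\<forall>i<N. r i = q i" by (auto simp: \<pi>_def)
    define T where "T = {q' \<in> UNIV. (\<lambda>i. if i < N then q' i else r i) \<in> U2 \<inter> U1}"
    have "csmooth UNIV (\<lambda>q'. if i < N then q' i else r i)" for i
      using csmooth_coord csmooth_const by (cases "i < N") auto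
    hence "open T" unfolding T_def by (rule open_preimage[OF open_UNIV _ open_Int[OF D2(1) D1(1)]])
    moreover have "(\<lambda>i. if i < N then q i else r i) = r" using r(2) by auto
    hence "q \<in> T" using r(1) by (simp add: T_def)
    moreover have "T \<subseteq> \<pi>"
    proof
      fix q' assume "q' \<in> T"
      thus "q' \<in> \<pi>" unfolding T_def \<pi>_def
        by (intro CollectI bexI[of _ "\<lambda>i. if i < N then q' i else r i"]) auto
    qed
    ultimately show "\<exists>T. open T \<and> q \<in> T \<and> T \<subseteq> \<pi>" by blast
  qed
  have \<pi>_cylinder: "cylinder N \<pi>" unfolding cylinder_def \<pi>_def by auto
  have \<pi>_sub: "\<pi> \<subseteq> U1"
  proof
    fix q assume "q \<in> \<pi>"
    then obtain r where "r \<in> U1" "\<forall>i<N. r i = q i" by (auto simp: \<pi>_def)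
    thus "q \<in> U1" using cylinderD[OF D1(3), of r q] by blast
  qed
  define V' where "V' = {w \<in> V1. G1 w \<in> \<pi>}"
  have d\<pi>: "ldiffeo N \<pi> V' ?Z1 G1"
    unfolding V'_def by (rule ldiffeo_restrict_domain[OF d1(1) \<pi>_open \<pi>_cylinder \<pi>_sub])
  have p\<pi>: "p \<in> \<pi>" unfolding \<pi>_def using d1(2) d2(2) by auto
  define z0 where "z0 = ?Z1 p"
  have z0: "z0 \<in> V'" unfolding z0_def by (rule ldiffeoD(5)[OF d\<pi> p\<pi>])
  obtain \<epsilon> where \<epsilon>: "\<epsilon> > 0" "box_nbhd z0 N \<epsilon> \<subseteq> V'"
    using cylinder_contains_box[OF ldiffeoD(2)[OF d\<pi>] ldiffeoD(4)[OF d\<pi>] z0] by blast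
  \<comment> \<open>A box as image allows single chart coordinates to be replaced by those of
    \<open>z0\<close>.\<close>
  define B where "B = box_nbhd z0 N \<epsilon>"
  define Ux where "Ux = {q \<in> \<pi>. ?Z1 q \<in> B}"
  have dx: "ldiffeo N Ux B ?Z1 G1"
    unfolding Ux_def by (rule ldiffeo_restrict_codomain[OF d\<pi>]) (use \<epsilon> in \<open>auto simp: B_def open_box_nbhd cylinder_box\<close>)
  note Dx = ldiffeoD[OF dx]
  define U where "U = U2 \<inter> Ux"
  have "ldiffeo (N + 2) U {w \<in> V2. G2 w \<in> U} ?Z2 G2"
    by (rule ldiffeo_restrict_domain[OF d2(1)])
       (use D2(1,3) Dx(1) cylinder_mono[OF Dx(3), of "N + 2"] in \<open>auto simp: U_def cylinder_def\<close>)
  moreover have "p \<in> U" using d2(2) p\<pi> center_in_box_nbhd[OF \<epsilon>(1), of z0 N]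
    by (simp add: U_def Ux_def B_def z0_def)
  moreover have "tr N ` (Rsp (N + 2) \<inter> U) = Rsp N \<inter> Ux"
  proof (intro equalityI subsetI)
    fix y assume "y \<in> tr N ` (Rsp (N + 2) \<inter> U)"
    then obtain q where q: "q \<in> U" "y = tr N q" by blast
    have "tr N q \<in> Ux" by (rule cylinderD[OF Dx(3), of q]) (use q in \<open>auto simp: U_def tr_def\<close>)
    thus "y \<in> Rsp N \<inter> Ux" using q tr_in_Rsp by simp
  next
    fix y assume y: "y \<in> Rsp N \<inter> Ux"
    then obtain r where r: "r \<in> U2" "\<forall>i<N. r i = y i" by (auto simp: Ux_def \<pi>_def)
    let ?q = "tr (N + 2) r"
    have "?q \<in> U2" by (rule cylinderD[OF D2(3) r(1)]) (simp add: tr_def)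
    moreover have "?q \<in> Ux" by (rule cylinderD[OF Dx(3), of y]) (use y r in \<open>auto simp: tr_def\<close>)
    moreover have "tr N ?q = y"
      using tr_Rsp[of y N] y r(2) by (auto simp: tr_def fun_eq_iff Rsp_def)
    ultimately show "y \<in> tr N ` (Rsp (N + 2) \<inter> U)"
      using tr_in_Rsp[of "N + 2" r] by (intro image_eqI[of _ _ ?q]) (auto simp: U_def)
  qed
  moreover have "U \<subseteq> Ux" "U \<subseteq> \<Omega>m (N + 2)" "Ux \<subseteq> \<Omega>m N"
    using d2(3) \<pi>_sub d1(3) by (auto simp: U_def Ux_def)
  ultimately show ?thesis using dx \<epsilon>(1) B_def
    by (intro exI[of _ U] exI[of _ "{w \<in> V2. G2 w \<in> U}"] exI[of _ G2] exI[of _ Ux] exI[of _ B]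
          exI[of _ G1] exI[of _ z0] exI[of _ \<epsilon>] conjI)
qed

theorem gtf_equiv:
  "\<exists>U. ropen (N + 2) U \<and> tr (N + 2) p \<in> U \<and> U \<subseteq> tr (N + 2) ` Om \<and> GTF_equiv n f g1 g2 \<phi>1 \<phi>2 \<nu> U"
proof -
  let ?Z1 = "\<lambda>q i. if i < N then z i (pad N q) else q i"
  let ?Z2 = "\<lambda>q i. if i < N + 2 then z i (pad (N + 2) q) else q i"
  obtain U V G U1 B G1 z0 \<epsilon> where d2: "ldiffeo (N + 2) U V ?Z2 G" and d1: "ldiffeo N U1 B ?Z1 G1"
    and B: "B = box_nbhd z0 N \<epsilon>" "\<epsilon> > 0" and U: "p \<in> U" "U \<subseteq> U1" "U \<subseteq> \<Omega>m (N + 2)" "U1 \<subseteq> \<Omega>m N"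
    and trU: "tr N ` (Rsp (N + 2) \<inter> U) = Rsp N \<inter> U1"
    using exists_charts by (elim exE conjE) (rule that; assumption)
  note D1 = ldiffeoD[OF d1] and D2 = ldiffeoD[OF d2]
  define UR where "UR = Rsp (N + 2) \<inter> U"
  define Vx where "Vx = Rsp N \<inter> B"
  define \<Phi> where "\<Phi> = (\<lambda>y i. if i < N then z i (pad N y) else 0)"
  define \<Psi> where "\<Psi> = (\<lambda>q j. z (N + j) (pad (N + 2) q))"
  \<comment> \<open>The coefficients of the triangular form may depend on few coordinates only, even outside of
    the chart; freezing the others does not change their values inside, because \<open>B\<close> is a box.\<close>
  define clamp where "clamp = (\<lambda>w i. if i < Suc (n + \<nu>) then w i else z0 i)"
  \<comment> \<open>The 0-based index of \<zeta>_(K-1). For \<nu> > 0 its row carries the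
    coefficients a and b; the rows after it integrate u2, with \<open>w (l + 1)\<close> as drift and
    no first input.\<close>
  define L where "L = \<kappa> + \<nu> + K - 1"
  define a where "a = (\<lambda>l. if l = L then (\<lambda>w. acoef (pad N (G1 (clamp w)))) else (\<lambda>w. w (l + 1)))"
  define b where "b = (\<lambda>l. if l = L then (\<lambda>w. bcoef (pad N (G1 (clamp w)))) else (\<lambda>w::nat \<Rightarrow> real. 0))"
  have L: "Suc L = n + \<nu>" "L = n + \<nu> - 1" using dims(1-3) by (auto simp: L_def)
  have q1: "pad N q \<in> \<Omega>" and q2: "pad (N + 2) q \<in> \<Omega>" if "q \<in> U" for q
    using that U by (auto simp: \<Omega>m_def)
  have z12: "z i (pad N q) = z i (pad (N + 2) q)" if "q \<in> U" "i < N" for q i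
    by (rule same_value[OF fsmooth_\<Omega>[OF z_fsmooth] z_supp[OF _ that(2)] q1[OF that(1)] q2[OF that(1)]])
       (auto simp: pad_def)
  have tr1: "pad N (tr N q) = pad N q" for q by (rule pad_agree) (simp add: tr_def)
  have \<Phi>tr: "\<Phi> (tr N q) i = z i (pad (N + 2) q)" if "q \<in> U" "i < N" for q i
    using z12[OF that] that(2) by (simp add: \<Phi>_def tr1)
  have diff1: "diffeo N (tr N ` UR) Vx \<Phi>"
    unfolding UR_def trU Vx_def by (rule diffeo_of_ldiffeo[OF d1]) (auto simp: \<Phi>_def)
  have diff2: "diffeo (N + 2) UR (Rsp (N + 2) \<inter> V)
      (\<lambda>q i. if i < N then \<Phi> (tr N q) i else if i < N + 2 then \<Psi> q (i - N) else 0)"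
    unfolding UR_def by (rule diffeo_of_ldiffeo[OF d2]) (use \<Phi>tr in \<open>auto simp: \<Psi>_def\<close>)
  have rVx: "ropen N Vx" unfolding Vx_def by (rule ropen_cylinder[OF D1(2,4)])
  have clampB: "clamp w \<in> B" if "w \<in> B" for w
    using that B(2) by (auto simp: B(1) clamp_def box_nbhd_def)
  have csmooth_clamp: "csmooth S (\<lambda>w. clamp w i)" for S i
    using csmooth_coord csmooth_const by (cases "i < Suc (n + \<nu>)") (auto simp: clamp_def)
  have lindN: "indep (\<lambda>i. diff_at q (z i)) {..<N}" if "q \<in> \<Omega>" for q
    by (rule indep_subset[OF indep_z[OF that]]) auto
  let ?FA = "\<lambda>w. acoef (pad N (G1 w))" and ?Fb = "\<lambda>w. bcoef (pad N (G1 w))"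
  have coefs: "\<nu> > 0 \<Longrightarrow> csmooth B ?FA \<and> depends_below N ?FA \<and> csmooth B ?Fb \<and> depends_below N ?Fb \<and>
     (\<forall>w\<in>B. pd (n + \<nu>) ?FA w \<noteq> 0 \<and> ?FA (clamp w) = ?FA w \<and> ?Fb (clamp w) = ?Fb w \<and> ?Fb w \<noteq> 0)"
  proof -
    assume \<nu>: "\<nu> > 0"
    note ea = coordinate_expansion[OF d1 U(4) acoef_fsmooth acoef_span(3)[OF _ \<nu>]]
    have bs: "pd c bcoef q = 0" if "q \<in> \<Omega>" "c \<ge> N" for q c
      using bcoef_supp[OF that(1) _ \<nu>] that(2) by simp
    note eb = coordinate_expansion[OF d1 U(4) bcoef_fsmooth bs]
    have p0: "z0 \<in> B" using center_in_box_nbhd[OF B(2)] B(1) by simp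
    have sFA: "csmooth B ?FA" "depends_below N ?FA" using ea(2,3)[OF _ _ p0] by auto
    have sFb: "csmooth B ?Fb" "depends_below N ?Fb" using eb(2,3)[OF _ _ p0] by auto
    have za: "pd j ?FA w = 0" if w: "w \<in> B" and j: "j \<ge> Suc (n + \<nu>)" for w j
    proof (cases "j < N")
      case True
      show ?thesis
        by (rule coefficient_zero[OF lindN[OF ea(4)] ea(1) acoef_span(1)[OF ea(4) \<nu>] j True]) (use w in auto)
    next
      case False
      thus ?thesis using depends_below_pd_zero[OF sFA(2)] by simp
    qed
    have zb: "pd j ?Fb w = 0" if w: "w \<in> B" and j: "j \<ge> Suc (n + \<nu>)" for w j
    proof (cases "j < N")
      case True
      have "n + \<nu> \<le> j" using j by simp
      show ?thesis
        by (rule coefficient_zero[OF lindN[OF eb(4)] eb(1) bcoef_span[OF eb(4) \<nu>] \<open>n + \<nu> \<le> j\<close> True]) (use w in auto)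
    next
      case False
      thus ?thesis using depends_below_pd_zero[OF sFb(2)] by simp
    qed
    have "pd (n + \<nu>) ?FA w \<noteq> 0" if w: "w \<in> B" for w
      by (rule coefficient_nonzero[OF lindN[OF ea(4)] ea(1) acoef_span(1,2)[OF ea(4) \<nu>]]) (use w in auto)
    moreover have "?FA (clamp w) = ?FA w" if w: "w \<in> B" for w
      by (rule constant_on_box[of z0 N \<epsilon> ?FA N "Suc (n + \<nu>)"])
         (use sFA za w clampB[OF w] in \<open>auto simp: B(1) clamp_def\<close>)
    moreover have "?Fb (clamp w) = ?Fb w" if w: "w \<in> B" for w
      by (rule constant_on_box[of z0 N \<epsilon> ?Fb N "Suc (n + \<nu>)"])
         (use sFb zb w clampB[OF w] in \<open>auto simp: B(1) clamp_def\<close>)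
    moreover have "?Fb w \<noteq> 0" if w: "w \<in> B" for w
      by (rule bcoef_nz[OF _ \<nu>]) (use eb(4)[OF _ _ w] in auto)
    ultimately show ?thesis using sFA sFb by blast
  qed
  have f3: "smooth_fun N Vx (a l) \<and> smooth_fun N Vx (b l) \<and>
      (\<forall>w w'. (\<forall>i<l + 2. w i = w' i) \<longrightarrow> a l w = a l w' \<and> b l w = b l w') \<and>
      (\<forall>w\<in>Vx. pd (l + 1) (a l) w \<noteq> 0 \<or> pd (l + 1) (b l) w \<noteq> 0)" if l: "L \<le> l \<and> l \<le> N - 2" for l
  proof (cases "l = L")
    case False
    have "smooth_fun N Vx (\<lambda>w. w (l + 1))" "smooth_fun N Vx (\<lambda>w. 0)"
      using smooth_fun_congI[OF rVx csmooth_coord[of UNIV]] smooth_fun_congI[OF rVx csmooth_const[of UNIV]] by auto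
    thus ?thesis using False by (simp add: a_def b_def pd_coord)
  next
    case True
    \<comment> \<open>Without prolongation \<open>L\<close> is the index of the last row, beyond N -
      2.\<close>
    have \<nu>: "\<nu> > 0" using l True L dims(1-3) by linarith
    note c = coefs[OF \<nu>]
    have "csmooth B (\<lambda>w. ?FA (clamp w))" "csmooth B (\<lambda>w. ?Fb (clamp w))"
      using csmooth_comp[of B B ?FA N clamp] csmooth_comp[of B B ?Fb N clamp] c D1(2) csmooth_clamp clampB by blast+
    hence "smooth_fun N Vx (a l)" "smooth_fun N Vx (b l)"
      using smooth_fun_congI[OF rVx] True by (auto simp: a_def b_def Vx_def)
    moreover have "a l w = a l w' \<and> b l w = b l w'" if e: "\<forall>i<l + 2. w i = w' i" for w w'
    proof -
      have "clamp w = clamp w'" using e True L(1) by (auto simp: clamp_def fun_eq_iff)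
      thus ?thesis using True by (simp add: a_def b_def)
    qed
    moreover have "pd (l + 1) (a l) w \<noteq> 0" if w: "w \<in> Vx" for w
    proof -
      have l1: "l + 1 = n + \<nu>" using True L(1) by simp
      have "clamp (w(n + \<nu> := t)) = (clamp w)(n + \<nu> := t)" for t by (auto simp: clamp_def)
      moreover have "clamp w (n + \<nu>) = w (n + \<nu>)" by (simp add: clamp_def)
      ultimately have "pd (l + 1) (a l) w = pd (n + \<nu>) ?FA (clamp w)"
        unfolding l1 using True by (simp add: a_def pd_def)
      thus ?thesis using c clampB w by (auto simp: Vx_def)
    qed
    ultimately show ?thesis by blast
  qed
  have f4: "b L w \<noteq> 0" if "\<kappa> + \<nu> + K < N" "w \<in> Vx" for w
  proof -
    have "\<nu> > 0" using that(1) dims(1) by linarith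
    from coefs[OF this] show ?thesis using clampB that(2) by (auto simp: b_def Vx_def)
  qed
  have f5: "tder n f g1 g2 N (\<lambda>p. \<Phi> p i) q
      = gtf_rhs (\<kappa> + \<nu>) K N a b (\<Phi> (tr N q)) (\<Psi> q 0) (\<Psi> q 1) i" if q: "q \<in> UR" and i: "i < N" for q i
  proof -
    have qU: "q \<in> U" using q by (simp add: UR_def)
    let ?q2 = "pad (N + 2) q"
    have "(\<lambda>y. \<Phi> y i) = (\<lambda>y. z i (pad N y))" using i by (simp add: \<Phi>_def)
    hence lhs: "tder n f g1 g2 N (\<lambda>p. \<Phi> p i) q = D (z i) ?q2"
      using tder_z[OF q1[OF qU] q2[OF qU] i] by simp
    have \<Psi>: "\<Psi> q 0 = z N ?q2" "\<Psi> q 1 = z (Suc N) ?q2" by (simp_all add: \<Psi>_def)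
    note d = dims(1-3)
    have L1: "\<kappa> + \<nu> + K - 1 = L" by (simp add: L_def)
    consider "i < \<kappa> + \<nu> - 1" | "i = \<kappa> + \<nu> - 1" | "\<kappa> + \<nu> \<le> i" "i < n + \<nu> - 1"
      | "i = n + \<nu> - 1" "\<nu> = 0" | "i = n + \<nu> - 1" "\<nu> > 0" | "n + \<nu> \<le> i" "i < N - 1" | "n + \<nu> \<le> i" "i = N - 1"
      using i by linarith
    thus ?thesis
    proof cases
      case 1
      have "Suc i < N" using 1 d by linarith
      thus ?thesis unfolding lhs D_z(1)[OF i 1] gtf_rhs_def using 1 \<Phi>tr[OF qU] by simp
    next
      case 2
      thus ?thesis unfolding lhs D_z(2)[OF i 2] gtf_rhs_def using \<Psi>(1) d by simp
    next
      case 3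
      have "Suc i < N" "\<not> i < \<kappa> + \<nu> - 1" "i \<noteq> \<kappa> + \<nu> - 1" "i < L" using 3 d L(2) by linarith+
      thus ?thesis unfolding lhs D_z(3)[OF i 3] gtf_rhs_def L1 using \<Phi>tr[OF qU] by simp
    next
      \<comment> \<open>Without prolongation the derivative of \<zeta>_(K-1) is the second input
        itself.\<close>
      case 4
      have "\<not> i < \<kappa> + \<nu> - 1" "i \<noteq> \<kappa> + \<nu> - 1" "\<not> i < L" "\<not> i < N - 1" using 4 d L(2) by linarith+
      thus ?thesis unfolding lhs D_z(4)[OF i 4(1)] gtf_rhs_def L1 \<Psi>(2) z_eq(5) using 4(2) by simp
    next
      case 5
      have c: "\<not> i < \<kappa> + \<nu> - 1" "i \<noteq> \<kappa> + \<nu> - 1" "\<not> i < L" "i < N - 1" "i = L" using 5 d L(2) by linarith+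
      let ?w = "\<Phi> (tr N q)"
      have ZB: "?Z1 q \<in> B" using D1(5) U(2) qU by blast
      have we: "?w j = ?Z1 q j" if "j < N" for j using that by (simp add: \<Phi>_def tr1)
      have wB: "?w \<in> B" by (rule cylinderD[OF D1(4) ZB]) (simp add: we)
      \<comment> \<open>The inverse chart returns the state of \<open>q\<close>, so the coefficients
        computed in chart coordinates take the values of \<open>acoef\<close> and
        \<open>bcoef\<close> there.\<close>
      have "pad N (G1 ?w) = pad N q"
      proof (rule pad_agree)
        fix j assume j: "j < N"
        have "G1 ?w j = G1 (?Z1 q) j" by (rule ldiffeo_agree(2)[OF d1 we j])
        thus "G1 ?w j = q j" using D1(6)[of q] U(2) qU by auto
      qed
      moreover have "?FA (clamp ?w) = ?FA ?w" "?Fb (clamp ?w) = ?Fb ?w" using coefs[OF 5(2)] wB by auto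
      ultimately have ab: "a i ?w = acoef (pad N q)" "b i ?w = bcoef (pad N q)"
        using c(5) by (simp_all add: a_def b_def)
      have "acoef (pad N q) = acoef ?q2"
        by (rule same_value[OF acoef_fsmooth acoef_span(3)[OF _ 5(2)] q1[OF qU] q2[OF qU]]) (auto simp: pad_def)
      moreover have "bcoef (pad N q) = bcoef ?q2"
        by (rule same_value[OF bcoef_fsmooth bcoef_supp[OF _ _ 5(2)] q1[OF qU] q2[OF qU]]) (auto simp: pad_def)
      moreover have "\<zeta> K ?q2 = acoef ?q2 + bcoef ?q2 * \<psi> (\<kappa> + \<nu>) ?q2" by (simp add: acoef_def)
      ultimately have "\<zeta> K ?q2 = a i ?w + b i ?w * \<Psi> q 0" using ab \<Psi>(1) z_eq(4) by simp
      thus ?thesis unfolding lhs D_z(4)[OF i 5(1)] gtf_rhs_def L1 using c by simp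
    next
      case 6
      have c: "\<not> i < \<kappa> + \<nu> - 1" "i \<noteq> \<kappa> + \<nu> - 1" "\<not> i < L" "i \<noteq> L" "Suc i < N" using 6 d L(2) by linarith+
      thus ?thesis unfolding lhs D_z(5)[OF i 6] gtf_rhs_def L1 using \<Phi>tr[OF qU c(5)] 6 by (simp add: a_def b_def)
    next
      case 7
      have c: "\<not> i < \<kappa> + \<nu> - 1" "i \<noteq> \<kappa> + \<nu> - 1" "\<not> i < L" "\<not> i < N - 1" using 7 d L(2) by linarith+
      show ?thesis unfolding lhs D_z(6)[OF i 7] gtf_rhs_def L1 \<Psi>(2) using c by simp
    qed
  qed
  have f6: "\<Phi> (tr N q) 0 = \<phi>1 (tr n q) \<and> \<Phi> (tr N q) (\<kappa> + \<nu>) = \<phi>2 (tr n q)" if "q \<in> UR" for q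
  proof -
    have t: "tr n (pad N q) = tr n q" by (auto simp: tr_def pad_def)
    have "0 < N" "\<kappa> + \<nu> < N" "0 < \<kappa> + \<nu>" "\<kappa> + \<nu> < n + \<nu>" using dims(1-3) by linarith+
    thus ?thesis using z_eq(1)[of 0] z_eq(2)[of "\<kappa> + \<nu>"] t \<psi>_0 \<zeta>_0 by (simp add: \<Phi>_def tr1)
  qed
  have "GTF_equiv n f g1 g2 \<phi>1 \<phi>2 \<nu> UR"
    unfolding GTF_equiv_def Let_def
  proof (intro exI conjI)
    show "1 \<le> \<kappa> + \<nu>" "1 \<le> K" "\<kappa> + \<nu> + K \<le> N" using dims(1-3) by linarith+
    show "diffeo N (tr N ` UR) Vx \<Phi>" by (rule diff1)
    show "diffeo (N + 2) UR (Rsp (N + 2) \<inter> V)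
      (\<lambda>q i. if i < N then \<Phi> (tr N q) i else if i < N + 2 then \<Psi> q (i - N) else 0)" by (rule diff2)
    show "\<forall>l. \<kappa> + \<nu> + K - 1 \<le> l \<and> l \<le> N - 2 \<longrightarrow>
           smooth_fun N Vx (a l) \<and> smooth_fun N Vx (b l) \<and>
           (\<forall>z z'. (\<forall>i<l + 2. z i = z' i) \<longrightarrow> a l z = a l z' \<and> b l z = b l z') \<and>
           (\<forall>z\<in>Vx. pd (l + 1) (a l) z \<noteq> 0 \<or> pd (l + 1) (b l) z \<noteq> 0)"
      using f3 unfolding L_def by blast
    show "\<kappa> + \<nu> + K < N \<longrightarrow> (\<forall>z\<in>Vx. b (\<kappa> + \<nu> + K - 1) z \<noteq> 0)" using f4 unfolding L_def by blast
    show "\<forall>q\<in>UR. \<forall>i<N. tder n f g1 g2 N (\<lambda>p. \<Phi> p i) q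
             = gtf_rhs (\<kappa> + \<nu>) K N a b (\<Phi> (tr N q)) (\<Psi> q 0) (\<Psi> q 1) i" using f5 by blast
    show "(\<forall>q\<in>UR. \<Phi> (tr N q) 0 = \<phi>1 (tr n q) \<and> \<Phi> (tr N q) (\<kappa> + \<nu>) = \<phi>2 (tr n q)) \<or>
          (\<forall>q\<in>UR. \<Phi> (tr N q) 0 = \<phi>2 (tr n q) \<and> \<Phi> (tr N q) (\<kappa> + \<nu>) = \<phi>1 (tr n q))" using f6 by blast
  qed
  moreover have "ropen (N + 2) UR" unfolding UR_def by (rule ropen_cylinder[OF D2(1,3)])
  moreover have "tr (N + 2) p \<in> UR"
    unfolding UR_def using tr_in_Rsp cylinderD[OF D2(3) U(1), of "tr (N + 2) p"] by (auto simp: tr_def)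
  moreover have "UR \<subseteq> tr (N + 2) ` Om"
  proof
    fix q assume q: "q \<in> UR"
    hence "pad (N + 2) q \<in> Om" using q2[of q] box by (auto simp: UR_def)
    moreover have "tr (N + 2) (pad (N + 2) q) = tr (N + 2) q" by (auto simp: tr_def pad_def)
    hence "tr (N + 2) (pad (N + 2) q) = q" using q tr_Rsp[of q "N + 2"] by (simp add: UR_def)
    ultimately show "q \<in> tr (N + 2) ` Om" by (metis image_eqI)
  qed
  ultimately show ?thesis by blast
qed

end

section \<open>From flat outputs to the triangular form\<close>

lemma GTF_equiv_swap: "GTF_equiv n f g1 g2 \<phi>1 \<phi>2 \<nu> U \<Longrightarrow> GTF_equiv n f g1 g2 \<phi>2 \<phi>1 \<nu> U"
  unfolding GTF_equiv_def Let_def by (subst disj_commute)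

text \<open>The least order with an input component gives \<kappa>, and any nonzero component there
  may serve as pivot \<open>c0\<close>. What remains is shrinking: to where the pivot has no zero,
  to generic points, and to a box.\<close>

lemma gtf_point:
  assumes j: "flat_jets n (jetW n f g1 g2) Om (\<lambda>k. jder n f g1 g2 k \<phi>1) (\<lambda>k. jder n f g1 g2 k \<phi>2) r1 r2"
    and dep: "\<exists>k. \<exists>q\<in>Om. \<exists>c\<ge>n. pd c (jder n f g1 g2 k \<phi>1) q \<noteq> 0"
  shows "\<exists>p\<in>Om. \<exists>\<nu> U. \<nu> + n \<le> r1 + r2 \<and> ropen (n + 2 * \<nu> + 2) U \<and> tr (n + 2 * \<nu> + 2) p \<in> U \<and>
    U \<subseteq> tr (n + 2 * \<nu> + 2) ` Om \<and> GTF_equiv n f g1 g2 \<phi>1 \<phi>2 \<nu> U"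
proof -
  let ?\<psi> = "\<lambda>k. jder n f g1 g2 k \<phi>1" and ?\<zeta> = "\<lambda>k. jder n f g1 g2 k \<phi>2"
  interpret flat_jets n "jetW n f g1 g2" Om ?\<psi> ?\<zeta> r1 r2 by (rule j)
  let ?P = "\<lambda>k. \<exists>q\<in>Om. \<exists>c\<ge>n. pd c (?\<psi> k) q \<noteq> 0"
  define \<kappa> where "\<kappa> = (LEAST k. ?P k)"
  have "?P \<kappa>" unfolding \<kappa>_def by (rule LeastI_ex) (rule dep)
  then obtain q c0 where q: "q \<in> Om" "c0 \<ge> n" "pd c0 (?\<psi> \<kappa>) q \<noteq> 0" by blast
  have low: "pd c (?\<psi> k) r = 0" if "k < \<kappa>" "r \<in> Om" "c \<ge> n" for k r c
    using not_less_Least[of k ?P] that unfolding \<kappa>_def[symmetric] by blast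
  have "c0 < n + 2"
  proof (rule ccontr)
    assume "\<not> c0 < n + 2"
    hence "pd c0 (?\<psi> \<kappa>) q = 0" by (intro jetseq_low[OF \<psi> open_Om subset_refl low q(1)]) auto
    thus False using q by blast
  qed
  define c1 where "c1 = (if c0 = n then n + 1 else n)"
  have c01: "{c0, c1} = {n, n + 1}" using \<open>c0 < n + 2\<close> q(2) by (auto simp: c1_def)
  have "\<kappa> \<ge> 1"
  proof (rule ccontr)
    assume "\<not> \<kappa> \<ge> 1"
    hence "\<kappa> = 0" by simp
    thus False using q \<psi> unfolding jetseq_def by blast
  qed
  define U where "U = {q \<in> Om. pd c0 (?\<psi> \<kappa>) q \<noteq> 0}"
  have Uo: "open U" unfolding U_def by (rule open_nonzero[OF open_Om fsmooth_csmooth[OF fsmooth_pd[OF \<psi>_fsmooth]]])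
  have Un: "U \<noteq> {}" "U \<subseteq> Om" using q by (auto simp: U_def)
  interpret pv: pivot_jets n "jetW n f g1 g2" Om ?\<psi> ?\<zeta> r1 r2 U \<kappa> c0 c1
    by unfold_locales (use Uo Un c01 low in \<open>auto simp: U_def\<close>)
  obtain V \<kappa>2 where V: "open V" "V \<noteq> {}" "V \<subseteq> U"
    and fp: "\<And>q. q \<in> V \<Longrightarrow> flat_point n \<kappa> c0 c1 (\<lambda>k. diff_at q (?\<psi> k)) (\<lambda>k. diff_at q (?\<zeta> k)) pv.K \<kappa>2 r1 r2"
    using pv.generic_flat_point[OF \<open>\<kappa> \<ge> 1\<close>] by blast
  obtain p where p: "p \<in> V" using V(2) by blast
  obtain M \<delta> where M: "\<delta> > 0" "M \<ge> n + 2 * flat_point.s pv.K \<kappa>2 + 2" "box_nbhd p M \<delta> \<subseteq> V"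
    using open_contains_box_nbhd_ge[OF V(1) p] by blast
  interpret gc: gtf_chart n "jetW n f g1 g2" Om ?\<psi> ?\<zeta> r1 r2 f g1 g2 \<phi>1 \<phi>2 p M \<delta> \<kappa> c0 c1 pv.K \<kappa>2
  proof (rule gtf_chart.intro[OF j], rule gtf_chart_axioms.intro)
    show "box_nbhd p M \<delta> \<subseteq> Om" using M(3) V(3) Un(2) by blast
    show "flat_point n \<kappa> c0 c1 (\<lambda>k. diff_at q (?\<psi> k)) (\<lambda>k. diff_at q (?\<zeta> k)) pv.K \<kappa>2 r1 r2"
      if "q \<in> box_nbhd p M \<delta>" for q
      by (rule fp) (use that M(3) in blast)
  qed (use M in \<open>simp_all add: fun_eq_iff\<close>)
  show ?thesis
    using gc.gtf_equiv gc.dims(9) p V(3) Un(2)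
    by (intro bexI[of _ p] exI[of _ "flat_point.s pv.K \<kappa>2"]) blast+
qed

lemma x_flat_imp_flat_jets:
  assumes sys: "affine2_system n X0 f g1 g2" and flat: "x_flat_output n f g1 g2 X0 Om \<phi>1 \<phi>2 r1 r2"
    and O: "open O'" "O' \<subseteq> Om"
  shows "flat_jets n (jetW n f g1 g2) O' (\<lambda>k. jder n f g1 g2 k \<phi>1) (\<lambda>k. jder n f g1 g2 k \<phi>2) r1 r2"
proof -
  let ?W = "jetW n f g1 g2" and ?\<psi> = "\<lambda>k. jder n f g1 g2 k \<phi>1" and ?\<zeta> = "\<lambda>k. jder n f g1 g2 k \<phi>2"
  let ?Yx = "\<lambda>p k. if k < r1 then jder n f g1 g2 k \<phi>1 p
                      else if k < r1 + r2 then jder n f g1 g2 (k - r1) \<phi>2 p else 0"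
  let ?Yu = "\<lambda>p k. if k < r1 + 1 then jder n f g1 g2 k \<phi>1 p
                      else if k < r1 + r2 + 2 then jder n f g1 g2 (k - (r1 + 1)) \<phi>2 p else 0"
  have \<phi>: "smooth_fun n X0 \<phi>1" "smooth_fun n X0 \<phi>2" and trX: "\<And>p. p \<in> O' \<Longrightarrow> tr n p \<in> X0"
    using flat O unfolding x_flat_output_def by blast+
  obtain Fx Fu V1 V2 where F: "\<And>i. i < n \<Longrightarrow> smooth_fun (r1 + r2) V1 (Fx i)"
      "\<And>j. j < 2 \<Longrightarrow> smooth_fun (r1 + r2 + 2) V2 (Fu j)"
    and Y: "\<And>p. p \<in> O' \<Longrightarrow> ?Yx p \<in> V1" "\<And>p. p \<in> O' \<Longrightarrow> ?Yu p \<in> V2"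
      "\<And>p i. p \<in> O' \<Longrightarrow> i < n \<Longrightarrow> p i = Fx i (?Yx p)" "\<And>p j. p \<in> O' \<Longrightarrow> j < (2::nat) \<Longrightarrow> p (n + j) = Fu j (?Yu p)"
  proof -
    from flat[unfolded x_flat_output_def Let_def]
    obtain Fx Fu V1 V2 where *: "\<forall>i<n. smooth_fun (r1 + r2) V1 (Fx i)" "\<forall>j<2. smooth_fun (r1 + r2 + 2) V2 (Fu j)"
      "\<forall>p\<in>Om. ?Yx p \<in> V1 \<and> ?Yu p \<in> V2 \<and> (\<forall>i<n. p i = Fx i (?Yx p)) \<and> (\<forall>j<2. p (n + j) = Fu j (?Yu p))"
      by blast
    show ?thesis
      by (rule that[of V1 Fx V2 Fu]) (use * O(2) in blast)+
  qed
  have fSM: "fsmooth O' (\<lambda>p. f i (tr n p))" "fsmooth O' (\<lambda>p. g1 i (tr n p))" "fsmooth O' (\<lambda>p. g2 i (tr n p))" if "i < n" for i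
    using sys that smooth_fun_imp_fsmooth trX unfolding affine2_system_def by blast+
  have W_fsmooth: "fsmooth O' (?W c)" for c
    using fSM[of c] by (auto simp: jetW_def intro!: fsmooth_add fsmooth_mult fsmooth_coord O)
  interpret control_field n ?W O'
  proof
    show "depends_below (n + 2) (?W i)" if "i < n" for i by (rule depends_below_jetW[OF that order_refl])
  qed (use O W_fsmooth in \<open>auto simp: jetW_def\<close>)
  have jets: "jetseq (\<lambda>k. jder n f g1 g2 k \<phi>)" if "smooth_fun n X0 \<phi>" for \<phi>
  proof -
    have "fsmooth O' (jder n f g1 g2 k \<phi>)" for k
    proof (induction k)
      case 0
      have "jder n f g1 g2 0 \<phi> = (\<lambda>p. \<phi> (tr n p))" by simp
      thus ?case using smooth_fun_imp_fsmooth[OF that trX] by simp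
    next
      case (Suc k)
      show ?case unfolding jder_Suc by (rule fsmooth_D[OF Suc])
    qed
    moreover have "pd c (jder n f g1 g2 0 \<phi>) p = 0" if "c \<ge> n" for c p
      by (rule depends_below_pd_zero[OF _ that]) (use depends_below_jder[of n 0] in simp)
    ultimately show ?thesis unfolding jetseq_def using jder_Suc by blast
  qed
  have sSM: "csmooth O' (?\<psi> k)" "csmooth O' (?\<zeta> k)" for k
    using jets[OF \<phi>(1)] jets[OF \<phi>(2)] fsmooth_csmooth by (auto simp: jetseq_def)
  show ?thesis
  proof
    show "jetseq ?\<psi>" "jetseq ?\<zeta>" by (rule jets[OF \<phi>(1)], rule jets[OF \<phi>(2)])
    show "covec i \<in> fv.span (diff_at p ` (?\<psi> ` {..<r1} \<union> ?\<zeta> ` {..<r2}))" if p: "p \<in> O'" and i: "i < n" for p i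
    proof -
      have s: "csmooth O' (\<lambda>p. ?Yx p k)" for k using sSM csmooth_const by (cases "k < r1"; cases "k < r1 + r2") auto
      have "covec i \<in> fv.span ((\<lambda>k. diff_at p (\<lambda>p. ?Yx p k)) ` {..<r1 + r2})"
        by (rule composite_span[where F = "Fx i" and Y = ?Yx, OF O(1) F(1)[OF i] s Y(1) Y(3)[OF _ i] p])
      thus ?thesis
      proof (rule span_monoD)
        show "(\<lambda>k. diff_at p (\<lambda>p. ?Yx p k)) ` {..<r1 + r2} \<subseteq> diff_at p ` (?\<psi> ` {..<r1} \<union> ?\<zeta> ` {..<r2})"
        proof
          fix x assume "x \<in> (\<lambda>k. diff_at p (\<lambda>p. ?Yx p k)) ` {..<r1 + r2}"
          then obtain k where k: "k < r1 + r2" "x = diff_at p (\<lambda>p. ?Yx p k)" by blast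
          show "x \<in> diff_at p ` (?\<psi> ` {..<r1} \<union> ?\<zeta> ` {..<r2})"
          proof (cases "k < r1")
            case True
            thus ?thesis unfolding k(2) by simp
          next
            case False
            hence "k - r1 < r2" using k(1) by simp
            thus ?thesis unfolding k(2) using False k(1) by simp
          qed
        qed
      qed
    qed
    show "covec (n + j) \<in> fv.span (diff_at p ` (?\<psi> ` {..r1} \<union> ?\<zeta> ` {..r2}))" if p: "p \<in> O'" and j: "j < 2" for p j
    proof -
      have s: "csmooth O' (\<lambda>p. ?Yu p k)" for k using sSM csmooth_const by (cases "k < r1 + 1"; cases "k < r1 + r2 + 2") auto
      have "covec (n + j) \<in> fv.span ((\<lambda>k. diff_at p (\<lambda>p. ?Yu p k)) ` {..<r1 + r2 + 2})"
        by (rule composite_span[where F = "Fu j" and Y = ?Yu, OF O(1) F(2)[OF j] s Y(2) Y(4)[OF _ j] p])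
      thus ?thesis
      proof (rule span_monoD)
        show "(\<lambda>k. diff_at p (\<lambda>p. ?Yu p k)) ` {..<r1 + r2 + 2} \<subseteq> diff_at p ` (?\<psi> ` {..r1} \<union> ?\<zeta> ` {..r2})"
        proof
          fix x assume "x \<in> (\<lambda>k. diff_at p (\<lambda>p. ?Yu p k)) ` {..<r1 + r2 + 2}"
          then obtain k where k: "k < r1 + r2 + 2" "x = diff_at p (\<lambda>p. ?Yu p k)" by blast
          show "x \<in> diff_at p ` (?\<psi> ` {..r1} \<union> ?\<zeta> ` {..r2})"
          proof (cases "k < r1 + 1")
            case True
            thus ?thesis unfolding k(2) by simp
          next
            case False
            hence "k - (r1 + 1) \<le> r2" using k(1) by simp
            thus ?thesis unfolding k(2) using False k(1) by simp
          qed
        qed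
      qed
    qed
  qed
qed

lemma flat_jets_swap:
  assumes "flat_jets n W Om \<psi> \<zeta> r1 r2"
  shows "flat_jets n W Om \<zeta> \<psi> r2 r1"
proof -
  interpret flat_jets n W Om \<psi> \<zeta> r1 r2 by (rule assms)
  show ?thesis
    by unfold_locales (use \<psi> \<zeta> flat_x flat_u in \<open>auto simp: Un_commute\<close>)
qed

text \<open>If no derivative of either component contained an input, the inputs could not be
  recovered. A component that does contain one takes the part of \<psi>, which is why the order of
  the two components in the form is left open.\<close>

lemma exists_gtf_point:
  assumes "affine2_system n X0 f g1 g2" "x_flat_output n f g1 g2 X0 Om \<phi>1 \<phi>2 r1 r2"
    and O: "open O'" "O' \<noteq> {}" "O' \<subseteq> Om"
  shows "\<exists>p\<in>O'. \<exists>\<nu> U. \<nu> + n \<le> r1 + r2 \<and> ropen (n + 2 * \<nu> + 2) U \<and> tr (n + 2 * \<nu> + 2) p \<in> U \<and>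
    U \<subseteq> tr (n + 2 * \<nu> + 2) ` O' \<and> GTF_equiv n f g1 g2 \<phi>1 \<phi>2 \<nu> U"
proof -
  let ?\<psi> = "\<lambda>k. jder n f g1 g2 k \<phi>1" and ?\<zeta> = "\<lambda>k. jder n f g1 g2 k \<phi>2"
  have j: "flat_jets n (jetW n f g1 g2) O' ?\<psi> ?\<zeta> r1 r2"
    by (rule x_flat_imp_flat_jets[OF assms(1,2) O(1,3)])
  interpret flat_jets n "jetW n f g1 g2" O' ?\<psi> ?\<zeta> r1 r2 by (rule j)
  have "(\<exists>k. \<exists>q\<in>O'. \<exists>c\<ge>n. pd c (?\<psi> k) q \<noteq> 0) \<or> (\<exists>k. \<exists>q\<in>O'. \<exists>c\<ge>n. pd c (?\<zeta> k) q \<noteq> 0)"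
  proof (rule ccontr)
    assume no: "\<not> ?thesis"
    obtain q where q: "q \<in> O'" using O(2) by blast
    have "covec (n + 0) \<in> fv.span (diff_at q ` (?\<psi> ` {..r1} \<union> ?\<zeta> ` {..r2}))" by (rule flat_u[OF q]) simp
    hence "covec (n + 0) n = 0"
      by (rule span_component_zero) (use no q in \<open>auto simp: diff_at_def\<close>)
    thus False by (simp add: covec_def)
  qed
  thus ?thesis
  proof
    assume "\<exists>k. \<exists>q\<in>O'. \<exists>c\<ge>n. pd c (?\<psi> k) q \<noteq> 0"
    thus ?thesis by (rule gtf_point[OF j])
  next
    assume dep: "\<exists>k. \<exists>q\<in>O'. \<exists>c\<ge>n. pd c (?\<zeta> k) q \<noteq> 0"
    from gtf_point[OF flat_jets_swap[OF j] dep] obtain p \<nu> U where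
      "p \<in> O'" "\<nu> + n \<le> r2 + r1" "ropen (n + 2 * \<nu> + 2) U" "tr (n + 2 * \<nu> + 2) p \<in> U"
      "U \<subseteq> tr (n + 2 * \<nu> + 2) ` O'" "GTF_equiv n f g1 g2 \<phi>2 \<phi>1 \<nu> U" by blast
    thus ?thesis using GTF_equiv_swap[of n f g1 g2 \<phi>2 \<phi>1 \<nu> U]
      by (intro bexI[of _ p] exI[of _ \<nu>] exI[of _ U] conjI) (simp_all add: add.commute)
  qed
qed

text \<open>Generic points are those of a dense open subset \<open>W\<close>. Since \<nu> is a
  natural number and the points of \<open>W\<close> are plentiful, the bound also shows that the
  differential difference is not negative.\<close>

theorem theorem2:
  fixes n r1 r2 :: nat
    and f g1 g2 :: "nat \<Rightarrow> (nat \<Rightarrow> real) \<Rightarrow> real"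
    and X Om :: "(nat \<Rightarrow> real) set"
    and \<phi>1 \<phi>2 :: "(nat \<Rightarrow> real) \<Rightarrow> real"
  assumes "affine2_system n X f g1 g2"
    and "x_flat_output n f g1 g2 X Om \<phi>1 \<phi>2 r1 r2"
  shows "\<exists>W. open W \<and> W \<subseteq> Om \<and> Om \<subseteq> closure W \<and>
           (\<forall>p\<in>W. \<exists>\<nu> U. int \<nu> \<le> int r1 + int r2 - int n \<and>
               ropen (n + 2 * \<nu> + 2) U \<and> tr (n + 2 * \<nu> + 2) p \<in> U \<and>
               U \<subseteq> tr (n + 2 * \<nu> + 2) ` Om \<and>
               GTF_equiv n f g1 g2 \<phi>1 \<phi>2 \<nu> U)"
proof -
  define good where "good = (\<lambda>p \<nu> U. int \<nu> \<le> int r1 + int r2 - int n \<and>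
               ropen (n + 2 * \<nu> + 2) U \<and> tr (n + 2 * \<nu> + 2) p \<in> U \<and>
               U \<subseteq> tr (n + 2 * \<nu> + 2) ` Om \<and> GTF_equiv n f g1 g2 \<phi>1 \<phi>2 \<nu> U)"
  define W where "W = {p \<in> Om. \<exists>\<nu> U. good p \<nu> U}"
  have Om: "open Om" using assms(2) by (simp add: x_flat_output_def)
  have "open W"
  proof (subst open_subopen, rule ballI)
    fix p assume "p \<in> W"
    then obtain \<nu> U where p: "p \<in> Om" "good p \<nu> U" by (auto simp: W_def)
    \<comment> \<open>The set \<open>U\<close> found for one point serves every point whose
      truncation lies in it, which gives openness.\<close>
    let ?T = "Om \<inter> {q. tr (n + 2 * \<nu> + 2) q \<in> U}"
    have "open ?T" using Om p(2) by (auto simp: good_def ropen_iff)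
    moreover have "p \<in> ?T" using p by (simp add: good_def)
    moreover have "good q \<nu> U" if "q \<in> ?T" for q using that p(2) by (simp add: good_def)
    hence "?T \<subseteq> W" by (auto simp: W_def)
    ultimately show "\<exists>T. open T \<and> p \<in> T \<and> T \<subseteq> W" by blast
  qed
  moreover have "Om \<subseteq> closure W"
  proof
    fix p assume p: "p \<in> Om"
    have "W \<inter> S \<noteq> {}" if S: "open S" "p \<in> S" for S
    proof -
      \<comment> \<open>Density: flatness passes to smaller open sets, so the local result can be
        applied inside any neighbourhood \<open>S\<close>.\<close>
      have O: "open (Om \<inter> S)" "Om \<inter> S \<noteq> {}" "Om \<inter> S \<subseteq> Om" using Om S p by auto
      from exists_gtf_point[OF assms O] obtain q \<nu> U where q: "q \<in> Om \<inter> S" "\<nu> + n \<le> r1 + r2"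
        "ropen (n + 2 * \<nu> + 2) U" "tr (n + 2 * \<nu> + 2) q \<in> U" "U \<subseteq> tr (n + 2 * \<nu> + 2) ` (Om \<inter> S)"
        "GTF_equiv n f g1 g2 \<phi>1 \<phi>2 \<nu> U" by blast
      have "good q \<nu> U" using q by (auto simp: good_def)
      thus ?thesis using q(1) by (auto simp: W_def)
    qed
    from this[of "- closure W"] show "p \<in> closure W" using closure_subset[of W] by blast
  qed
  moreover have "W \<subseteq> Om" by (auto simp: W_def)
  ultimately show ?thesis unfolding W_def good_def by blast
qed

end
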